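(* For $p>1$, the Besov space $\mathfrak B_p$ is a Banach space with the norm $$\|f\|_{\mathfrak B_p}=|f(0)|+\sup_{i\in\mathbb S^2}\left[\int_{\mathbb B_i}(1-|z|^2)^p|\partial_{x_0}f(z)|^p\,d\lambda_i(z)\right]^{1/p}.$$
   Context: $\mathbb H$ denotes the quaternions with real part coordinate $x_0$, $\mathbb S^2$ the sphere of purely imaginary unit quaternions, $\mathbb C(i)=\{x+iy:x,y\in\mathbb R\}$ for $i\in\mathbb S^2$, $\mathbb B$ the open unit ball of $\mathbb H$, $\mathbb B_i=\mathbb B\cap\mathbb C(i)$. A real differentiable function $f:\mathbb B\to\mathbb H$ is (left) slice regular if for every $i\in\mathbb S^2$, $\left(\frac{\partial}{\partial x}+i\frac{\partial}{\partial y}\right)f(x+iy)=0$ on $\mathbb B_i$. $dA_i=\frac1\pi dx\,dy$ on $\mathbb B_i$ and $d\lambda_i(z)=\frac{dA_i(z)}{(1-|z|^2)^2}$. For $p>0$ and $n\in\mathbb N$ with $pn>1$, the slice regular Besov space $\mathfrak B_p$ is the quaternionic right linear space of slice regular functions $f$ on $\mathbb B$ such that $\sup_{i\in\mathbb S^2}\int_{\mathbb B_i}|(1-|z|^2)^n\partial_{x_0}^nf(z)|^pd\lambda_i(z)<\infty$ (the space does not depend on the choice of $n$). *)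

theory Defs
  imports "HOL-Analysis.Analysis"
begin

subsection \<open>Quaternions\<close>

text \<open>
  A quaternion is a pair of its real part and its vector part. The product type carries the
  componentwise real vector space structure and the Euclidean norm, which is the usual
  quaternionic absolute value; the product is
  $(a + u)(b + v) = (ab - u \cdot v) + (av + bu + u \times v)$.
\<close>

type_synonym quat = "real \<times> (real^3)"

definition qmult :: "quat \<Rightarrow> quat \<Rightarrow> quat"  (infixl \<open>*\<^sub>H\<close> 70) where
  "q *\<^sub>H r = (fst q * fst r - snd q \<bullet> snd r,
             fst q *\<^sub>R snd r + fst r *\<^sub>R snd q + cross3 (snd q) (snd r))"

definition quat_of_real :: "real \<Rightarrow> quat" where
  "quat_of_real x = (x, 0)"

lemma qmult_assoc: "(q *\<^sub>H r) *\<^sub>H s = q *\<^sub>H (r *\<^sub>H s)"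
  by (simp add: qmult_def prod_eq_iff cross3_simps forall_3)

lemma qmult_add_left: "(q + r) *\<^sub>H s = q *\<^sub>H s + r *\<^sub>H s"
  by (simp add: qmult_def prod_eq_iff cross3_simps forall_3)

lemma qmult_add_right: "q *\<^sub>H (r + s) = q *\<^sub>H r + q *\<^sub>H s"
  by (simp add: qmult_def prod_eq_iff cross3_simps forall_3)

lemma qmult_of_real_left: "quat_of_real x *\<^sub>H q = x *\<^sub>R q"
  by (simp add: qmult_def quat_of_real_def prod_eq_iff)

lemma qmult_of_real_right: "q *\<^sub>H quat_of_real x = x *\<^sub>R q"
  by (simp add: qmult_def quat_of_real_def prod_eq_iff)

lemma norm_qmult: "norm (q *\<^sub>H r) = norm q * norm r"
proof -
  have "(norm (q *\<^sub>H r))\<^sup>2 = (norm q * norm r)\<^sup>2"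
    unfolding power_mult_distrib power2_norm_eq_inner
    by (simp add: qmult_def inner_prod_def cross3_simps)
  then show ?thesis by (simp add: power2_eq_iff_nonneg)
qed

definition imag_units :: "quat set" where
  "imag_units = {q. fst q = 0 \<and> norm q = 1}"

lemma imag_units_square: "i \<in> imag_units \<Longrightarrow> i *\<^sub>H i = quat_of_real (-1)"
  by (auto simp: imag_units_def qmult_def quat_of_real_def norm_prod_def
      power2_norm_eq_inner[symmetric])

text \<open>The point $x + iy$ of the slice $\mathbb{C}(i)$, with $z = (x, y)$ given as a complex number.\<close>

definition slice :: "quat \<Rightarrow> complex \<Rightarrow> quat" where
  "slice i z = quat_of_real (Re z) + Im z *\<^sub>R i"

lemma norm_slice: "i \<in> imag_units \<Longrightarrow> norm (slice i z) = cmod z"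
  by (auto simp: imag_units_def slice_def quat_of_real_def norm_prod_def cmod_def power_mult_distrib)


subsection \<open>Slice regular functions\<close>

definition slice_regular :: "(quat \<Rightarrow> quat) \<Rightarrow> bool" where
  "slice_regular f \<longleftrightarrow>
     (\<forall>q\<in>ball 0 1. f differentiable (at q)) \<and>
     (\<forall>i\<in>imag_units. \<forall>x y. slice i (Complex x y) \<in> ball 0 1 \<longrightarrow>
        vector_derivative (\<lambda>t. f (slice i (Complex t y))) (at x)
        + i *\<^sub>H vector_derivative (\<lambda>t. f (slice i (Complex x t))) (at y) = 0)"

definition deriv_x0 :: "(quat \<Rightarrow> quat) \<Rightarrow> quat \<Rightarrow> quat" where
  "deriv_x0 f q = vector_derivative (\<lambda>t. f (q + quat_of_real t)) (at 0)"


subsection \<open>The Besov spaces\<close>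

text \<open>
  The measures $dA_i$ and $d\lambda_i$ in the coordinates $z = (x, y)$; they do not depend on $i$
  and are only integrated against over the unit disc.
\<close>

definition disc_A :: "complex measure" where
  "disc_A = density lborel (\<lambda>_. ennreal (1 / pi))"

definition disc_lambda :: "complex measure" where
  "disc_lambda = density disc_A (\<lambda>z. ennreal (1 / (1 - (cmod z)\<^sup>2)\<^sup>2))"

text \<open>
  A function on the unit ball is represented by its extension by zero, so that equality of
  members of the space is equality on the ball and the pointwise operations are the usual ones.
  The index \<open>n\<close> is the order of the derivative, meant to satisfy $pn > 1$. The supremum is
  taken in the extended nonnegative reals.
\<close>

definition besov_space :: "real \<Rightarrow> nat \<Rightarrow> (quat \<Rightarrow> quat) set" where
  "besov_space p n = {f. slice_regular f \<and> (\<forall>q. q \<notin> ball 0 1 \<longrightarrow> f q = 0) \<and>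
     (SUP i\<in>imag_units. \<integral>\<^sup>+z\<in>ball 0 1.
        ennreal (norm ((1 - (cmod z)\<^sup>2) ^ n *\<^sub>R (deriv_x0 ^^ n) f (slice i z)) powr p)
        \<partial>disc_lambda) < \<infinity>}"

definition ennreal_powr :: "ennreal \<Rightarrow> real \<Rightarrow> ennreal" where
  "ennreal_powr x a = (if x = \<infinity> then \<infinity> else ennreal (enn2real x powr a))"

definition besov_enorm :: "real \<Rightarrow> (quat \<Rightarrow> quat) \<Rightarrow> ennreal" where
  "besov_enorm p f = ennreal (norm (f 0)) +
     (SUP i\<in>imag_units. ennreal_powr
        (\<integral>\<^sup>+z\<in>ball 0 1.
           ennreal ((1 - (cmod z)\<^sup>2) powr p * norm (deriv_x0 f (slice i z)) powr p)
         \<partial>disc_lambda) (1 / p))"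

definition besov_norm :: "real \<Rightarrow> (quat \<Rightarrow> quat) \<Rightarrow> real" where
  "besov_norm p f = enn2real (besov_enorm p f)"


subsection \<open>Quaternionic right Banach spaces of functions\<close>

definition right_quat_subspace :: "('a \<Rightarrow> quat) set \<Rightarrow> bool" where
  "right_quat_subspace V \<longleftrightarrow>
     (\<lambda>_. 0) \<in> V \<and>
     (\<forall>f\<in>V. \<forall>g\<in>V. (\<lambda>x. f x + g x) \<in> V) \<and>
     (\<forall>f\<in>V. \<forall>c. (\<lambda>x. f x *\<^sub>H c) \<in> V)"

definition right_quat_norm_on :: "('a \<Rightarrow> quat) set \<Rightarrow> (('a \<Rightarrow> quat) \<Rightarrow> real) \<Rightarrow> bool" where
  "right_quat_norm_on V N \<longleftrightarrow>
     (\<forall>f\<in>V. 0 \<le> N f \<and> (N f = 0 \<longleftrightarrow> f = (\<lambda>_. 0))) \<and>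
     (\<forall>f\<in>V. \<forall>g\<in>V. N (\<lambda>x. f x + g x) \<le> N f + N g) \<and>
     (\<forall>f\<in>V. \<forall>c. N (\<lambda>x. f x *\<^sub>H c) = N f * norm c)"

definition norm_complete_on :: "('a \<Rightarrow> quat) set \<Rightarrow> (('a \<Rightarrow> quat) \<Rightarrow> real) \<Rightarrow> bool" where
  "norm_complete_on V N \<longleftrightarrow>
     (\<forall>F :: nat \<Rightarrow> 'a \<Rightarrow> quat.
        (\<forall>k. F k \<in> V) \<and>
        (\<forall>e>0. \<exists>K. \<forall>k\<ge>K. \<forall>m\<ge>K. N (\<lambda>x. F k x - F m x) < e)
        \<longrightarrow> (\<exists>f\<in>V. (\<lambda>k. N (\<lambda>x. F k x - f x)) \<longlonglongrightarrow> 0))"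

definition right_quat_banach_space :: "('a \<Rightarrow> quat) set \<Rightarrow> (('a \<Rightarrow> quat) \<Rightarrow> real) \<Rightarrow> bool" where
  "right_quat_banach_space V N \<longleftrightarrow>
     right_quat_subspace V \<and> right_quat_norm_on V N \<and> norm_complete_on V N"

end

theory Submission
  imports Defs "HOL-Complex_Analysis.Complex_Analysis"
begin

text \<open>
  For a unit $i$ the map $w \mapsto \langle w, v\rangle + \langle w, iv\rangle\,\mathrm{i}$ turns left
  multiplication by $x + iy$ into multiplication by $x + \mathrm{i}y$, so it turns the restriction of a
  slice regular function to a slice into a holomorphic function $u$ on the disc, and $\partial_{x_0}$
  into complex differentiation. All estimates are made for $u$, with constants independent of $i$.

  The spaces for different $n$ coincide because
  $\int |u|^p (1-|z|)^a$ and $|u(0)|^p + \int |u'|^p (1-|z|)^{a+p}$ are comparable for $a > -1$: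
  one direction is the mean value property together with Cauchy's inequality on discs of radius
  proportional to $1-|z|$, the other a weighted Hardy inequality along radii.

  For completeness, a Cauchy sequence converges locally uniformly. The power series
  $f(q) = \sum_m q^m a_m$ controls the full real derivative of a slice regular function by its
  supremum on a larger ball, so the limit is real differentiable and slice regular; Fatou's lemma
  gives convergence in norm.
\<close>

subsection \<open>Rotation invariance and the mean value property\<close>

text \<open>The k-th derivative times (1-|z|^2)^k, in p-th power against the invariant measure,
  carries the weight exponent kp - 2. Passing from order k to k+1 works for every exponent; the
  Hardy direction needs kp - 2 > -1. For k >= 1 this is guaranteed by p > 1, while k = 0 has
  exponent -2 and is out of reach. Hence every admissible order is compared with k = 1, the order
  that appears in the norm. The values that the Hardy inequality leaves behind are derivatives at 0,
  a point of every slice, so they cannot spoil the supremum over i.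

  The obstacle in completeness is that slice regularity demands real differentiability across
  slices, which no estimate on a single slice sees; only an expansion valid on the whole ball
  compares points of different slices.

  Polar coordinates are avoided: the mean value property comes from rotation invariance of area,
  radial integrals from dilations and an exchange of integrals.\<close>

text \<open>Carries the invariance of Lebesgue measure under orthogonal maps of
  \<open>real^2\<close> over to the complex plane.\<close>

definition vec2 :: "real^2 \<Rightarrow> complex" where "vec2 x = Complex (x$1) (x$2)"

lemma vec2_borel [measurable]: "vec2 \<in> borel_measurable borel"
  unfolding vec2_def Complex_eq by measurable

lemma vimage_vec2_box:
  "vec2 -` box l u = box (vector [Re l, Im l]) (vector [Re u, Im u])"
  by (auto simp: vec2_def box_def mem_box_cart forall_2 Basis_complex_def Basis_vec_def axis_def
      inner_vec_def sum_2 vector_2)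

lemma distr_vec2: "distr lborel borel vec2 = lborel"
proof (rule lborel_eqI[symmetric])
  fix l u :: complex assume le: "\<And>b. b \<in> Basis \<Longrightarrow> l \<bullet> b \<le> u \<bullet> b"
  have B: "(Basis :: (real^2) set) = {axis 1 1, axis 2 1}"
    by (auto simp: Basis_vec_def UNIV_2)
  show "emeasure (distr lborel borel vec2) (box l u) = ennreal (\<Prod>b\<in>Basis. (u - l) \<bullet> b)"
    using le[of 1] le[of \<i>]
    by (simp add: emeasure_distr vimage_vec2_box emeasure_lborel_box_eq B Basis_complex_def
        inner_axis axis_eq_axis)
qed simp

text \<open>By \<open>lborel_eqI\<close> it is enough to measure boxes. The preimage of a box under
  multiplication by \<open>c\<close> is its image under the inverse rotation, multiplication by
  \<open>cnj c\<close>, which is orthogonal and so keeps the area.\<close>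

lemma distr_rotate:
  assumes "cmod c = 1"
  shows "distr lborel borel ((*) c) = (lborel :: complex measure)"
proof (rule lborel_eqI[symmetric])
  fix l u :: complex assume le: "\<And>b. b \<in> Basis \<Longrightarrow> l \<bullet> b \<le> u \<bullet> b"
  define S where "S = (*) c -` box l u"
  define R :: "real^2 \<Rightarrow> real^2" where
    "R x = vector [Re (cnj c * vec2 x), Im (cnj c * vec2 x)]" for x
  have S [measurable]: "S \<in> sets borel"
    unfolding S_def by (intro borel_open open_vimage open_box continuous_intros)
  have cc: "c * cnj c = 1" "cnj c * c = 1"
    using assms by (simp_all add: complex_norm_square[symmetric] mult.commute)
  have v2R: "vec2 (R x) = cnj c * vec2 x" for x
    unfolding R_def by (simp add: vec2_def vector_2 complex_eq_iff)
  have inj: "x = y" if "vec2 x = vec2 y" for x y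
    using that by (simp add: vec2_def vec_eq_iff forall_2)
  have nrm: "norm x = cmod (vec2 x)" for x
    by (simp add: vec2_def norm_vec_def L2_set_def sum_2 cmod_def)
  have "linear R"
    by (rule linearI) (auto simp: R_def vec2_def vec_eq_iff forall_2 vector_2 algebra_simps)
  moreover have "norm (R x) = norm x" for x
    by (simp add: nrm v2R norm_mult assms)
  ultimately have orth: "orthogonal_transformation R"
    by (simp add: orthogonal_transformation)
  have T: "vec2 -` box l u \<in> lmeasurable"
    by (simp add: vimage_vec2_box)
  have eq: "vec2 -` S = R ` (vec2 -` box l u)"
  proof (intro set_eqI iffI)
    fix x assume x: "x \<in> vec2 -` S"
    define y :: "real^2" where "y = vector [Re (c * vec2 x), Im (c * vec2 x)]"
    have y: "vec2 y = c * vec2 x" by (simp add: y_def vec2_def vector_2 complex_eq_iff)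
    have "x = R y" by (rule inj) (simp add: v2R y mult.assoc[symmetric] cc)
    moreover have "y \<in> vec2 -` box l u" using x y by (simp add: S_def)
    ultimately show "x \<in> R ` (vec2 -` box l u)" by blast
  qed (auto simp: S_def v2R mult.assoc[symmetric] cc)
  have "emeasure (distr lborel borel ((*) c)) (box l u) = emeasure lborel S"
    by (subst emeasure_distr) (auto simp: S_def)
  also have "\<dots> = emeasure (distr lborel borel vec2) S"
    by (simp add: distr_vec2)
  also have "\<dots> = emeasure lebesgue (vec2 -` S)"
    by (subst emeasure_distr) (auto simp: measurable_sets_borel[OF vec2_borel])
  also have "\<dots> = ennreal (measure lebesgue (R ` (vec2 -` box l u)))"
    unfolding eq using measurable_orthogonal_image[OF orth T]
    by (auto simp: emeasure_eq_measure2 fmeasurableD2)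
  also have "\<dots> = emeasure lebesgue (vec2 -` box l u)"
    using T by (simp add: measure_orthogonal_image[OF orth T] emeasure_eq_measure2 fmeasurableD2)
  also have "\<dots> = emeasure (distr lborel borel vec2) (box l u)"
    by (subst emeasure_distr) (auto simp: measurable_sets_borel[OF vec2_borel])
  also have "\<dots> = ennreal (\<Prod>b\<in>Basis. (u - l) \<bullet> b)"
    using le by (simp add: distr_vec2 emeasure_lborel_box_eq)
  finally show "emeasure (distr lborel borel ((*) c)) (box l u) = ennreal (\<Prod>b\<in>Basis. (u - l) \<bullet> b)" .
qed simp

text \<open>The rotation by $c = e^{\mathrm{i}\pi/m}$ changes the sign of the integral, since $c^m = -1$.\<close>

lemma integral_power_ball:
  assumes "m > 0"
  shows "(\<integral>w. indicator (ball 0 r) w *\<^sub>R w ^ m \<partial>lborel) = (0::complex)"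
proof -
  define c where "c = cis (pi / m)"
  have c: "cmod c = 1" by (simp add: c_def)
  have cm: "c ^ m = -1"
    unfolding c_def by (subst Complex.DeMoivre) (use assms in simp)
  let ?f = "\<lambda>w::complex. indicator (ball 0 r) w *\<^sub>R w ^ m"
  have [measurable]: "(\<lambda>w::complex. w ^ m) \<in> borel_measurable borel" "ball (0::complex) r \<in> sets borel"
    by (intro borel_measurable_continuous_onI continuous_intros) simp
  have "(\<integral>w. ?f w \<partial>lborel) = (\<integral>w. ?f w \<partial>distr lborel borel ((*) c))"
    by (simp add: distr_rotate c)
  also have "\<dots> = (\<integral>w. ?f (c * w) \<partial>lborel)"
    by (rule integral_distr) measurable
  also have "\<dots> = (\<integral>w. - ?f w \<partial>lborel)"
    by (rule Bochner_Integration.integral_cong)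
       (auto simp: power_mult_distrib cm norm_mult c indicator_def)
  also have "\<dots> = - (\<integral>w. ?f w \<partial>lborel)" by simp
  finally show ?thesis by simp
qed

text \<open>The source of the Jensen and Minkowski steps below: a bound that is affine in
  \<open>x\<close> can be integrated without normalising the measure. The case x = 0 is computed
  directly because convexity is used on the open half-line.\<close>

lemma powr_above_tangent:
  fixes x y p :: real
  assumes "x \<ge> 0" "y > 0" "p \<ge> 1"
  shows "y powr p + p * y powr (p - 1) * (x - y) \<le> x powr p"
proof (cases "x = 0")
  case True
  have "y powr (p - 1) * y = y powr p"
    using assms powr_add[of y "p - 1" 1] by simp
  then have "y powr p + p * y powr (p - 1) * (x - y) = (1 - p) * y powr p"
    using True by (simp add: algebra_simps)
  also have "\<dots> \<le> 0" using assms by (simp add: mult_nonpos_nonneg)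
  finally show ?thesis using True by simp
next
  case False
  have "(x powr p - y powr p) \<ge> p * y powr (p - 1) * (x - y)"
  proof (rule convex_on_imp_above_tangent[of "{0<..}"])
    show "convex_on {0<..} (\<lambda>x. x powr p)" by (rule powr_convex) (use assms in auto)
    show "((\<lambda>x. x powr p) has_real_derivative p * y powr (p - 1)) (at y within {0<..})"
      using assms by (auto intro!: derivative_eq_intros)
  qed (use assms False in \<open>auto simp: interior_open\<close>)
  then show ?thesis by simp
qed

lemma set_integrable_ball:
  fixes g :: "complex \<Rightarrow> 'a::{banach, second_countable_topology}"
  assumes "continuous_on (cball z r) g"
  shows "set_integrable lborel (ball z r) g"
proof (rule set_integrable_subset)
  show "set_integrable lborel (cball z r) g"
    unfolding set_integrable_def by (rule borel_integrable_compact[OF _ assms]) simp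
qed auto

lemma measure_disc: "r \<ge> 0 \<Longrightarrow> measure lborel (ball (z::complex) r) = pi * r\<^sup>2"
  by (simp add: content_ball unit_ball_vol_2)

lemma emeasure_disc: "r \<ge> 0 \<Longrightarrow> emeasure lborel (ball (z::complex) r) = ennreal (pi * r\<^sup>2)"
  by (simp add: emeasure_ball unit_ball_vol_2)

lemma ball_in_borel [measurable]: "ball z r \<in> sets borel"
  by simp

text \<open>The Taylor series is integrated term by term over the disc; by
  \<open>integral_power_ball\<close> only the constant term survives.\<close>

lemma area_mean_value_0:
  fixes g :: "complex \<Rightarrow> complex"
  assumes hol: "g holomorphic_on ball 0 R" and r: "0 < r" "r < R"
  shows "(LINT w:ball 0 r|lborel. g w) = of_real (pi * r\<^sup>2) * g 0"
proof -
  define c where "c m = (deriv ^^ m) g 0 / fact m" for m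
  define s where "s N w = (\<Sum>m<N. c m * w ^ m)" for N w
  have sums: "(\<lambda>m. c m * w ^ m) sums g w" if "w \<in> ball 0 R" for w
    using holomorphic_power_series[OF hol that] by (simp add: c_def)
  \<comment> \<open>Convergence at a point beyond \<open>r\<close> makes the series absolutely
    convergent at \<open>r\<close>, which yields the dominating constant \<open>M\<close>.\<close>
  obtain r' where r': "r < r'" "r' < R" using dense r(2) by blast
  have "summable (\<lambda>m. c m * of_real r' ^ m)"
    using sums[of "of_real r'"] r r' by (auto simp: sums_iff)
  then have "summable (\<lambda>m. norm (c m * of_real r ^ m))"
    using r r' by (intro powser_insidea[of c "of_real r'"]) auto
  then have summ: "summable (\<lambda>m. norm (c m) * r ^ m)"
    using r by (simp add: norm_mult norm_power)
  define M where "M = (\<Sum>m. norm (c m) * r ^ m)"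
  have bound: "norm (s N w) \<le> M" if "w \<in> ball 0 r" for N w
  proof -
    have "norm (s N w) \<le> (\<Sum>m<N. norm (c m) * r ^ m)"
      unfolding s_def using that
      by (intro order_trans[OF norm_sum] sum_mono)
         (auto simp: norm_mult norm_power intro!: mult_left_mono power_mono)
    also have "\<dots> \<le> M" unfolding M_def
      by (intro sum_le_suminf summ) (use r in auto)
    finally show ?thesis .
  qed
  have lim: "(\<lambda>N. LINT w:ball 0 r|lborel. s N w) \<longlonglongrightarrow> (LINT w:ball 0 r|lborel. g w)"
    unfolding set_lebesgue_integral_def
  proof (rule integral_dominated_convergence)
    have "continuous_on (ball 0 r) g"
      by (rule holomorphic_on_imp_continuous_on, rule holomorphic_on_subset[OF hol]) (use r in auto)
    then show "(\<lambda>w. indicator (ball 0 r) w *\<^sub>R g w) \<in> borel_measurable lborel"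
      by (simp add: borel_measurable_continuous_on_indicator)
    show "(\<lambda>w. indicator (ball 0 r) w *\<^sub>R s N w) \<in> borel_measurable lborel" for N
    proof -
      have "continuous_on (ball 0 r) (s N)"
        unfolding s_def by (intro continuous_intros)
      then show ?thesis
        by (simp add: borel_measurable_continuous_on_indicator)
    qed
    show "integrable lborel (\<lambda>w::complex. indicator (ball 0 r) w *\<^sub>R M)"
      using set_integrable_ball[of 0 r "\<lambda>_. M"] by (simp add: set_integrable_def)
    show "AE w in lborel. (\<lambda>N. indicator (ball 0 r) w *\<^sub>R s N w) \<longlonglongrightarrow> indicator (ball 0 r) w *\<^sub>R g w"
      using sums r by (auto simp: sums_def s_def indicator_def)
    show "AE w in lborel. norm (indicator (ball 0 r) w *\<^sub>R s N w) \<le> indicator (ball 0 r) w *\<^sub>R M" for N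
      using bound by (auto simp: indicator_def)
  qed
  have "(LINT w:ball 0 r|lborel. s N w) = of_real (pi * r\<^sup>2) * g 0" if "N > 0" for N
  proof -
    have "(LINT w:ball 0 r|lborel. s N w) = (\<Sum>m<N. LINT w:ball 0 r|lborel. c m * w ^ m)"
      unfolding s_def set_lebesgue_integral_def scaleR_sum_right
      by (rule Bochner_Integration.integral_sum, fold set_integrable_def)
         (intro set_integrable_ball continuous_intros)
    also have "\<dots> = (\<Sum>m<N. if m = 0 then of_real (pi * r\<^sup>2) * c 0 else 0)"
    proof (rule sum.cong[OF refl])
      fix m
      have "(LINT w:ball 0 r|lborel. c m * w ^ m)
            = c m * (\<integral>w. indicator (ball 0 r) w *\<^sub>R w ^ m \<partial>lborel)"
        unfolding set_lebesgue_integral_def by (simp flip: mult_scaleR_right)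
      also have "\<dots> = (if m = 0 then of_real (pi * r\<^sup>2) * c 0 else 0)"
        using integral_power_ball[of m r] r measure_disc[of r 0]
        by (auto simp: scaleR_conv_of_real)
      finally show "(LINT w:ball 0 r|lborel. c m * w ^ m) = (if m = 0 then of_real (pi * r\<^sup>2) * c 0 else 0)" .
    qed
    also have "\<dots> = of_real (pi * r\<^sup>2) * g 0"
      using that by (simp add: c_def)
    finally show ?thesis .
  qed
  then have "(\<lambda>N. LINT w:ball 0 r|lborel. s N w) \<longlonglongrightarrow> of_real (pi * r\<^sup>2) * g 0"
    by (intro tendsto_eventually eventually_mono[OF eventually_gt_at_top[of 0]]) auto
  then show ?thesis using lim LIMSEQ_unique by blast
qed

text \<open>The tangent of x^p at |g(0)| lies below |g|^p, and in it |g| may be replaced by the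
  smaller Re(d g), whose area mean is exactly |g(0)|. The linear term then integrates to
  zero.\<close>

lemma submean_value_0:
  assumes hol: "g holomorphic_on ball 0 R" and r: "0 < r" "r < R" and p: "p \<ge> 1"
  shows "ennreal (pi * r\<^sup>2 * cmod (g 0) powr p) \<le> (\<integral>\<^sup>+w\<in>ball 0 r. ennreal (cmod (g w) powr p) \<partial>lborel)"
proof (cases "g 0 = 0")
  case False
  define x where "x = cmod (g 0)"
  have x: "x > 0" using False by (simp add: x_def)
  \<comment> \<open>The unimodular factor that turns g(0) into the positive number
    \<open>x\<close>.\<close>
  define d where "d = cnj (g 0) / of_real x"
  have d: "cmod d = 1" using x by (simp add: d_def norm_divide x_def)
  have d0: "Re (d * g 0) = x"
  proof -
    have "d * g 0 = of_real (x\<^sup>2) / of_real x"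
      by (simp add: d_def x_def complex_norm_square[symmetric] mult.commute)
    then show ?thesis using x by (simp add: power2_eq_square)
  qed
  have cont: "continuous_on (cball 0 r) g"
    by (rule holomorphic_on_imp_continuous_on, rule holomorphic_on_subset[OF hol]) (use r in auto)
  let ?l = "\<lambda>w. x powr p + p * x powr (p - 1) * (Re (d * g w) - x)"
  have int_g: "set_integrable lborel (ball 0 r) g"
    by (rule set_integrable_ball[OF cont])
  have int_Re: "set_integrable lborel (ball 0 r) (\<lambda>w. Re (d * g w))"
    by (intro set_integrable_ball continuous_intros cont)
  have int_l: "set_integrable lborel (ball 0 r) ?l"
    by (intro set_integrable_ball continuous_intros cont)
  have int_p: "set_integrable lborel (ball 0 r) (\<lambda>w. cmod (g w) powr p)"
    using p by (intro set_integrable_ball continuous_on_powr' continuous_intros cont) auto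
  have "(LINT w:ball 0 r|lborel. d * g w) = (pi * r\<^sup>2) *\<^sub>R (d * g 0)"
    using area_mean_value_0[OF hol r] by (simp add: scaleR_conv_of_real)
  then have "Re (LINT w:ball 0 r|lborel. d * g w) = pi * r\<^sup>2 * x"
    by (simp only: scaleR_complex.simps d0)
  moreover have "Re (LINT w:ball 0 r|lborel. d * g w) = (LINT w:ball 0 r|lborel. Re (d * g w))"
    unfolding set_lebesgue_integral_def
    using set_integrable_ball[OF continuous_on_mult_left[OF cont, of d]]
    by (subst integral_Re[symmetric]) (auto simp: set_integrable_def)
  ultimately have re: "(LINT w:ball 0 r|lborel. Re (d * g w)) = pi * r\<^sup>2 * x" by simp
  have const: "(LINT w:ball (0::complex) r|lborel. k) = pi * r\<^sup>2 * k" for k :: real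
    using r measure_disc[of r 0] by (simp add: set_lebesgue_integral_def)
  have ci: "set_integrable lborel (ball (0::complex) r) (\<lambda>_. k)" for k :: real
    by (intro set_integrable_ball continuous_intros)
  have "(LINT w:ball 0 r|lborel. ?l w) = pi * r\<^sup>2 * x powr p
      + p * x powr (p - 1) * ((LINT w:ball 0 r|lborel. Re (d * g w)) - pi * r\<^sup>2 * x)"
    using int_Re ci by (simp add: set_integral_add(2) set_integral_diff(2) set_integrable_mult_right set_integral_diff(1) const)
  then have "pi * r\<^sup>2 * x powr p = (LINT w:ball 0 r|lborel. ?l w)"
    unfolding re by simp
  also have "\<dots> \<le> (LINT w:ball 0 r|lborel. cmod (g w) powr p)"
  proof (rule set_integral_mono[OF int_l int_p])
    fix w
    have "Re (d * g w) \<le> cmod (g w)"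
      using complex_Re_le_cmod[of "d * g w"] by (simp add: norm_mult d)
    then have "?l w \<le> x powr p + p * x powr (p - 1) * (cmod (g w) - x)"
      using p by (intro add_left_mono mult_left_mono) auto
    also have "\<dots> \<le> cmod (g w) powr p"
      by (rule powr_above_tangent) (use x p in auto)
    finally show "?l w \<le> cmod (g w) powr p" .
  qed
  finally have "ennreal (pi * r\<^sup>2 * x powr p) \<le> ennreal (LINT w:ball 0 r|lborel. cmod (g w) powr p)"
    by (rule ennreal_leI)
  also have "\<dots> = (\<integral>\<^sup>+w\<in>ball 0 r. ennreal (cmod (g w) powr p) \<partial>lborel)"
    unfolding set_lebesgue_integral_def
    by (subst nn_integral_eq_integral[symmetric])
       (use int_p in \<open>auto simp: set_integrable_def indicator_def intro!: nn_integral_cong\<close>)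
  finally show ?thesis by (simp add: x_def)
qed simp

lemma nn_integral_translate:
  fixes z :: "'a::euclidean_space"
  assumes [measurable]: "h \<in> borel_measurable borel"
  shows "(\<integral>\<^sup>+w. h (z + w) \<partial>lborel) = (\<integral>\<^sup>+w. h w \<partial>lborel)"
proof -
  have "(\<integral>\<^sup>+w. h w \<partial>lborel) = (\<integral>\<^sup>+w. h w \<partial>distr lborel borel ((+) z))"
    by (simp add: lborel_distr_plus)
  also have "\<dots> = (\<integral>\<^sup>+w. h (z + w) \<partial>lborel)"
    by (rule nn_integral_distr) auto
  finally show ?thesis ..
qed

text \<open>Only the values of \<open>u\<close> on \<open>S\<close> are controlled, so
  \<open>u\<close> is first replaced by its extension by zero, which is Borel; outside
  \<open>S\<close> the indicator hides the change.\<close>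

lemma measurable_on_open:
  fixes u :: "complex \<Rightarrow> 'a::real_normed_vector"
  assumes "continuous_on S u" "open S" and [measurable]: "\<phi> \<in> borel_measurable borel"
  shows "(\<lambda>w. \<phi> (u w) * indicator S w :: ennreal) \<in> borel_measurable borel"
proof -
  have [measurable]: "(\<lambda>w. indicator S w *\<^sub>R u w) \<in> borel_measurable borel"
    using assms by (simp add: borel_measurable_continuous_on_indicator)
  have [measurable]: "S \<in> sets borel" using assms by auto
  have "(\<lambda>w. \<phi> (u w) * indicator S w) = (\<lambda>w. \<phi> (indicator S w *\<^sub>R u w) * indicator S w)"
    by (auto simp: indicator_def)
  also have "\<dots> \<in> borel_measurable borel" by measurable
  finally show ?thesis .
qed

lemma submean_value:
  assumes hol: "u holomorphic_on ball z R" and r: "0 < r" "r < R" and p: "p \<ge> 1"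
  shows "ennreal (pi * r\<^sup>2 * cmod (u z) powr p) \<le> (\<integral>\<^sup>+w\<in>ball z r. ennreal (cmod (u w) powr p) \<partial>lborel)"
proof -
  have "(\<lambda>w. u (z + w)) holomorphic_on ball 0 R"
    by (rule holomorphic_on_compose_gen[OF _ hol, unfolded o_def])
       (auto intro!: holomorphic_intros simp: dist_norm)
  from submean_value_0[OF this r p]
  have "ennreal (pi * r\<^sup>2 * cmod (u z) powr p)
      \<le> (\<integral>\<^sup>+w\<in>ball 0 r. ennreal (cmod (u (z + w)) powr p) \<partial>lborel)" by simp
  also have "\<dots> = (\<integral>\<^sup>+w. (\<lambda>w. ennreal (cmod (u w) powr p) * indicator (ball z r) w) (z + w) \<partial>lborel)"
    by (rule nn_integral_cong) (simp add: indicator_def dist_norm)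
  also have "\<dots> = (\<integral>\<^sup>+w\<in>ball z r. ennreal (cmod (u w) powr p) \<partial>lborel)"
  proof (rule nn_integral_translate,
      rule measurable_on_open[where \<phi> = "\<lambda>x. ennreal (cmod x powr p)"])
    show "continuous_on (ball z r) u"
      by (rule holomorphic_on_imp_continuous_on, rule holomorphic_on_subset[OF hol]) (use r in auto)
  qed auto
  finally show ?thesis .
qed

subsection \<open>Weighted integrals over the disc\<close>

text \<open>The weight uses 1-|z| instead of 1-|z|^2 because it is 1-Lipschitz in z and integrates
  explicitly along radii; \<open>weight_comparable\<close> translates between the two.\<close>

definition disc_int :: "real \<Rightarrow> real \<Rightarrow> (complex \<Rightarrow> complex) \<Rightarrow> ennreal" where
  "disc_int p a u = (\<integral>\<^sup>+z\<in>ball 0 1. ennreal (cmod (u z) powr p * (1 - cmod z) powr a) \<partial>lborel)"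

lemma measurable_powr_holomorphic:
  assumes "u holomorphic_on S" "open S"
  shows "(\<lambda>w. ennreal (cmod (u w) powr p) * indicator S w) \<in> borel_measurable borel"
  by (rule measurable_on_open[where \<phi> = "\<lambda>x. ennreal (cmod x powr p)"])
     (auto intro: holomorphic_on_imp_continuous_on assms)

text \<open>Comparability in both directions lets one bound serve both signs of the exponent: the
  first inequality is raised to a power \<open>a\<close> that is nonnegative, the second is used
  when \<open>a\<close> is negative.\<close>

lemma powr_le_of_comparable:
  fixes x y k a :: real
  assumes "x > 0" "y > 0" "x \<le> k * y" "y \<le> k * x"
  shows "x powr a \<le> k powr \<bar>a\<bar> * y powr a"
proof (cases "a \<ge> 0")
  case True
  have "x powr a \<le> (k * y) powr a" using assms True by (intro powr_mono2) auto
  also have "\<dots> = k powr \<bar>a\<bar> * y powr a"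
    using assms True by (smt (verit) powr_mult zero_less_mult_iff)
  finally show ?thesis .
next
  case False
  have k: "k > 0" using assms by (smt (verit) zero_less_mult_iff)
  have "x powr a \<le> (y / k) powr a"
    using assms False k by (intro powr_mono2') (auto simp: field_simps)
  also have "\<dots> = k powr \<bar>a\<bar> * y powr a"
    using assms False k by (simp add: powr_divide powr_minus_divide)
  finally show ?thesis .
qed

text \<open>This is \<open>submean_value\<close> on a small disc around z. There 1-|w| stays between
  \<open>r\<close> and 1, so the weight is at least r^|a| whatever the sign of
  \<open>a\<close>.\<close>

lemma disc_int_local_bound:
  assumes s: "s < 1" and p: "p \<ge> 1"
  obtains C where "C > 0"
    "\<And>v z. v holomorphic_on ball 0 1 \<Longrightarrow> cmod z \<le> s \<Longrightarrow>
       ennreal (cmod (v z) powr p) \<le> ennreal C * disc_int p a v"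
proof
  \<comment> \<open>Half of the least distance from such z to the unit circle: the disc of radius
    \<open>2 * r\<close> stays inside the unit disc, as \<open>submean_value\<close> needs a larger
    disc of holomorphy, and 1-|w| >= r on the disc of radius \<open>r\<close>.\<close>
  define r where "r = (1 - s) / 2"
  have r: "r > 0" using s by (simp add: r_def)
  define k where "k = (1 / r) powr \<bar>a\<bar>"
  have k: "k > 0" using r by (simp add: k_def)
  define C where "C = k / (pi * r\<^sup>2)"
  show "C > 0" using k r by (simp add: C_def)
  fix v z assume hol: "v holomorphic_on ball 0 1" and z: "cmod z \<le> s"
  have near: "cmod w \<le> cmod z + r" if "w \<in> ball z r" for w
    using that norm_triangle_sub[of w z] by (simp add: dist_norm norm_minus_commute)
  have "v holomorphic_on ball z (2 * r)"
  proof (rule holomorphic_on_subset[OF hol], rule subsetI)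
    fix w assume "w \<in> ball z (2 * r)"
    then show "w \<in> ball 0 1"
      using z norm_triangle_sub[of w z] by (simp add: dist_norm norm_minus_commute r_def)
  qed
  from submean_value[OF this, of r p]
  have "ennreal (pi * r\<^sup>2 * cmod (v z) powr p) \<le> (\<integral>\<^sup>+w\<in>ball z r. ennreal (cmod (v w) powr p) \<partial>lborel)"
    using r p by simp
  also have "\<dots> \<le> (\<integral>\<^sup>+w. ennreal k * (ennreal (cmod (v w) powr p * (1 - cmod w) powr a) * indicator (ball 0 1) w) \<partial>lborel)"
  proof (rule nn_integral_mono)
    fix w
    show "ennreal (cmod (v w) powr p) * indicator (ball z r) w
      \<le> ennreal k * (ennreal (cmod (v w) powr p * (1 - cmod w) powr a) * indicator (ball 0 1) w)"
    proof (cases "w \<in> ball z r")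
      case True
      have w: "1 - cmod w \<ge> r" using near[OF True] z unfolding r_def by argo
      have r1: "r \<le> 1" using z norm_ge_zero[of z] unfolding r_def by argo
      have "1 - cmod w \<le> 1 / r * 1"
        using r r1 norm_ge_zero[of w] by (smt (verit) le_divide_eq_1_pos mult_1_right)
      moreover have "1 \<le> 1 / r * (1 - cmod w)"
        using w r by (simp add: field_simps)
      ultimately have "1 powr a \<le> k * (1 - cmod w) powr a"
        unfolding k_def using w r by (intro powr_le_of_comparable) auto
      then have "cmod (v w) powr p \<le> k * (cmod (v w) powr p * (1 - cmod w) powr a)"
        using mult_left_mono[of 1 "k * (1 - cmod w) powr a" "cmod (v w) powr p"] by (simp add: ac_simps)
      then show ?thesis using w r k True by (auto simp: indicator_def ennreal_mult'[symmetric] intro!: ennreal_leI)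
    qed simp
  qed
  also have "\<dots> = ennreal k * disc_int p a v"
    unfolding disc_int_def
  proof (rule nn_integral_cmult)
    have "(\<lambda>w. ennreal (cmod (v w) powr p * (1 - cmod w) powr a) * indicator (ball 0 1) w)
      = (\<lambda>w. (ennreal (cmod (v w) powr p) * indicator (ball 0 1) w) * ennreal ((1 - cmod w) powr a))"
      by (auto simp: ennreal_mult ac_simps)
    moreover have "(\<lambda>w. ennreal (cmod (v w) powr p) * indicator (ball 0 1) w) \<in> borel_measurable borel"
      by (rule measurable_powr_holomorphic[OF hol]) simp
    ultimately show "(\<lambda>w. ennreal (cmod (v w) powr p * (1 - cmod w) powr a) * indicator (ball 0 1) w)
      \<in> borel_measurable lborel" by simp
  qed
  finally have *: "ennreal (pi * r\<^sup>2 * cmod (v z) powr p) \<le> ennreal k * disc_int p a v" .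
  have "ennreal (cmod (v z) powr p) = ennreal (1 / (pi * r\<^sup>2)) * ennreal (pi * r\<^sup>2 * cmod (v z) powr p)"
    using r by (simp add: ennreal_mult'[symmetric])
  also have "\<dots> \<le> ennreal (1 / (pi * r\<^sup>2)) * (ennreal k * disc_int p a v)"
    by (rule mult_left_mono[OF *]) simp
  also have "\<dots> = ennreal C * disc_int p a v"
    using k by (simp add: C_def ennreal_mult'[symmetric] mult.assoc[symmetric])
  finally show "ennreal (cmod (v z) powr p) \<le> ennreal C * disc_int p a v" .
qed

section \<open>Bounding the derivative by the function\<close>

text \<open>Cauchy's inequality bounds the derivative by the value of u at some \<open>w0\<close> on
  the circle of radius \<open>r\<close>, and \<open>submean_value\<close> bounds that value by an
  integral over a disc about \<open>w0\<close>, contained in the disc of radius \<open>2 * r\<close>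
  about z. In the exponent p + 2, the p comes from Cauchy and the 2 from the area.\<close>

lemma deriv_powr_bound:
  assumes hol: "u holomorphic_on ball z R" and r: "0 < r" "2 * r < R" and p: "p \<ge> 1"
  shows "ennreal (pi * r powr (p + 2) * cmod (deriv u z) powr p)
     \<le> (\<integral>\<^sup>+w\<in>ball z (2 * r). ennreal (cmod (u w) powr p) \<partial>lborel)"
proof -
  have sub: "ball z r \<subseteq> ball z R" "cball z r \<subseteq> ball z R" "sphere z r \<subseteq> ball z R"
    using r by auto
  have cont: "continuous_on (ball z R) (\<lambda>w. cmod (u w))"
    by (intro continuous_intros holomorphic_on_imp_continuous_on hol)
  obtain w0 where w0: "w0 \<in> sphere z r" "\<And>w. w \<in> sphere z r \<Longrightarrow> cmod (u w) \<le> cmod (u w0)"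
    using continuous_attains_sup[OF compact_sphere _ continuous_on_subset[OF cont sub(3)]] r by auto
  have "cmod ((deriv ^^ 1) u z) \<le> fact 1 * cmod (u w0) / r ^ 1"
    by (rule Cauchy_inequality[OF holomorphic_on_subset[OF hol sub(1)]
          holomorphic_on_imp_continuous_on[OF holomorphic_on_subset[OF hol sub(2)]] r(1)])
       (use w0 in \<open>auto simp: dist_norm\<close>)
  then have "r * cmod (deriv u z) \<le> cmod (u w0)"
    using r by (simp add: field_simps)
  then have "(r * cmod (deriv u z)) powr p \<le> cmod (u w0) powr p"
    using r p by (intro powr_mono2) auto
  then have "r powr p * cmod (deriv u z) powr p \<le> cmod (u w0) powr p"
    using r by (simp add: powr_mult)
  then have "pi * r\<^sup>2 * (r powr p * cmod (deriv u z) powr p) \<le> pi * r\<^sup>2 * cmod (u w0) powr p"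
    by (intro mult_left_mono) auto
  moreover have "r powr (p + 2) = r powr p * r\<^sup>2"
    using r by (simp add: powr_add)
  ultimately have "ennreal (pi * r powr (p + 2) * cmod (deriv u z) powr p) \<le> ennreal (pi * r\<^sup>2 * cmod (u w0) powr p)"
    by (intro ennreal_leI) (simp add: ac_simps)
  also have "\<dots> \<le> (\<integral>\<^sup>+w\<in>ball w0 r. ennreal (cmod (u w) powr p) \<partial>lborel)"
  proof (rule submean_value)
    show "u holomorphic_on ball w0 (R - r)"
      by (rule holomorphic_on_subset[OF hol])
         (use w0 in \<open>simp add: ball_subset_ball_iff dist_commute\<close>)
  qed (use r p in auto)
  also have "\<dots> \<le> (\<integral>\<^sup>+w\<in>ball z (2 * r). ennreal (cmod (u w) powr p) \<partial>lborel)"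
  proof (rule nn_set_integral_set_mono)
    show "ball w0 r \<subseteq> ball z (2 * r)"
      using w0 by (simp add: ball_subset_ball_iff dist_commute)
  qed
  finally show ?thesis .
qed

text \<open>The local bound on discs of radius proportional to 1-|z| is integrated in z, and the
  order of integration is exchanged. This works because points paired by the kernel have comparable
  distances to the unit circle.\<close>

lemma disc_int_deriv_le:
  assumes p: "p \<ge> 1"
  obtains C where "C > 0"
    "\<And>u. u holomorphic_on ball 0 1 \<Longrightarrow> disc_int p (a + p) (deriv u) \<le> ennreal C * disc_int p a u"
proof
  \<comment> \<open>Cancels the factor pi * (1/4)^(p+2) of \<open>deriv_powr_bound\<close> at radius
    (1-|z|)/4.\<close>
  define c0 where "c0 = 4 powr (p + 2) / pi"
  \<comment> \<open>For paired points, 1-|z| and 1-|w| differ by a factor of at most 2, and the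
    weight to be compared has exponent a - 2.\<close>
  define k where "k = 2 powr \<bar>a - 2\<bar>"
  show "c0 * (k * pi) > 0" by (simp add: c0_def k_def)
  fix u assume hol: "u holomorphic_on ball 0 1"
  define G where "G w = ennreal (cmod (u w) powr p) * indicator (ball 0 1) w" for w
  have [measurable]: "G \<in> borel_measurable borel"
    unfolding G_def by (rule measurable_powr_holomorphic[OF hol]) simp
  \<comment> \<open>The pairing |w-z| < (1-|z|)/2 is the disc of radius 2(d/4) from the local bound.
    The exponent a - 2 is what remains of a + p after the factor (1-|z|)^(p+2) has been used
    up.\<close>
  define K where "K z w = (if cmod z < 1 \<and> 2 * cmod (w - z) < 1 - cmod z
      then ennreal ((1 - cmod z) powr (a - 2)) * G w else 0)" for z w
  have [measurable]: "case_prod K \<in> borel_measurable (lborel \<Otimes>\<^sub>M lborel)"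
    unfolding K_def by measurable
  have G_ball: "(\<integral>\<^sup>+w\<in>ball z r. ennreal (cmod (u w) powr p) \<partial>lborel) = (\<integral>\<^sup>+w\<in>ball z r. G w \<partial>lborel)"
    if "ball z r \<subseteq> ball 0 1" for z r
    using that by (intro nn_integral_cong) (auto simp: G_def indicator_def)
  have 1: "ennreal (cmod (deriv u z) powr p * (1 - cmod z) powr (a + p)) \<le> ennreal c0 * (\<integral>\<^sup>+w. K z w \<partial>lborel)"
    if z: "cmod z < 1" for z
  proof -
    define d where "d = 1 - cmod z"
    have d: "d > 0" using z by (simp add: d_def)
    have sub: "ball z d \<subseteq> ball 0 1"
      by (simp add: d_def ball_subset_ball_iff)
    have "ball z (2 * (d / 4)) \<subseteq> ball 0 1"
      using sub d by (auto simp: subset_iff)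
    then have *: "ennreal (pi * (d / 4) powr (p + 2) * cmod (deriv u z) powr p)
        \<le> (\<integral>\<^sup>+w\<in>ball z (2 * (d / 4)). G w \<partial>lborel)"
      using deriv_powr_bound[OF holomorphic_on_subset[OF hol sub], of "d / 4" p] d p
      by (simp add: G_ball)
    have "d powr (p + 2) * d powr (a - 2) = d powr (a + p)"
      by (simp add: powr_add[symmetric] add.commute)
    then have "cmod (deriv u z) powr p * d powr (a + p)
      = c0 * (d powr (a - 2) * (pi * (d / 4) powr (p + 2) * cmod (deriv u z) powr p))"
      using d by (simp add: c0_def powr_divide ac_simps)
    then have "ennreal (cmod (deriv u z) powr p * d powr (a + p))
      = ennreal c0 * (ennreal (d powr (a - 2)) * ennreal (pi * (d / 4) powr (p + 2) * cmod (deriv u z) powr p))"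
      by (simp add: ennreal_mult'[symmetric] c0_def)
    also have "\<dots> \<le> ennreal c0 * (ennreal (d powr (a - 2)) * (\<integral>\<^sup>+w\<in>ball z (2 * (d / 4)). G w \<partial>lborel))"
      by (intro mult_left_mono *) auto
    also have "ennreal (d powr (a - 2)) * (\<integral>\<^sup>+w\<in>ball z (2 * (d / 4)). G w \<partial>lborel)
       = (\<integral>\<^sup>+w. ennreal (d powr (a - 2)) * (G w * indicator (ball z (2 * (d / 4))) w) \<partial>lborel)"
      by (rule nn_integral_cmult[symmetric]) measurable
    also have "\<dots> = (\<integral>\<^sup>+w. K z w \<partial>lborel)"
      using z by (intro nn_integral_cong)
        (auto simp: K_def d_def indicator_def dist_norm norm_minus_commute)
    finally show ?thesis by (simp add: d_def)
  qed
  have 2: "(\<integral>\<^sup>+z. K z w \<partial>lborel)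
      \<le> ennreal (k * pi) * (ennreal (cmod (u w) powr p * (1 - cmod w) powr a) * indicator (ball 0 1) w)" for w
  proof (cases "cmod w < 1")
    case True
    define d where "d = 1 - cmod w"
    have d: "d > 0" using True by (simp add: d_def)
    \<comment> \<open>For fixed w all paired z lie in the disc of radius 1-|w| about w; its area
      supplies the square that turns the exponent a - 2 back into a.\<close>
    have "(\<integral>\<^sup>+z. K z w \<partial>lborel) \<le> (\<integral>\<^sup>+z. ennreal (k * d powr (a - 2)) * G w * indicator (ball w d) z \<partial>lborel)"
    proof (rule nn_integral_mono)
      fix z
      show "K z w \<le> ennreal (k * d powr (a - 2)) * G w * indicator (ball w d) z"
      proof (cases "cmod z < 1 \<and> 2 * cmod (w - z) < 1 - cmod z")
        case zw: True
        have *: "cmod z \<le> cmod w + cmod (w - z)" "cmod w \<le> cmod z + cmod (w - z)"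
          using norm_triangle_sub[of z w] norm_triangle_sub[of w z] by (simp_all add: norm_minus_commute)
        have "(1 - cmod z) powr (a - 2) \<le> k * d powr (a - 2)"
          unfolding k_def by (rule powr_le_of_comparable) (use zw True * in \<open>auto simp: d_def\<close>)
        moreover have "z \<in> ball w d"
          using zw * by (auto simp: d_def dist_norm)
        ultimately show ?thesis
          using zw by (auto simp: K_def intro!: mult_right_mono ennreal_leI)
      qed (auto simp: K_def)
    qed
    also have "\<dots> = ennreal (k * d powr (a - 2)) * G w * ennreal (pi * d\<^sup>2)"
      using d by (subst nn_integral_cmult_indicator) (auto simp: emeasure_disc)
    also have "\<dots> = ennreal (k * d powr (a - 2) * cmod (u w) powr p * (pi * d\<^sup>2))"
      using d True by (simp add: G_def ennreal_mult'[symmetric] k_def)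
    also have "k * d powr (a - 2) * cmod (u w) powr p * (pi * d\<^sup>2) = k * pi * (cmod (u w) powr p * d powr a)"
      using d by (simp add: powr_diff)
    finally show ?thesis
      using True d by (simp add: d_def ennreal_mult'[symmetric] k_def)
  next
    case False
    then have "K z w = 0" for z by (simp add: K_def G_def)
    then show ?thesis by simp
  qed
  have "disc_int p (a + p) (deriv u) \<le> (\<integral>\<^sup>+z. ennreal c0 * (\<integral>\<^sup>+w. K z w \<partial>lborel) \<partial>lborel)"
    unfolding disc_int_def
    by (rule nn_integral_mono) (use 1 in \<open>auto simp: indicator_def\<close>)
  also have "\<dots> = ennreal c0 * (\<integral>\<^sup>+z. (\<integral>\<^sup>+w. K z w \<partial>lborel) \<partial>lborel)"
    by (rule nn_integral_cmult) measurable
  also have "(\<integral>\<^sup>+z. (\<integral>\<^sup>+w. K z w \<partial>lborel) \<partial>lborel) = (\<integral>\<^sup>+w. (\<integral>\<^sup>+z. K z w \<partial>lborel) \<partial>lborel)"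
    by (rule lborel_pair.Fubini'[symmetric]) measurable
  also have "\<dots> \<le> (\<integral>\<^sup>+w. ennreal (k * pi) * (ennreal (cmod (u w) powr p * (1 - cmod w) powr a) * indicator (ball 0 1) w) \<partial>lborel)"
    by (rule nn_integral_mono) (rule 2)
  also have "\<dots> = ennreal (k * pi) * disc_int p a u"
    unfolding disc_int_def
  proof (rule nn_integral_cmult)
    have "(\<lambda>w. ennreal (cmod (u w) powr p * (1 - cmod w) powr a) * indicator (ball 0 1) w)
      = (\<lambda>w. G w * ennreal ((1 - cmod w) powr a))"
      by (auto simp: G_def ennreal_mult ac_simps)
    then show "(\<lambda>w. ennreal (cmod (u w) powr p * (1 - cmod w) powr a) * indicator (ball 0 1) w)
      \<in> borel_measurable lborel" by simp
  qed
  finally have "disc_int p (a + p) (deriv u) \<le> ennreal c0 * (ennreal (k * pi) * disc_int p a u)"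
    by (simp add: mult_left_mono)
  moreover have "ennreal (c0 * (k * pi)) = ennreal c0 * ennreal (k * pi)"
    by (rule ennreal_mult) (simp_all add: c0_def k_def)
  ultimately show "disc_int p (a + p) (deriv u) \<le> ennreal (c0 * (k * pi)) * disc_int p a u"
    by (simp add: mult.assoc)
qed

section \<open>Averages over dilations and Jensen's inequality on an interval\<close>

lemma nn_integral_dilate:
  fixes H :: "complex \<Rightarrow> ennreal"
  assumes [measurable]: "H \<in> borel_measurable borel" and t: "t > 0"
  shows "(\<integral>\<^sup>+z. H (t *\<^sub>R z) \<partial>lborel) = ennreal (1 / t\<^sup>2) * (\<integral>\<^sup>+w. H w \<partial>lborel)"
proof -
  have "(\<integral>\<^sup>+w. H w \<partial>lborel) = (\<integral>\<^sup>+w. H w \<partial>density (distr lborel borel (\<lambda>x::complex. 0 + t *\<^sub>R x)) (\<lambda>_. \<bar>t\<bar> ^ DIM(complex)))"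
    using lborel_affine[of t "0::complex"] t by simp
  also have "\<dots> = ennreal (t\<^sup>2) * (\<integral>\<^sup>+z. H (t *\<^sub>R z) \<partial>lborel)"
    using t by (simp add: nn_integral_density nn_integral_distr nn_integral_cmult)
  finally show ?thesis
    using t by (simp add: mult.assoc[symmetric] ennreal_mult'[symmetric])
qed

text \<open>Averaging over $t \ge 1/2$ only keeps the factor $t^{-2}$ coming from the substitution $w = tz$ bounded.\<close>

lemma radial_kernel_bound:
  fixes G :: "complex \<Rightarrow> ennreal"
  assumes b: "-1 < \<beta>" "\<beta> < 0" and [measurable]: "G \<in> borel_measurable borel"
  shows "(\<integral>\<^sup>+z\<in>ball 0 1. ennreal ((1 - cmod z) powr \<beta>) * (\<integral>\<^sup>+t\<in>{1/2..1}. G (t *\<^sub>R z) \<partial>lborel) \<partial>lborel)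
    \<le> ennreal (4 / (\<beta> + 1)) * (\<integral>\<^sup>+w\<in>ball 0 1. G w * ennreal ((1 - cmod w) powr (\<beta> + 1)) \<partial>lborel)"
proof -
  define A where "A z t = (if cmod z < 1 \<and> 1/2 \<le> t \<and> t \<le> 1
     then ennreal ((1 - cmod z) powr \<beta>) * G (t *\<^sub>R z) else 0)" for z and t :: real
  \<comment> \<open>What \<open>A\<close> becomes under w = tz, with (1-|w|/t)^\<beta> enlarged to
    (t-|w|)^\<beta>, a function that integrates explicitly in t.\<close>
  define B where "B t w = (if 1/2 \<le> t \<and> t \<le> 1 \<and> cmod w < t
     then ennreal ((t - cmod w) powr \<beta>) * G w else 0)" for w and t :: real
  have [measurable]: "case_prod A \<in> borel_measurable (lborel \<Otimes>\<^sub>M lborel)"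
    unfolding A_def by measurable
  have [measurable]: "case_prod B \<in> borel_measurable (lborel \<Otimes>\<^sub>M lborel)"
    unfolding B_def by measurable
  have 1: "(\<integral>\<^sup>+z. A z t \<partial>lborel) \<le> 4 * (\<integral>\<^sup>+w. B t w \<partial>lborel)" for t
  proof (cases "1/2 \<le> t \<and> t \<le> 1")
    case True
    then have t: "1/2 \<le> t" "t \<le> 1" "t > 0" by auto
    define H where "H w = (if cmod w < t then ennreal ((1 - cmod w / t) powr \<beta>) * G w else 0)" for w
    have [measurable]: "H \<in> borel_measurable borel"
      unfolding H_def by measurable
    have HB: "H w \<le> B t w" for w
    proof (cases "cmod w < t")
      case w: True
      \<comment> \<open>Division by t <= 1 enlarges t-|w|, and the negative exponent \<beta>
        reverses the inequality.\<close>
      have "(t - cmod w) * 1 \<le> (t - cmod w) * (1 / t)"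
        using w t by (intro mult_left_mono) auto
      then have "t - cmod w \<le> 1 - cmod w / t"
        using t by (simp add: diff_divide_distrib)
      then have "(1 - cmod w / t) powr \<beta> \<le> (t - cmod w) powr \<beta>"
        using w b by (intro powr_mono2') auto
      then show ?thesis using w t
        by (auto simp: H_def B_def intro!: mult_right_mono ennreal_leI)
    qed (simp add: H_def)
    have "(\<integral>\<^sup>+z. A z t \<partial>lborel) = (\<integral>\<^sup>+z. H (t *\<^sub>R z) \<partial>lborel)"
      using t by (intro nn_integral_cong) (auto simp: A_def H_def)
    also have "\<dots> = ennreal (1 / t\<^sup>2) * (\<integral>\<^sup>+w. H w \<partial>lborel)"
      by (rule nn_integral_dilate) (use t in measurable)
    also have "\<dots> \<le> ennreal 4 * (\<integral>\<^sup>+w. B t w \<partial>lborel)"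
    proof (rule mult_mono)
      have "(1/2)\<^sup>2 \<le> t\<^sup>2" using t by (intro power_mono) auto
      then show "ennreal (1 / t\<^sup>2) \<le> ennreal 4"
        using t by (intro ennreal_leI) (simp add: field_simps power2_eq_square)
    qed (auto intro!: nn_integral_mono HB)
    finally show ?thesis by simp
  qed (auto simp: A_def)
  have 2: "(\<integral>\<^sup>+t. B t w \<partial>lborel) \<le> ennreal (1 / (\<beta> + 1)) * (G w * ennreal ((1 - cmod w) powr (\<beta> + 1)) * indicator (ball 0 1) w)" for w
  proof (cases "cmod w < 1")
    case True
    \<comment> \<open>After a shift by |w| the t-integral of \<open>B\<close> is at most that of
      s^\<beta> over s in [0, 1-|w|], which is finite because \<beta> > -1.\<close>
    define f where "f t = ennreal (t powr \<beta>) * indicator {0..1 - cmod w} t" for t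
    have [measurable]: "f \<in> borel_measurable borel" unfolding f_def by measurable
    have f: "(\<integral>\<^sup>+t. f t \<partial>lborel) = ennreal ((1 - cmod w) powr (\<beta> + 1) / (\<beta> + 1))"
      unfolding f_def
      by (rule nn_integral_has_integral_lebesgue'[OF _ has_integral_powr_from_0]) (use b True in auto)
    have "(\<integral>\<^sup>+t. B t w \<partial>lborel) \<le> (\<integral>\<^sup>+t. G w * f (- cmod w + t) \<partial>lborel)"
      by (rule nn_integral_mono) (auto simp: B_def f_def mult.commute)
    also have "\<dots> = G w * (\<integral>\<^sup>+t. f (- cmod w + t) \<partial>lborel)"
      by (rule nn_integral_cmult) measurable
    also have "(\<integral>\<^sup>+t. f (- cmod w + t) \<partial>lborel) = ennreal ((1 - cmod w) powr (\<beta> + 1) / (\<beta> + 1))"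
      by (subst nn_integral_translate) (auto simp: f)
    finally show ?thesis
      using True b by (simp add: ennreal_mult'[symmetric] mult.left_commute)
  next
    case False
    have "B t w = 0" for t using False by (auto simp: B_def)
    then show ?thesis by simp
  qed
  have "(\<integral>\<^sup>+z\<in>ball 0 1. ennreal ((1 - cmod z) powr \<beta>) * (\<integral>\<^sup>+t\<in>{1/2..1}. G (t *\<^sub>R z) \<partial>lborel) \<partial>lborel)
     = (\<integral>\<^sup>+z. (\<integral>\<^sup>+t. A z t \<partial>lborel) \<partial>lborel)"
  proof (rule nn_integral_cong)
    fix z
    have "ennreal ((1 - cmod z) powr \<beta>) * (\<integral>\<^sup>+t\<in>{1/2..1}. G (t *\<^sub>R z) \<partial>lborel)
      = (\<integral>\<^sup>+t. ennreal ((1 - cmod z) powr \<beta>) * (G (t *\<^sub>R z) * indicator {1/2..1} t) \<partial>lborel)"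
      by (rule nn_integral_cmult[symmetric]) measurable
    also have "\<dots> * indicator (ball 0 1) z = (\<integral>\<^sup>+t. A z t \<partial>lborel)"
      by (cases "cmod z < 1") (auto simp: A_def indicator_def intro!: nn_integral_cong)
    finally show "ennreal ((1 - cmod z) powr \<beta>) * (\<integral>\<^sup>+t\<in>{1/2..1}. G (t *\<^sub>R z) \<partial>lborel) * indicator (ball 0 1) z
      = (\<integral>\<^sup>+t. A z t \<partial>lborel)" .
  qed
  also have "\<dots> = (\<integral>\<^sup>+t. (\<integral>\<^sup>+z. A z t \<partial>lborel) \<partial>lborel)"
    by (rule lborel_pair.Fubini'[symmetric]) measurable
  also have "\<dots> \<le> (\<integral>\<^sup>+t. 4 * (\<integral>\<^sup>+w. B t w \<partial>lborel) \<partial>lborel)"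
    by (rule nn_integral_mono) (rule 1)
  also have "\<dots> = 4 * (\<integral>\<^sup>+t. (\<integral>\<^sup>+w. B t w \<partial>lborel) \<partial>lborel)"
    by (rule nn_integral_cmult) measurable
  also have "(\<integral>\<^sup>+t. (\<integral>\<^sup>+w. B t w \<partial>lborel) \<partial>lborel) = (\<integral>\<^sup>+w. (\<integral>\<^sup>+t. B t w \<partial>lborel) \<partial>lborel)"
    by (rule lborel_pair.Fubini'[symmetric]) measurable
  also have "\<dots> \<le> (\<integral>\<^sup>+w. ennreal (1 / (\<beta> + 1)) * (G w * ennreal ((1 - cmod w) powr (\<beta> + 1)) * indicator (ball 0 1) w) \<partial>lborel)"
    by (rule nn_integral_mono) (rule 2)
  also have "\<dots> = ennreal (1 / (\<beta> + 1)) * (\<integral>\<^sup>+w\<in>ball 0 1. G w * ennreal ((1 - cmod w) powr (\<beta> + 1)) \<partial>lborel)"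
    by (rule nn_integral_cmult) measurable
  finally show ?thesis
    using b by (simp add: mult.assoc[symmetric] mult_left_mono ennreal_mult'[symmetric] flip: ennreal_numeral)
qed

text \<open>Hoelder's inequality for $g = (g/m)\,m$, from the tangent of $x^p$ at the mean of $g/m$.\<close>

lemma integral_powr_Jensen:
  fixes g m :: "real \<Rightarrow> real"
  assumes ab: "a < b" and g: "continuous_on {a..b} g" "\<And>t. t \<in> {a..b} \<Longrightarrow> g t \<ge> 0"
    and m: "continuous_on {a..b} m" "\<And>t. t \<in> {a..b} \<Longrightarrow> m t > 0" and p: "p \<ge> 1"
  shows "integral {a..b} g powr p
    \<le> integral {a..b} m powr (p - 1) * integral {a..b} (\<lambda>t. g t powr p * m t powr (1 - p))"
proof -
  let ?G = "integral {a..b} g" and ?M = "integral {a..b} m"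
  let ?h = "\<lambda>t. g t powr p * m t powr (1 - p)"
  have int: "g integrable_on {a..b}" "m integrable_on {a..b}"
    by (intro integrable_continuous_real g m)+
  have int_h: "?h integrable_on {a..b}"
    using p by (intro integrable_continuous_real continuous_intros continuous_on_powr' g m)
       (use g m in force)+
  have h0: "integral {a..b} ?h \<ge> 0"
    by (rule integral_nonneg[OF int_h]) auto
  obtain t0 where t0: "t0 \<in> {a..b}" "\<And>t. t \<in> {a..b} \<Longrightarrow> m t0 \<le> m t"
    using continuous_attains_inf[OF compact_Icc _ m(1)] ab by auto
  have "0 < m t0 * (b - a)" using m(2) t0 ab by simp
  also have "\<dots> = integral {a..b} (\<lambda>_. m t0)" using ab by simp
  also have "\<dots> \<le> ?M" by (rule integral_le) (use t0 int in auto)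
  finally have M: "?M > 0" .
  have G: "?G \<ge> 0" by (rule integral_nonneg[OF int(1)]) (use g in auto)
  show ?thesis
  proof (cases "?G = 0")
    case False
    define y where "y = ?G / ?M"
    have y: "y > 0" using False G M by (simp add: y_def)
    have "integral {a..b} (\<lambda>t. y powr p * m t + p * y powr (p - 1) * (g t - y * m t)) \<le> integral {a..b} ?h"
    proof (rule integral_le[OF _ int_h])
      show "(\<lambda>t. y powr p * m t + p * y powr (p - 1) * (g t - y * m t)) integrable_on {a..b}"
        by (intro integrable_continuous_real continuous_intros g m)
      fix t assume t: "t \<in> {a..b}"
      have mt: "m t > 0" by (rule m(2)[OF t])
      have "m t * (y powr p + p * y powr (p - 1) * (g t / m t - y)) \<le> m t * (g t / m t) powr p"
        by (intro mult_left_mono powr_above_tangent) (use mt g(2)[OF t] y p in auto)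
      also have "m t * (g t / m t) powr p = ?h t"
        using mt g(2)[OF t] by (simp add: powr_divide powr_diff)
      finally show "y powr p * m t + p * y powr (p - 1) * (g t - y * m t) \<le> ?h t"
        using mt by (simp add: algebra_simps)
    qed
    also have "integral {a..b} (\<lambda>t. y powr p * m t + p * y powr (p - 1) * (g t - y * m t))
      = y powr p * ?M + p * y powr (p - 1) * (?G - y * ?M)"
      using int by (simp add: integral_add integral_diff integrable_diff integrable_on_mult_right)
    also have "\<dots> = y powr p * ?M" using M by (simp add: y_def)
    finally have "?M powr (p - 1) * (y powr p * ?M) \<le> ?M powr (p - 1) * integral {a..b} ?h"
      by (rule mult_left_mono) simp
    moreover have "?M powr (p - 1) * (y powr p * ?M) = ?G powr p"
      using M G by (simp add: y_def powr_divide powr_diff)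
    ultimately show ?thesis by simp
  qed (use h0 in simp)
qed

subsection \<open>The Hardy inequality\<close>

text \<open>Jensen's inequality is applied on the radius with the weight $(1-t + 1-|z|)^{-b}$, which is comparable to $(1-t|z|)^{-b}$ and has an explicit antiderivative.\<close>

lemma radial_difference_bound:
  assumes hol: "u holomorphic_on ball 0 1" and z: "cmod z < 1" and b: "b > 1" and p: "p \<ge> 1"
  shows "cmod (u z - u (z / 2)) powr p
    \<le> (1 / (b - 1)) powr (p - 1) * 2 powr (b * (p - 1)) * (1 - cmod z) powr ((1 - b) * (p - 1))
      * integral {1/2..1} (\<lambda>t. cmod (deriv u (t *\<^sub>R z)) powr p * (1 - t * cmod z) powr (b * (p - 1)))"
proof -
  define c where "c = 1 - cmod z"
  have c: "c > 0" using z by (simp add: c_def)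
  define g where "g t = cmod (deriv u (t *\<^sub>R z))" for t
  define m where "m t = (1 - t + c) powr (- b)" for t
  have in_ball: "t *\<^sub>R z \<in> ball 0 1" if "t \<in> {1/2..1}" for t
    using that z mult_right_mono[of t 1 "cmod z"] by auto
  have hol': "deriv u holomorphic_on ball 0 1"
    by (intro holomorphic_deriv hol) simp
  have cont_d: "continuous_on {1/2..1} (\<lambda>t. deriv u (t *\<^sub>R z))"
    by (rule continuous_on_compose2[OF holomorphic_on_imp_continuous_on[OF hol']])
       (use in_ball in \<open>auto intro!: continuous_intros\<close>)
  have cont_g: "continuous_on {1/2..1} g"
    unfolding g_def by (intro continuous_intros cont_d)
  have cont_m: "continuous_on {1/2..1} m"
    unfolding m_def by (intro continuous_intros) (use c in auto)
  have cont_gp: "continuous_on {1/2..1} (\<lambda>t. g t powr p)"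
    using p by (intro continuous_on_powr' cont_g continuous_on_const) (auto simp: g_def)
  have cont_mp: "continuous_on {1/2..1} (\<lambda>t. m t powr (1 - p))"
    using c by (intro continuous_on_powr' cont_m continuous_on_const) (auto simp: m_def)
  have cont_w: "continuous_on {1/2..1} (\<lambda>t. (1 - t * cmod z) powr (b * (p - 1)))"
    by (intro continuous_on_powr continuous_intros) (use in_ball in force)
  have "((\<lambda>t. z * deriv u (t *\<^sub>R z)) has_integral (u (1 *\<^sub>R z) - u ((1/2) *\<^sub>R z))) {1/2..1}"
  proof (rule fundamental_theorem_of_calculus)
    fix t :: real assume t: "t \<in> {1/2..1}"
    have "(u has_field_derivative deriv u (t *\<^sub>R z)) (at (t *\<^sub>R z))"
      by (rule holomorphic_derivI[OF hol _ in_ball[OF t]]) simp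
    moreover have "((\<lambda>t. t *\<^sub>R z) has_vector_derivative z) (at t)"
      by (auto intro!: derivative_eq_intros simp: has_vector_derivative_def)
    ultimately have "(u \<circ> (\<lambda>t. t *\<^sub>R z) has_vector_derivative z * deriv u (t *\<^sub>R z)) (at t)"
      by (intro field_vector_diff_chain_at) auto
    then show "((\<lambda>t. u (t *\<^sub>R z)) has_vector_derivative z * deriv u (t *\<^sub>R z)) (at t within {1/2..1})"
      by (auto simp: o_def intro: has_vector_derivative_at_within)
  qed simp
  then have int: "(\<lambda>t. z * deriv u (t *\<^sub>R z)) integrable_on {1/2..1}"
    "u z - u (z / 2) = integral {1/2..1} (\<lambda>t. z * deriv u (t *\<^sub>R z))"
    by (auto simp: scaleR_conv_of_real has_integral_integrable_integral)
  have "cmod (u z - u (z / 2)) \<le> integral {1/2..1} g"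
    unfolding int(2)
  proof (rule integral_norm_bound_integral[OF int(1)])
    show "g integrable_on {1/2..1}" by (intro integrable_continuous_real cont_g)
    fix t show "cmod (z * deriv u (t *\<^sub>R z)) \<le> g t"
      using z mult_right_mono[of "cmod z" 1 "g t"] by (simp add: g_def norm_mult)
  qed
  then have "cmod (u z - u (z / 2)) powr p \<le> integral {1/2..1} g powr p"
    using p by (intro powr_mono2) auto
  also have "\<dots> \<le> integral {1/2..1} m powr (p - 1) * integral {1/2..1} (\<lambda>t. g t powr p * m t powr (1 - p))"
    by (rule integral_powr_Jensen) (use cont_g cont_m p c in \<open>auto simp: g_def m_def\<close>)
  also have "\<dots> \<le> (c powr (1 - b) / (b - 1)) powr (p - 1)
       * integral {1/2..1} (\<lambda>t. 2 powr (b * (p - 1)) * (g t powr p * (1 - t * cmod z) powr (b * (p - 1))))"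
  proof (rule mult_mono)
    let ?F = "\<lambda>t. (1 - t + c) powr (1 - b) / (b - 1)"
    have "(m has_integral (?F 1 - ?F (1/2))) {1/2..1}"
    proof (rule fundamental_theorem_of_calculus)
      fix t :: real assume t: "t \<in> {1/2..1}"
      have "(?F has_real_derivative m t) (at t)"
      proof -
        have "((\<lambda>t. 1 - t + c) has_real_derivative - 1) (at t)"
          by (auto intro!: derivative_eq_intros)
        then have "((\<lambda>t. (1 - t + c) powr (1 - b)) has_real_derivative
            (1 - b) * (1 - t + c) powr (1 - b - of_nat 1) * - 1) (at t)"
          by (rule DERIV_fun_powr) (use t c in auto)
        then have "(?F has_real_derivative ((1 - b) * (1 - t + c) powr (1 - b - of_nat 1) * - 1) / (b - 1)) (at t)"
          by (rule DERIV_cdivide)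
        also have "((1 - b) * (1 - t + c) powr (1 - b - of_nat 1) * - 1) / (b - 1) = m t"
          using b by (simp add: m_def field_simps)
        finally show ?thesis .
      qed
      then show "(?F has_vector_derivative m t) (at t within {1/2..1})"
        by (auto simp: has_real_derivative_iff_has_vector_derivative intro: has_vector_derivative_at_within)
    qed simp
    then have "integral {1/2..1} m = ?F 1 - ?F (1/2)" by (rule integral_unique)
    \<comment> \<open>Only the endpoint t = 1 matters: there the antiderivative equals
      (1-|z|)^(1-b)/(b-1), and since b > 1 the other endpoint only subtracts.\<close>
    also have "\<dots> \<le> c powr (1 - b) / (b - 1)" using b by simp
    finally have m_le: "integral {1/2..1} m \<le> c powr (1 - b) / (b - 1)" .
    have "integral {1/2..1} m \<ge> 0"
      by (intro integral_nonneg integrable_continuous_real cont_m) (simp add: m_def)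
    then show "integral {1/2..1} m powr (p - 1) \<le> (c powr (1 - b) / (b - 1)) powr (p - 1)"
      using m_le p by (intro powr_mono2) auto
    show "integral {1/2..1} (\<lambda>t. g t powr p * m t powr (1 - p))
      \<le> integral {1/2..1} (\<lambda>t. 2 powr (b * (p - 1)) * (g t powr p * (1 - t * cmod z) powr (b * (p - 1))))"
    proof (rule integral_le)
      show "(\<lambda>t. g t powr p * m t powr (1 - p)) integrable_on {1/2..1}"
        by (intro integrable_continuous_real continuous_on_mult cont_gp cont_mp)
      show "(\<lambda>t. 2 powr (b * (p - 1)) * (g t powr p * (1 - t * cmod z) powr (b * (p - 1)))) integrable_on {1/2..1}"
        by (intro integrable_continuous_real continuous_on_mult continuous_on_const cont_gp cont_w)
      fix t :: real assume t: "t \<in> {1/2..1}"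
      have 1: "t * cmod z \<le> t" "t * cmod z \<le> cmod z"
        using t z mult_left_mono[of "cmod z" 1 t] mult_right_mono[of t 1 "cmod z"] by auto
      have "m t powr (1 - p) = (1 - t + c) powr (b * (p - 1))"
        by (simp add: m_def powr_powr algebra_simps)
      also have "\<dots> \<le> (2 * (1 - t * cmod z)) powr (b * (p - 1))"
      proof (rule powr_mono2)
        \<comment> \<open>Add the two bounds t|z| <= t and t|z| <= |z|.\<close>
        show "1 - t + c \<le> 2 * (1 - t * cmod z)" using 1 unfolding c_def by argo
      qed (use t c b p in auto)
      also have "\<dots> = 2 powr (b * (p - 1)) * (1 - t * cmod z) powr (b * (p - 1))"
        using 1 z by (subst powr_mult) auto
      finally have "g t powr p * m t powr (1 - p)
         \<le> g t powr p * (2 powr (b * (p - 1)) * (1 - t * cmod z) powr (b * (p - 1)))"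
        by (rule mult_left_mono) simp
      then show "g t powr p * m t powr (1 - p)
         \<le> 2 powr (b * (p - 1)) * (g t powr p * (1 - t * cmod z) powr (b * (p - 1)))"
        by (simp add: ac_simps)
    qed
    show "0 \<le> integral {1/2..1} (\<lambda>t. g t powr p * m t powr (1 - p))"
      by (intro integral_nonneg integrable_continuous_real continuous_on_mult cont_gp cont_mp) simp
  qed simp
  also have "(c powr (1 - b) / (b - 1)) powr (p - 1)
    = (1 / (b - 1)) powr (p - 1) * c powr ((1 - b) * (p - 1))"
    using b c by (simp add: powr_divide powr_powr)
  also have "integral {1/2..1} (\<lambda>t. 2 powr (b * (p - 1)) * (g t powr p * (1 - t * cmod z) powr (b * (p - 1))))
    = 2 powr (b * (p - 1)) * integral {1/2..1} (\<lambda>t. g t powr p * (1 - t * cmod z) powr (b * (p - 1)))"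
    by (rule integral_mult_right)
  finally show ?thesis
    by (simp add: g_def c_def ac_simps)
qed

lemma powr_add_le:
  fixes x y p :: real
  assumes "x \<ge> 0" "y \<ge> 0" "p \<ge> 0"
  shows "(x + y) powr p \<le> 2 powr p * (x powr p + y powr p)"
proof -
  have "(x + y) powr p \<le> (2 * max x y) powr p"
    using assms by (intro powr_mono2) auto
  also have "\<dots> = 2 powr p * max x y powr p"
    using assms by (simp add: powr_mult)
  also have "\<dots> \<le> 2 powr p * (x powr p + y powr p)"
    by (intro mult_left_mono) (auto simp: max_def)
  finally show ?thesis .
qed

text \<open>The case $G = 1$ of the kernel bound replaces an integration in polar coordinates.\<close>

lemma nn_integral_radial_weight:
  assumes "-1 < \<beta>" "\<beta> < 0"
  shows "(\<integral>\<^sup>+z\<in>ball (0::complex) 1. ennreal ((1 - cmod z) powr \<beta>) \<partial>lborel) \<le> ennreal (8 * pi / (\<beta> + 1))"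
proof -
  let ?I = "\<integral>\<^sup>+z\<in>ball (0::complex) 1. ennreal ((1 - cmod z) powr \<beta>) \<partial>lborel"
  \<comment> \<open>The inner integral of 1 over [1/2,1] is 1/2; undoing it doubles the constant 4
    of the kernel bound, and the area of the disc contributes pi.\<close>
  have "ennreal 2 * ennreal (1/2) = 1"
    by (subst ennreal_mult'[symmetric]) auto
  then have "?I = ennreal 2 * (ennreal (1/2) * ?I)"
    by (simp only: mult.assoc[symmetric] mult_1_left)
  also have "ennreal (1/2) * ?I
     = (\<integral>\<^sup>+z\<in>ball (0::complex) 1. ennreal ((1 - cmod z) powr \<beta>) * (\<integral>\<^sup>+t\<in>{1/2..1::real}. 1 \<partial>lborel) \<partial>lborel)"
    by (subst nn_integral_cmult[symmetric]) (auto simp: ac_simps)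
  also have "\<dots> \<le> ennreal (4 / (\<beta> + 1)) * (\<integral>\<^sup>+w\<in>ball (0::complex) 1. 1 * ennreal ((1 - cmod w) powr (\<beta> + 1)) \<partial>lborel)"
    using radial_kernel_bound[OF assms, of "\<lambda>_. 1"] by simp
  also have "\<dots> \<le> ennreal (4 / (\<beta> + 1)) * (\<integral>\<^sup>+w. indicator (ball (0::complex) 1) w \<partial>lborel)"
    using assms
    by (intro mult_left_mono nn_integral_mono) (auto simp: indicator_def powr_le1)
  also have "\<dots> = ennreal (4 * pi / (\<beta> + 1))"
    using assms by (simp add: emeasure_disc ennreal_mult'[symmetric])
  finally have "?I \<le> ennreal 2 * ennreal (4 * pi / (\<beta> + 1))"
    by (simp add: mult_left_mono)
  also have "\<dots> = ennreal (8 * pi / (\<beta> + 1))"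
    using assms by (subst ennreal_mult'[symmetric]) auto
  finally show ?thesis .
qed

lemma ennreal_mult_sum:
  assumes "x \<ge> 0" "a \<ge> 0" "b \<ge> 0" "c \<ge> 0" "d \<ge> 0"
  shows "ennreal (x * (a * b + c * d)) = ennreal x * (ennreal a * ennreal b + ennreal c * ennreal d)"
  using assms by (simp add: ennreal_mult ennreal_plus)

text \<open>Split u(z) into u(z) - u(z/2) and u(z/2). The difference is an integral of u' along the
  outer half of the radius, where the averaged kernel bound applies. The points z/2 stay in the disc
  of radius 1/2, where u is controlled by u(0) and the supremum of |u'|, and what is left is a
  finite integral of the weight.\<close>

lemma disc_int_le_deriv:
  assumes p: "p > 1" and a: "a > -1"
  obtains C where "C > 0"
    "\<And>u. u holomorphic_on ball 0 1 \<Longrightarrow>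
       disc_int p a u \<le> ennreal C * (ennreal (cmod (u 0) powr p) + disc_int p (a + p) (deriv u))"
proof -
  \<comment> \<open>Any \<open>\<beta>\<close> with \<open>-1 < \<beta> < min a 0\<close> works; \<open>b\<close> is chosen so that the weights of
    radial_difference_bound and radial_kernel_bound match.\<close>
  define \<beta> where "\<beta> = (min a 0 - 1) / 2"
  have \<beta>: "-1 < \<beta>" "\<beta> < 0" "\<beta> < a" using a by (auto simp: \<beta>_def min_def)
  define b where "b = (a - \<beta>) / (p - 1) + 1"
  have b: "b > 1" using \<beta> p by (simp add: b_def)
  have bp: "b * (p - 1) = a - \<beta> + (p - 1)" "(1 - b) * (p - 1) = \<beta> - a"
    using p by (simp_all add: b_def field_simps)
  define K where "K = (1 / (b - 1)) powr (p - 1) * 2 powr (b * (p - 1))"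
  have K: "K > 0" using b by (simp add: K_def)
  define D where "D = 8 * pi / (\<beta> + 1)"
  have D: "D > 0" using \<beta> by (simp add: D_def)
  obtain C1 where C1: "C1 > 0" "\<And>v z. v holomorphic_on ball 0 1 \<Longrightarrow> cmod z \<le> 1/2 \<Longrightarrow>
       ennreal (cmod (v z) powr p) \<le> ennreal C1 * disc_int p (a + p) v"
    using disc_int_local_bound[of "1/2" p "a + p"] p by auto
  \<comment> \<open>2^p is the price of \<open>powr_add_le\<close>; 1 accounts for u(0), and
    \<open>C1\<close> for the supremum of |u'| on the disc of radius 1/2.\<close>
  define C2 where "C2 = 2 powr p * (1 + C1)"
  have C2: "C2 > 0" using C1 by (simp add: C2_def)
  define C where "C = 2 powr p * (K * (4 / (\<beta> + 1)) + D * C2)"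
  show ?thesis
  proof
    show "C > 0" unfolding C_def using K \<beta> D C2 by (intro mult_pos_pos add_pos_pos) auto
    fix u assume hol: "u holomorphic_on ball 0 1"
    have hol': "deriv u holomorphic_on ball 0 1"
      by (intro holomorphic_deriv hol) simp
    let ?W = "disc_int p (a + p) (deriv u)"
    let ?E = "ennreal (cmod (u 0) powr p) + ?W"
    \<comment> \<open>The exponent satisfies b(p-1) + \<beta> + 1 = a + p, so the kernel bound
      returns exactly the weight of the claim.\<close>
    define G where "G w = (ennreal (cmod (deriv u w) powr p) * indicator (ball 0 1) w) * ennreal ((1 - cmod w) powr (b * (p - 1)))" for w
    have [measurable]: "G \<in> borel_measurable borel"
      unfolding G_def using measurable_powr_holomorphic[OF hol', of p] by simp
    define Q where "Q z = ennreal ((1 - cmod z) powr \<beta>) * (\<integral>\<^sup>+t\<in>{1/2..1}. G (t *\<^sub>R z) \<partial>lborel) * indicator (ball 0 1) z" for z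
    have [measurable]: "Q \<in> borel_measurable borel"
      unfolding Q_def by measurable
    have Q: "(\<integral>\<^sup>+z. Q z \<partial>lborel) \<le> ennreal (4 / (\<beta> + 1)) * ?W"
    proof -
      have "(\<integral>\<^sup>+z. Q z \<partial>lborel) \<le> ennreal (4 / (\<beta> + 1)) * (\<integral>\<^sup>+w\<in>ball 0 1. G w * ennreal ((1 - cmod w) powr (\<beta> + 1)) \<partial>lborel)"
        unfolding Q_def by (rule radial_kernel_bound) (use \<beta> in auto)
      also have "(\<integral>\<^sup>+w\<in>ball 0 1. G w * ennreal ((1 - cmod w) powr (\<beta> + 1)) \<partial>lborel) = ?W"
        unfolding disc_int_def
      proof (rule nn_integral_cong)
        fix w
        have "(1 - cmod w) powr (b * (p - 1)) * (1 - cmod w) powr (\<beta> + 1) = (1 - cmod w) powr (a + p)"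
          by (simp add: bp powr_add[symmetric])
        then show "G w * ennreal ((1 - cmod w) powr (\<beta> + 1)) * indicator (ball 0 1) w
          = ennreal (cmod (deriv u w) powr p * (1 - cmod w) powr (a + p)) * indicator (ball 0 1) w"
          by (simp add: G_def indicator_def ennreal_mult'[symmetric] mult.assoc)
      qed
      finally show ?thesis .
    qed
    have 1: "ennreal (cmod (u z - u (z / 2)) powr p * (1 - cmod z) powr a) \<le> ennreal K * Q z"
      if z: "cmod z < 1" for z
    proof -
      let ?g = "\<lambda>t. cmod (deriv u (t *\<^sub>R z)) powr p * (1 - t * cmod z) powr (b * (p - 1))"
      have in_ball: "t *\<^sub>R z \<in> ball 0 1" if "t \<in> {1/2..1}" for t
        using that z mult_right_mono[of t 1 "cmod z"] by auto
      have int: "?g integrable_on {1/2..1}"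
      proof (intro integrable_continuous_real continuous_on_mult)
        have "continuous_on {1/2..1} (\<lambda>t. deriv u (t *\<^sub>R z))"
          by (rule continuous_on_compose2[OF holomorphic_on_imp_continuous_on[OF hol']])
             (use in_ball in \<open>auto intro!: continuous_intros\<close>)
        then show "continuous_on {1/2..1} (\<lambda>t. cmod (deriv u (t *\<^sub>R z)) powr p)"
          using p by (intro continuous_on_powr' continuous_on_norm continuous_on_const) auto
        show "continuous_on {1/2..1} (\<lambda>t. (1 - t * cmod z) powr (b * (p - 1)))"
          by (intro continuous_on_powr continuous_intros) (use in_ball in force)
      qed
      have "(\<integral>\<^sup>+t\<in>{1/2..1}. G (t *\<^sub>R z) \<partial>lborel) = (\<integral>\<^sup>+t. ennreal (?g t) * indicator {1/2..1} t \<partial>lborel)"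
      proof (rule nn_integral_cong)
        fix t :: real
        show "G (t *\<^sub>R z) * indicator {1/2..1} t = ennreal (?g t) * indicator {1/2..1} t"
          using in_ball[of t] by (auto simp: G_def indicator_def ennreal_mult')
      qed
      also have "\<dots> = ennreal (integral {1/2..1} ?g)"
        by (rule nn_integral_has_integral_lebesgue'[OF _ integrable_integral[OF int]]) auto
      finally have Gi: "(\<integral>\<^sup>+t\<in>{1/2..1}. G (t *\<^sub>R z) \<partial>lborel) = ennreal (integral {1/2..1} ?g)" .
      have nonneg: "integral {1/2..1} ?g \<ge> 0"
        by (rule integral_nonneg[OF int]) auto
      \<comment> \<open>The loss \<beta> - a of \<open>radial_difference_bound\<close> and the
        weight a combine to \<beta>, the exponent that the kernel bound expects.\<close>
      have pw: "(1 - cmod z) powr (\<beta> - a) * (1 - cmod z) powr a = (1 - cmod z) powr \<beta>"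
        by (simp add: powr_add[symmetric])
      have "cmod (u z - u (z / 2)) powr p * (1 - cmod z) powr a
        \<le> (K * (1 - cmod z) powr (\<beta> - a) * integral {1/2..1} ?g) * (1 - cmod z) powr a"
        using radial_difference_bound[OF hol z b less_imp_le[OF p]]
        by (intro mult_right_mono) (simp_all add: K_def bp)
      also have "\<dots> = K * ((1 - cmod z) powr \<beta> * integral {1/2..1} ?g)"
        by (simp add: pw[symmetric] ac_simps)
      finally show ?thesis
        using z K nonneg by (simp add: Q_def Gi ennreal_mult'[symmetric] ennreal_leI)
    qed
    have 2: "ennreal (cmod (u (z / 2)) powr p) \<le> ennreal C2 * ?E" if z: "cmod z < 1" for z
    proof -
      have "continuous_on (cball 0 (1/2)) (\<lambda>w. cmod (deriv u w))"
        by (intro continuous_intros holomorphic_on_imp_continuous_on holomorphic_on_subset[OF hol']) auto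
      from continuous_attains_sup[OF compact_cball _ this]
      obtain w0 where w0: "w0 \<in> cball 0 (1/2)"
        "\<And>w. w \<in> cball 0 (1/2) \<Longrightarrow> cmod (deriv u w) \<le> cmod (deriv u w0)" by auto
      have "cmod (u (z / 2) - u 0) \<le> cmod (deriv u w0) * cmod (z / 2 - 0)"
      proof (rule field_differentiable_bound)
        fix w :: complex assume w: "w \<in> cball 0 (1/2)"
        then have "(u has_field_derivative deriv u w) (at w)"
          by (intro holomorphic_derivI[OF hol]) auto
        then show "(u has_field_derivative deriv u w) (at w within cball 0 (1/2))"
          by (rule has_field_derivative_at_within)
      qed (use w0 z in \<open>auto simp: norm_divide\<close>)
      also have "\<dots> \<le> cmod (deriv u w0) * 1"
        using z by (intro mult_left_mono) (auto simp: norm_divide)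
      finally have "cmod (u (z / 2)) \<le> cmod (u 0) + cmod (deriv u w0)"
        using norm_triangle_sub[of "u (z / 2)" "u 0"] by simp
      then have "cmod (u (z / 2)) powr p \<le> (cmod (u 0) + cmod (deriv u w0)) powr p"
        using p by (intro powr_mono2) auto
      also have "\<dots> \<le> 2 powr p * (cmod (u 0) powr p + cmod (deriv u w0) powr p)"
        using p by (intro powr_add_le) auto
      finally have "ennreal (cmod (u (z / 2)) powr p) \<le> ennreal (2 powr p) * (ennreal (cmod (u 0) powr p) + ennreal (cmod (deriv u w0) powr p))"
        by (simp add: ennreal_leI flip: ennreal_mult' ennreal_plus)
      also have "\<dots> \<le> ennreal (2 powr p) * (ennreal (1 + C1) * ?E)"
      proof (rule mult_left_mono)
        have "ennreal (cmod (u 0) powr p) + ennreal (cmod (deriv u w0) powr p) \<le> 1 * ?E + ennreal C1 * ?E"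
          using C1(2)[OF hol', of w0] w0(1)
          by (intro add_mono) (auto intro: order_trans[OF _ mult_left_mono[of ?W ?E]])
        also have "\<dots> = ennreal (1 + C1) * ?E"
          using C1(1) by (simp add: ennreal_plus distrib_right)
        finally show "ennreal (cmod (u 0) powr p) + ennreal (cmod (deriv u w0) powr p) \<le> ennreal (1 + C1) * ?E" .
      qed simp
      finally show ?thesis
        using C1(1) by (simp add: C2_def ennreal_mult mult.assoc)
    qed
    let ?R = "\<lambda>z. ennreal ((1 - cmod z) powr \<beta>) * indicator (ball 0 1) z"
    have 3: "ennreal (cmod (u z) powr p * (1 - cmod z) powr a) * indicator (ball 0 1) z
      \<le> ennreal (2 powr p) * (ennreal K * Q z + (ennreal C2 * ?E) * ?R z)" for z
    proof (cases "cmod z < 1")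
      case True
      have "cmod (u z) powr p \<le> (cmod (u z - u (z / 2)) + cmod (u (z / 2))) powr p"
        using p norm_triangle_sub[of "u z" "u (z/2)"] by (intro powr_mono2) auto
      also have "\<dots> \<le> 2 powr p * (cmod (u z - u (z / 2)) powr p + cmod (u (z / 2)) powr p)"
        using p by (intro powr_add_le) auto
      finally have "cmod (u z) powr p * (1 - cmod z) powr a
        \<le> 2 powr p * (cmod (u z - u (z / 2)) powr p + cmod (u (z / 2)) powr p) * (1 - cmod z) powr a"
        by (rule mult_right_mono) simp
      also have "\<dots> = 2 powr p * (cmod (u z - u (z / 2)) powr p * (1 - cmod z) powr a + cmod (u (z / 2)) powr p * (1 - cmod z) powr a)"
        by (simp add: algebra_simps)
      \<comment> \<open>In the second summand the exponent is lowered from a to \<beta>, because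
        \<open>nn_integral_radial_weight\<close> requires an exponent strictly between -1 and
        0.\<close>
      also have "\<dots> \<le> 2 powr p * (cmod (u z - u (z / 2)) powr p * (1 - cmod z) powr a + cmod (u (z / 2)) powr p * (1 - cmod z) powr \<beta>)"
        using True \<beta> by (intro mult_left_mono add_left_mono powr_mono') auto
      finally have "ennreal (cmod (u z) powr p * (1 - cmod z) powr a)
        \<le> ennreal (2 powr p) * (ennreal (cmod (u z - u (z / 2)) powr p * (1 - cmod z) powr a)
            + ennreal (cmod (u (z / 2)) powr p) * ennreal ((1 - cmod z) powr \<beta>))"
        by (simp add: ennreal_leI flip: ennreal_mult' ennreal_plus)
      also have "\<dots> \<le> ennreal (2 powr p) * (ennreal K * Q z + (ennreal C2 * ?E) * ennreal ((1 - cmod z) powr \<beta>))"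
        by (intro mult_left_mono add_mono mult_right_mono 1 2 True) auto
      finally show ?thesis using True by simp
    qed simp
    have "disc_int p a u \<le> (\<integral>\<^sup>+z. ennreal (2 powr p) * (ennreal K * Q z + (ennreal C2 * ?E) * ?R z) \<partial>lborel)"
      unfolding disc_int_def[of p a u] by (rule nn_integral_mono) (rule 3)
    also have "\<dots> = ennreal (2 powr p) * (ennreal K * (\<integral>\<^sup>+z. Q z \<partial>lborel) + (ennreal C2 * ?E) * (\<integral>\<^sup>+z. ?R z \<partial>lborel))"
      by (simp add: nn_integral_cmult nn_integral_add)
    also have "\<dots> \<le> ennreal (2 powr p) * (ennreal K * (ennreal (4 / (\<beta> + 1)) * ?E) + (ennreal C2 * ?E) * ennreal D)"
    proof (intro mult_left_mono add_mono)
      have "ennreal (4 / (\<beta> + 1)) * ?W \<le> ennreal (4 / (\<beta> + 1)) * ?E"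
        by (intro mult_left_mono) auto
      then show "(\<integral>\<^sup>+z. Q z \<partial>lborel) \<le> ennreal (4 / (\<beta> + 1)) * ?E"
        using Q by (rule order_trans[rotated])
      show "(\<integral>\<^sup>+z. ?R z \<partial>lborel) \<le> ennreal D"
        unfolding D_def by (rule nn_integral_radial_weight) (use \<beta> in auto)
    qed auto
    also have "\<dots> = ennreal C * ?E"
    proof -
      have "ennreal C = ennreal (2 powr p) * (ennreal K * ennreal (4 / (\<beta> + 1)) + ennreal D * ennreal C2)"
        unfolding C_def by (rule ennreal_mult_sum) (use K \<beta> C2 D in auto)
      moreover have "x * (k * (y * e) + (z * e) * d) = x * (k * y + d * z) * e" for x k y z d e :: ennreal
        by (simp add: algebra_simps)
      ultimately show ?thesis by (simp only:)
    qed
    finally show "disc_int p a u \<le> ennreal C * ?E" .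
  qed
qed

section \<open>Iteration to derivatives of higher order\<close>

text \<open>The exponents (n+1)p - 2 grow by p with each derivative, which is the step of
  \<open>disc_int_deriv_le\<close>; that step is available for every exponent.\<close>

lemma disc_int_higher_deriv_le:
  assumes p: "p > 1"
  shows "\<exists>C>0. \<forall>u. u holomorphic_on ball 0 1 \<longrightarrow>
    disc_int p (real (Suc n) * p - 2) ((deriv ^^ Suc n) u) \<le> ennreal C * disc_int p (p - 2) (deriv u)"
proof (induction n)
  case 0
  show ?case by (rule exI[of _ 1]) simp
next
  case (Suc n)
  then obtain C where C: "C > 0" "\<And>u. u holomorphic_on ball 0 1 \<Longrightarrow>
    disc_int p (real (Suc n) * p - 2) ((deriv ^^ Suc n) u) \<le> ennreal C * disc_int p (p - 2) (deriv u)"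
    by blast
  obtain C' where C': "C' > 0" "\<And>u. u holomorphic_on ball 0 1 \<Longrightarrow>
    disc_int p (real (Suc n) * p - 2 + p) (deriv u) \<le> ennreal C' * disc_int p (real (Suc n) * p - 2) u"
    using disc_int_deriv_le[of p "real (Suc n) * p - 2"] p by auto
  have eq: "real (Suc n) * p - 2 + p = real (Suc (Suc n)) * p - 2"
    by (simp add: algebra_simps)
  show ?case
  proof (intro exI[of _ "C' * C"] conjI allI impI)
    show "C' * C > 0" using C C' by simp
    fix u assume hol: "u holomorphic_on ball 0 1"
    have "disc_int p (real (Suc (Suc n)) * p - 2) ((deriv ^^ Suc (Suc n)) u)
      \<le> ennreal C' * disc_int p (real (Suc n) * p - 2) ((deriv ^^ Suc n) u)"
      using C'(2)[OF holomorphic_higher_deriv[OF hol open_ball, of "Suc n"]]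
      by (simp only: eq funpow.simps o_apply)
    also have "\<dots> \<le> ennreal C' * (ennreal C * disc_int p (p - 2) (deriv u))"
      by (intro mult_left_mono C(2) hol) simp
    finally show "disc_int p (real (Suc (Suc n)) * p - 2) ((deriv ^^ Suc (Suc n)) u)
      \<le> ennreal (C' * C) * disc_int p (p - 2) (deriv u)"
      using C C' by (simp add: ennreal_mult mult.assoc)
  qed
qed

text \<open>The Hardy inequality is applied to each derivative in turn, and every application leaves
  behind one value at 0; these accumulate in the sum.\<close>

lemma disc_int_le_higher_deriv:
  assumes p: "p > 1"
  shows "\<exists>C>0. \<forall>u. u holomorphic_on ball 0 1 \<longrightarrow>
    disc_int p (p - 2) (deriv u) \<le> ennreal C *
      (ennreal (\<Sum>k=1..n. cmod ((deriv ^^ k) u 0) powr p) + disc_int p (real (Suc n) * p - 2) ((deriv ^^ Suc n) u))"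
proof (induction n)
  case 0
  show ?case by (rule exI[of _ 1]) simp
next
  case (Suc n)
  let ?S = "\<lambda>n u. \<Sum>k=1..n. cmod ((deriv ^^ k) u 0) powr p"
  obtain C where C: "C > 0" "\<And>u. u holomorphic_on ball 0 1 \<Longrightarrow>
    disc_int p (p - 2) (deriv u) \<le> ennreal C *
      (ennreal (?S n u) + disc_int p (real (Suc n) * p - 2) ((deriv ^^ Suc n) u))"
    using Suc by blast
  \<comment> \<open>Here p > 1 is essential: the smallest exponent is p - 2, which exceeds -1
    exactly in that case.\<close>
  have "real (Suc n) * p - 2 > -1"
  proof -
    have "real (Suc n) * p = p + p * real n" "0 \<le> p * real n"
      using p by (simp_all add: algebra_simps)
    then show ?thesis using p by linarith
  qed
  then obtain C' where C': "C' > 0" "\<And>u. u holomorphic_on ball 0 1 \<Longrightarrow>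
    disc_int p (real (Suc n) * p - 2) u \<le>
      ennreal C' * (ennreal (cmod (u 0) powr p) + disc_int p (real (Suc n) * p - 2 + p) (deriv u))"
    using disc_int_le_deriv[of p "real (Suc n) * p - 2"] p by auto
  have eq: "real (Suc n) * p - 2 + p = real (Suc (Suc n)) * p - 2"
    by (simp add: algebra_simps)
  show ?case
  proof (intro exI[of _ "C * (1 + C')"] conjI allI impI)
    show "C * (1 + C') > 0" using C C' by simp
    fix u assume hol: "u holomorphic_on ball 0 1"
    let ?x = "cmod ((deriv ^^ Suc n) u 0) powr p"
    let ?W = "disc_int p (real (Suc (Suc n)) * p - 2) ((deriv ^^ Suc (Suc n)) u)"
    have S: "ennreal (?S (Suc n) u) = ennreal (?S n u) + ennreal ?x"
      by (simp add: sum_nonneg flip: ennreal_plus)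
    have "disc_int p (real (Suc n) * p - 2) ((deriv ^^ Suc n) u) \<le> ennreal C' * (ennreal ?x + ?W)"
      using C'(2)[OF holomorphic_higher_deriv[OF hol open_ball, of "Suc n"]]
      by (simp only: eq funpow.simps o_apply)
    also have "\<dots> \<le> ennreal C' * (ennreal (?S (Suc n) u) + ?W)"
      unfolding S by (intro mult_left_mono add_right_mono) auto
    finally have "ennreal (?S n u) + disc_int p (real (Suc n) * p - 2) ((deriv ^^ Suc n) u)
      \<le> 1 * (ennreal (?S (Suc n) u) + ?W) + ennreal C' * (ennreal (?S (Suc n) u) + ?W)"
      unfolding S by (intro add_mono) (auto simp: add.assoc)
    also have "\<dots> = ennreal (1 + C') * (ennreal (?S (Suc n) u) + ?W)"
      using C' by (simp add: ennreal_plus distrib_right)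
    finally have "disc_int p (p - 2) (deriv u) \<le> ennreal C * (ennreal (1 + C') * (ennreal (?S (Suc n) u) + ?W))"
      by (intro order_trans[OF C(2)[OF hol]] mult_left_mono) auto
    then show "disc_int p (p - 2) (deriv u) \<le> ennreal (C * (1 + C')) * (ennreal (?S (Suc n) u) + ?W)"
      using C C' by (simp add: ennreal_mult mult.assoc)
  qed
qed

subsection \<open>Slice regular functions as families of holomorphic functions\<close>

definition hc :: "quat \<Rightarrow> quat \<Rightarrow> quat \<Rightarrow> complex" where
  "hc i v w = Complex (w \<bullet> v) (w \<bullet> (i *\<^sub>H v))"

lemma bounded_linear_hc: "bounded_linear (hc i v)"
proof -
  have "bounded_linear (\<lambda>w. of_real (w \<bullet> v) + \<i> * of_real (w \<bullet> (i *\<^sub>H v)))"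
    by (intro bounded_linear_add bounded_linear_compose[OF bounded_linear_mult_right]
        bounded_linear_compose[OF bounded_linear_of_real] bounded_linear_inner_left)
  then show ?thesis by (simp add: hc_def[abs_def] Complex_eq)
qed

lemma Re_hc [simp]: "Re (hc i v w) = w \<bullet> v"
  by (simp add: hc_def)

lemma inner_le_hc: "\<bar>w \<bullet> v\<bar> \<le> cmod (hc i v w)"
  using abs_Re_le_cmod[of "hc i v w"] by simp

text \<open>Left multiplication by a purely imaginary quaternion is skew-adjoint; with i^2 = -1 this
  makes it orthogonal.\<close>

lemma qmult_unit_inner:
  assumes "i \<in> imag_units"
  shows "(i *\<^sub>H w) \<bullet> v = - (w \<bullet> (i *\<^sub>H v))" "(i *\<^sub>H w) \<bullet> (i *\<^sub>H v) = w \<bullet> v"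
proof -
  show *: "(i *\<^sub>H w) \<bullet> v = - (w \<bullet> (i *\<^sub>H v))" for v w
    using assms by (simp add: imag_units_def qmult_def inner_prod_def cross3_simps)
  have "i *\<^sub>H (i *\<^sub>H v) = - v"
    using imag_units_square[OF assms] by (simp add: qmult_assoc[symmetric] qmult_of_real_left)
  then show "(i *\<^sub>H w) \<bullet> (i *\<^sub>H v) = w \<bullet> v" by (simp add: *)
qed

lemma cmod_hc_le:
  assumes "i \<in> imag_units"
  shows "cmod (hc i v w) \<le> 2 * norm v * norm w"
proof -
  have iv: "norm (i *\<^sub>H v) = norm v" using assms by (simp add: norm_qmult imag_units_def)
  have bd: "\<bar>w \<bullet> x\<bar> \<le> norm v * norm w" if "norm x = norm v" for x
    using Cauchy_Schwarz_ineq2[of w x] that by (simp add: mult.commute)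
  have "cmod (hc i v w) \<le> \<bar>w \<bullet> v\<bar> + \<bar>w \<bullet> (i *\<^sub>H v)\<bar>"
    using cmod_le[of "hc i v w"] by (simp add: hc_def)
  also have "\<dots> \<le> norm v * norm w + norm v * norm w"
    by (intro add_mono bd refl iv)
  finally show ?thesis by simp
qed

lemma hc_slice:
  assumes "i \<in> imag_units"
  shows "hc i v (slice i z *\<^sub>H w) = z * hc i v w"
proof -
  have "slice i z *\<^sub>H w = Re z *\<^sub>R w + Im z *\<^sub>R (i *\<^sub>H w)"
    by (simp add: slice_def qmult_add_left qmult_of_real_left)
       (simp add: qmult_def prod_eq_iff cross3_simps forall_3)
  then show ?thesis
    by (simp add: hc_def complex_eq_iff inner_simps qmult_unit_inner(1)[OF assms, of w v]
        qmult_unit_inner(2)[OF assms])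
qed

lemma slice_add: "slice i (z + w) = slice i z + slice i w"
  by (simp add: slice_def quat_of_real_def algebra_simps prod_eq_iff)

lemma slice_of_real [simp]: "slice i (of_real t) = quat_of_real t"
  by (simp add: slice_def)

lemma slice_0 [simp]: "slice i 0 = 0"
  by (simp add: slice_def quat_of_real_def prod_eq_iff)

lemma bounded_linear_slice: "bounded_linear (slice i)"
proof -
  have "linear (slice i)"
    by (rule linearI) (simp_all add: slice_add, simp add: slice_def quat_of_real_def prod_eq_iff algebra_simps)
  then show ?thesis by (rule linear_conv_bounded_linear[THEN iffD1])
qed

lemma slice_in_ball: "i \<in> imag_units \<Longrightarrow> slice i z \<in> ball 0 1 \<longleftrightarrow> cmod z < 1"
  by (simp add: norm_slice)

lemma qmult_zero_right [simp]: "q *\<^sub>H 0 = 0"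
  by (simp add: qmult_def zero_prod_def)

lemma bounded_linear_qmult_right: "bounded_linear (\<lambda>q. c *\<^sub>H q)"
proof (rule linear_conv_bounded_linear[THEN iffD1], rule linearI)
  fix b and x :: quat and r :: real
  show "c *\<^sub>H (b + x) = c *\<^sub>H b + c *\<^sub>H x" by (rule qmult_add_right)
  show "c *\<^sub>H (r *\<^sub>R x) = r *\<^sub>R (c *\<^sub>H x)"
    by (simp add: qmult_def prod_eq_iff cross3_simps forall_3)
qed

lemma bounded_linear_qmult_left: "bounded_linear (\<lambda>q. q *\<^sub>H c)"
proof (rule linear_conv_bounded_linear[THEN iffD1], rule linearI)
  fix b and x :: quat and r :: real
  show "(b + x) *\<^sub>H c = b *\<^sub>H c + x *\<^sub>H c" by (rule qmult_add_left)
  show "(r *\<^sub>R x) *\<^sub>H c = r *\<^sub>R (x *\<^sub>H c)"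
    by (simp add: qmult_def prod_eq_iff cross3_simps forall_3)
qed

text \<open>Unlike \<^const>\<open>slice_regular\<close>, this property passes to \<^const>\<open>deriv_x0\<close> without knowing that the derivative is again real differentiable in all directions.\<close>

definition slice_hol :: "quat \<Rightarrow> (quat \<Rightarrow> quat) \<Rightarrow> bool" where
  "slice_hol i g \<longleftrightarrow> (\<forall>v. (\<lambda>z. hc i v (g (slice i z))) holomorphic_on ball 0 1)"

lemma slice_holD: "slice_hol i g \<Longrightarrow> (\<lambda>z. hc i v (g (slice i z))) holomorphic_on ball 0 1"
  unfolding slice_hol_def by blast

lemma slice_hol_continuous:
  assumes "slice_hol i g"
  shows "continuous_on (ball 0 1) (\<lambda>z. g (slice i z))"
proof -
  have "continuous_on (ball 0 1) (\<lambda>z. \<Sum>b\<in>Basis. (Re (hc i b (g (slice i z)))) *\<^sub>R b)"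
    by (intro continuous_intros holomorphic_on_imp_continuous_on slice_holD[OF assms])
  then show ?thesis by (simp add: euclidean_representation)
qed

text \<open>\<open>deriv_x0\<close> is a \<open>vector_derivative\<close>, so it means something
  only once a derivative is known to exist. The candidate \<open>w\<close> is assembled from the
  real parts of the complex derivatives of the coordinates \<open>hc i b\<close> along a basis;
  uniqueness of derivatives then gives the claim for every \<open>v\<close>.\<close>

lemma hc_deriv_x0:
  assumes g: "slice_hol i g" and z: "cmod z < 1"
  shows "hc i v (deriv_x0 g (slice i z)) = deriv (\<lambda>z. hc i v (g (slice i z))) z"
proof -
  define \<phi> where "\<phi> t = g (slice i z + quat_of_real t)" for t
  define w where "w = (\<Sum>b\<in>Basis. Re (deriv (\<lambda>z. hc i b (g (slice i z))) z) *\<^sub>R b)"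
  have hv: "((\<lambda>t. hc i v (\<phi> t)) has_vector_derivative deriv (\<lambda>z. hc i v (g (slice i z))) z) (at 0)" for v
  proof -
    let ?u = "\<lambda>z. hc i v (g (slice i z))"
    have "?u holomorphic_on ball 0 1" by (rule slice_holD[OF g])
    from holomorphic_derivI[OF this open_ball, of z] z
    have "(?u has_field_derivative deriv ?u z) (at (z + of_real 0))" by simp
    moreover have "((\<lambda>t. z + of_real t) has_vector_derivative 1) (at 0)"
      by (auto intro!: derivative_eq_intros simp: has_vector_derivative_def scaleR_conv_of_real)
    ultimately have "(?u \<circ> (\<lambda>t. z + of_real t) has_vector_derivative 1 * deriv ?u z) (at 0)"
      by (intro field_vector_diff_chain_at)
    then show ?thesis by (simp add: o_def \<phi>_def slice_add)
  qed
  have "((\<lambda>t. \<Sum>b\<in>Basis. (\<phi> t \<bullet> b) *\<^sub>R b) has_vector_derivative w) (at 0)"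
    unfolding w_def
  proof (rule has_vector_derivative_sum)
    fix b :: quat
    have "((\<lambda>t. Re (hc i b (\<phi> t))) has_vector_derivative Re (deriv (\<lambda>z. hc i b (g (slice i z))) z)) (at 0)"
      by (rule bounded_linear.has_vector_derivative[OF bounded_linear_Re hv])
    then show "((\<lambda>t. (\<phi> t \<bullet> b) *\<^sub>R b) has_vector_derivative Re (deriv (\<lambda>z. hc i b (g (slice i z))) z) *\<^sub>R b) (at 0)"
      by (intro bounded_linear.has_vector_derivative[OF bounded_linear_scaleR_left]) simp
  qed
  then have \<phi>: "(\<phi> has_vector_derivative w) (at 0)"
    by (simp add: euclidean_representation)
  then have "deriv_x0 g (slice i z) = w"
    unfolding deriv_x0_def \<phi>_def by (rule vector_derivative_at)
  moreover have "((\<lambda>t. hc i v (\<phi> t)) has_vector_derivative hc i v w) (at 0)"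
    by (rule bounded_linear.has_vector_derivative[OF bounded_linear_hc \<phi>])
  ultimately show ?thesis
    using vector_derivative_unique_at hv by metis
qed

lemma slice_hol_deriv_x0:
  assumes "slice_hol i g"
  shows "slice_hol i (deriv_x0 g)"
  unfolding slice_hol_def
proof
  fix v
  have "deriv (\<lambda>z. hc i v (g (slice i z))) holomorphic_on ball 0 1"
    by (intro holomorphic_deriv slice_holD[OF assms]) simp
  then show "(\<lambda>z. hc i v (deriv_x0 g (slice i z))) holomorphic_on ball 0 1"
    by (rule holomorphic_transform) (simp add: hc_deriv_x0[OF assms])
qed

lemma slice_hol_funpow: "slice_hol i g \<Longrightarrow> slice_hol i ((deriv_x0 ^^ k) g)"
  by (induction k) (auto intro: slice_hol_deriv_x0)

lemma hc_funpow_deriv_x0: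
  assumes "slice_hol i g" "cmod z < 1"
  shows "hc i v ((deriv_x0 ^^ k) g (slice i z)) = (deriv ^^ k) (\<lambda>z. hc i v (g (slice i z))) z"
  using assms(2)
proof (induction k arbitrary: z)
  case (Suc k)
  have "hc i v ((deriv_x0 ^^ Suc k) g (slice i z)) = deriv (\<lambda>z. hc i v ((deriv_x0 ^^ k) g (slice i z))) z"
    by (simp add: hc_deriv_x0[OF slice_hol_funpow[OF assms(1)] Suc.prems])
  also have "\<dots> = deriv ((deriv ^^ k) (\<lambda>z. hc i v (g (slice i z)))) z"
  proof (rule deriv_cong_ev[OF _ refl])
    \<comment> \<open>The induction hypothesis can be differentiated only because it holds in a
      neighbourhood of z.\<close>
    have "eventually (\<lambda>z. z \<in> ball 0 1) (nhds z)"
      by (rule eventually_nhds_in_open) (use Suc.prems in auto)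
    then show "eventually (\<lambda>z. hc i v ((deriv_x0 ^^ k) g (slice i z)) = (deriv ^^ k) (\<lambda>z. hc i v (g (slice i z))) z) (nhds z)"
      by eventually_elim (simp add: Suc.IH)
  qed
  finally show ?case by simp
qed simp

lemma vector_derivative_slice:
  assumes "(f has_derivative D) (at (slice i (Complex x y)))"
  shows "vector_derivative (\<lambda>t. f (slice i (Complex t y))) (at x) = D (quat_of_real 1)"
    and "vector_derivative (\<lambda>t. f (slice i (Complex x t))) (at y) = D i"
proof -
  have 1: "((\<lambda>t. slice i (Complex t y)) has_vector_derivative quat_of_real 1) (at x)"
    unfolding slice_def quat_of_real_def
    by (auto intro!: derivative_eq_intros simp: has_vector_derivative_def prod_eq_iff)
  have 2: "((\<lambda>t. slice i (Complex x t)) has_vector_derivative i) (at y)"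
    unfolding slice_def quat_of_real_def
    by (auto intro!: derivative_eq_intros simp: has_vector_derivative_def prod_eq_iff)
  show "vector_derivative (\<lambda>t. f (slice i (Complex t y))) (at x) = D (quat_of_real 1)"
    using vector_derivative_diff_chain_within[OF 1, of f D] assms
    by (auto simp: o_def intro: vector_derivative_at has_derivative_at_withinI)
  show "vector_derivative (\<lambda>t. f (slice i (Complex x t))) (at y) = D i"
    using vector_derivative_diff_chain_within[OF 2, of f D] assms
    by (auto simp: o_def intro: vector_derivative_at has_derivative_at_withinI)
qed

lemma deriv_x0_eq:
  assumes "(f has_derivative D) (at q)"
  shows "deriv_x0 f q = D (quat_of_real 1)"
proof -
  have 1: "((\<lambda>t. q + quat_of_real t) has_vector_derivative quat_of_real 1) (at 0)"
    unfolding quat_of_real_def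
    by (auto intro!: derivative_eq_intros simp: has_vector_derivative_def prod_eq_iff)
  have "(f has_derivative D) (at (q + quat_of_real 0) within range (\<lambda>t. q + quat_of_real t))"
    using assms by (simp add: quat_of_real_def zero_prod_def[symmetric] has_derivative_at_withinI)
  with 1 have "(f \<circ> (\<lambda>t. q + quat_of_real t) has_vector_derivative D (quat_of_real 1)) (at 0)"
    by (rule vector_derivative_diff_chain_within)
  then show ?thesis
    unfolding deriv_x0_def by (simp add: o_def vector_derivative_at)
qed

text \<open>In this form the Cauchy-Riemann condition is linear in the full derivative
  \<open>D\<close>, so sums, right multiples and limits of derivatives inherit it.\<close>

lemma slice_regular_iff:
  "slice_regular f \<longleftrightarrow> (\<forall>q\<in>ball 0 1. f differentiable (at q)) \<and>
    (\<forall>i\<in>imag_units. \<forall>z D. cmod z < 1 \<longrightarrow> (f has_derivative D) (at (slice i z)) \<longrightarrow>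
       D (quat_of_real 1) + i *\<^sub>H D i = 0)"
proof (intro iffI conjI; (elim conjE)?)
  assume f: "slice_regular f"
  then show "\<forall>q\<in>ball 0 1. f differentiable (at q)" by (simp add: slice_regular_def)
  show "\<forall>i\<in>imag_units. \<forall>z D. cmod z < 1 \<longrightarrow> (f has_derivative D) (at (slice i z)) \<longrightarrow>
       D (quat_of_real 1) + i *\<^sub>H D i = 0"
  proof (intro ballI allI impI)
    fix i z D assume i: "i \<in> imag_units" and z: "cmod z < 1" and D: "(f has_derivative D) (at (slice i z))"
    then have "slice i (Complex (Re z) (Im z)) \<in> ball 0 1"
      using slice_in_ball by simp
    then have "vector_derivative (\<lambda>t. f (slice i (Complex t (Im z)))) (at (Re z))
        + i *\<^sub>H vector_derivative (\<lambda>t. f (slice i (Complex (Re z) t))) (at (Im z)) = 0"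
      using f i unfolding slice_regular_def by blast
    then show "D (quat_of_real 1) + i *\<^sub>H D i = 0"
      using D by (simp add: vector_derivative_slice[where D = D])
  qed
next
  assume f: "\<forall>q\<in>ball 0 1. f differentiable (at q)"
    and D: "\<forall>i\<in>imag_units. \<forall>z D. cmod z < 1 \<longrightarrow> (f has_derivative D) (at (slice i z)) \<longrightarrow>
       D (quat_of_real 1) + i *\<^sub>H D i = 0"
  show "slice_regular f"
    unfolding slice_regular_def
  proof (intro conjI f ballI allI impI)
    fix i x y assume i: "i \<in> imag_units" and xy: "slice i (Complex x y) \<in> ball 0 1"
    obtain E where E: "(f has_derivative E) (at (slice i (Complex x y)))"
      using f xy unfolding differentiable_def by blast
    show "vector_derivative (\<lambda>t. f (slice i (Complex t y))) (at x)
        + i *\<^sub>H vector_derivative (\<lambda>t. f (slice i (Complex x t))) (at y) = 0"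
      unfolding vector_derivative_slice[OF E] using D i E xy slice_in_ball[OF i] by blast
  qed
qed

text \<open>The condition amounts to D(i) = i D(1). Hence on the plane of the slice the derivative
  multiplies D(1) from the left by the increment, which \<open>hc_slice\<close> turns into complex
  multiplication.\<close>

lemma slice_regular_slice_hol:
  assumes f: "slice_regular f" and i: "i \<in> imag_units"
  shows "slice_hol i f"
  unfolding slice_hol_def
proof
  fix v
  let ?u = "\<lambda>z. hc i v (f (slice i z))"
  show "?u holomorphic_on ball 0 1"
    unfolding holomorphic_on_open[OF open_ball]
  proof
    fix z :: complex assume "z \<in> ball 0 1"
    then have z: "cmod z < 1" by simp
    then obtain D where D: "(f has_derivative D) (at (slice i z))"
      using f slice_in_ball[OF i, of z] unfolding slice_regular_def differentiable_def by blast
    interpret D: linear D using D by (rule has_derivative_linear)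
    have "D (quat_of_real 1) + i *\<^sub>H D i = 0"
      using f i z D unfolding slice_regular_iff by blast
    then have "i *\<^sub>H (D (quat_of_real 1) + i *\<^sub>H D i) = i *\<^sub>H 0" by simp
    moreover have "i *\<^sub>H (i *\<^sub>H D i) = - D i"
      using imag_units_square[OF i] by (simp add: qmult_assoc[symmetric] qmult_of_real_left)
    ultimately have Di: "D i = i *\<^sub>H D (quat_of_real 1)"
      by (simp add: qmult_add_right)
    have "D (slice i h) = slice i h *\<^sub>H D (quat_of_real 1)" for h
    proof -
      have "slice i h = Re h *\<^sub>R quat_of_real 1 + Im h *\<^sub>R i"
        by (simp add: slice_def quat_of_real_def)
      then have "D (slice i h) = Re h *\<^sub>R D (quat_of_real 1) + Im h *\<^sub>R (i *\<^sub>H D (quat_of_real 1))"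
        by (simp add: D.add D.scaleR Di)
      also have "\<dots> = slice i h *\<^sub>H D (quat_of_real 1)"
        by (simp add: slice_def qmult_add_left qmult_of_real_left)
           (simp add: qmult_def prod_eq_iff cross3_simps forall_3)
      finally show ?thesis .
    qed
    then have "hc i v (D (slice i h)) = hc i v (D (quat_of_real 1)) * h" for h
      by (simp add: hc_slice[OF i])
    moreover have "((\<lambda>z. hc i v (f (slice i z))) has_derivative (\<lambda>h. hc i v (D (slice i h)))) (at z)"
      by (intro bounded_linear.has_derivative[OF bounded_linear_hc]
          has_derivative_compose[OF bounded_linear_imp_has_derivative[OF bounded_linear_slice] D])
    ultimately show "\<exists>f'. (?u has_field_derivative f') (at z)"
      unfolding has_field_derivative_def by auto
  qed
qed

subsection \<open>Independence of the order of the derivative\<close>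

definition slice_int :: "real \<Rightarrow> nat \<Rightarrow> (complex \<Rightarrow> quat) \<Rightarrow> ennreal" where
  "slice_int p k h = (\<integral>\<^sup>+z\<in>ball 0 1. ennreal (norm ((1 - (cmod z)\<^sup>2) ^ k *\<^sub>R h z) powr p) \<partial>disc_lambda)"

lemma nn_integral_disc_lambda:
  assumes F: "F \<in> borel_measurable borel"
  shows "(\<integral>\<^sup>+z. F z \<partial>disc_lambda)
    = (\<integral>\<^sup>+z. ennreal (1 / pi * (1 / (1 - (cmod z)\<^sup>2)\<^sup>2)) * F z \<partial>lborel)"
proof -
  have [measurable]: "F \<in> borel_measurable disc_A"
    using F by (simp add: disc_A_def)
  have "(\<integral>\<^sup>+z. F z \<partial>disc_lambda) = (\<integral>\<^sup>+z. ennreal (1 / (1 - (cmod z)\<^sup>2)\<^sup>2) * F z \<partial>disc_A)"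
    unfolding disc_lambda_def
    by (rule nn_integral_density) (auto simp: disc_A_def F intro!: measurable_compose[OF _ measurable_ennreal])
  also have "\<dots> = (\<integral>\<^sup>+z. ennreal (1 / pi) * (ennreal (1 / (1 - (cmod z)\<^sup>2)\<^sup>2) * F z) \<partial>lborel)"
    unfolding disc_A_def using F by (intro nn_integral_density) auto
  finally show ?thesis
    by (simp add: mult.assoc[symmetric] ennreal_mult'[symmetric])
qed

text \<open>The factor (1-|z|^2)^(kp) meets the density (1-|z|^2)^(-2) of the measure; this is the
  origin of the exponents kp - 2.\<close>

lemma slice_int_eq:
  assumes h: "continuous_on (ball 0 1) h"
  shows "slice_int p k h = (\<integral>\<^sup>+z\<in>ball 0 1. ennreal (1 / pi * ((1 - (cmod z)\<^sup>2) powr (real k * p - 2) * norm (h z) powr p)) \<partial>lborel)"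
proof -
  have "slice_int p k h = (\<integral>\<^sup>+z. ennreal (1 / pi * (1 / (1 - (cmod z)\<^sup>2)\<^sup>2))
      * (ennreal (norm ((1 - (cmod z)\<^sup>2) ^ k *\<^sub>R h z) powr p) * indicator (ball 0 1) z) \<partial>lborel)"
    unfolding slice_int_def
  proof (rule nn_integral_disc_lambda, rule measurable_on_open[where \<phi> = "\<lambda>x. ennreal (norm x powr p)"])
    show "continuous_on (ball 0 1) (\<lambda>z. (1 - (cmod z)\<^sup>2) ^ k *\<^sub>R h z)"
      by (intro continuous_intros h)
  qed auto
  also have "\<dots> = (\<integral>\<^sup>+z\<in>ball 0 1. ennreal (1 / pi * ((1 - (cmod z)\<^sup>2) powr (real k * p - 2) * norm (h z) powr p)) \<partial>lborel)"
  proof (rule nn_integral_cong)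
    fix z
    define s where "s = 1 - (cmod z)\<^sup>2"
    have "1 / pi * (1 / s\<^sup>2) * norm (s ^ k *\<^sub>R h z) powr p
       = 1 / pi * (s powr (real k * p - 2) * norm (h z) powr p)" if "cmod z < 1"
    proof -
      have s: "s > 0" using that power_strict_mono[of "cmod z" 1 2] by (simp add: s_def)
      have "norm (s ^ k *\<^sub>R h z) powr p = (s powr real k) powr p * norm (h z) powr p"
        using s by (simp add: powr_mult powr_realpow)
      also have "(s powr real k) powr p = s powr (real k * p - 2) * s\<^sup>2"
        using s by (simp add: powr_powr powr_diff)
      finally show ?thesis using s by simp
    qed
    then show "ennreal (1 / pi * (1 / (1 - (cmod z)\<^sup>2)\<^sup>2))
      * (ennreal (norm ((1 - (cmod z)\<^sup>2) ^ k *\<^sub>R h z) powr p) * indicator (ball 0 1) z)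
      = ennreal (1 / pi * ((1 - (cmod z)\<^sup>2) powr (real k * p - 2) * norm (h z) powr p)) * indicator (ball 0 1) z"
      by (cases "cmod z < 1") (simp_all add: s_def ennreal_mult'[symmetric] mult.assoc[symmetric])
  qed
  finally show ?thesis .
qed

lemma weight_comparable:
  assumes "cmod z < 1"
  shows "(1 - (cmod z)\<^sup>2) powr a \<le> 2 powr \<bar>a\<bar> * (1 - cmod z) powr a"
    and "(1 - cmod z) powr a \<le> 2 powr \<bar>a\<bar> * (1 - (cmod z)\<^sup>2) powr a"
proof -
  have eq: "1 - (cmod z)\<^sup>2 = (1 - cmod z) * (1 + cmod z)"
    by (simp add: algebra_simps power2_eq_square)
  have "(1 - cmod z) * 1 \<le> (1 - cmod z) * (1 + cmod z)" "(1 - cmod z) * (1 + cmod z) \<le> (1 - cmod z) * 2"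
    using assms by (intro mult_left_mono; simp)+
  then have *: "1 - cmod z \<le> 1 - (cmod z)\<^sup>2" "1 - (cmod z)\<^sup>2 \<le> 2 * (1 - cmod z)"
    unfolding eq by simp_all
  show "(1 - (cmod z)\<^sup>2) powr a \<le> 2 powr \<bar>a\<bar> * (1 - cmod z) powr a"
    and "(1 - cmod z) powr a \<le> 2 powr \<bar>a\<bar> * (1 - (cmod z)\<^sup>2) powr a"
    using assms * by (intro powr_le_of_comparable; argo)+
qed

lemma powr_sum_le:
  fixes x :: "'a \<Rightarrow> real"
  assumes A: "finite A" "A \<noteq> {}" and x: "\<And>b. b \<in> A \<Longrightarrow> x b \<ge> 0" and p: "p \<ge> 0"
  shows "(\<Sum>b\<in>A. x b) powr p \<le> real (card A) powr p * (\<Sum>b\<in>A. x b powr p)"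
proof -
  obtain c where c: "c \<in> A" "\<And>b. b \<in> A \<Longrightarrow> x b \<le> x c"
  proof -
    have "Max (x ` A) \<in> x ` A" using A by (intro Max_in) auto
    then obtain c where "c \<in> A" "x c = Max (x ` A)" by auto
    then show thesis using A by (intro that[of c]) auto
  qed
  have "(\<Sum>b\<in>A. x b) powr p \<le> (real (card A) * x c) powr p"
    using c x p sum_bounded_above[of A x "x c"] by (intro powr_mono2) (auto intro: sum_nonneg)
  also have "\<dots> = real (card A) powr p * x c powr p"
    using c x by (simp add: powr_mult)
  also have "\<dots> \<le> real (card A) powr p * (\<Sum>b\<in>A. x b powr p)"
    using A c by (intro mult_left_mono member_le_sum) auto
  finally show ?thesis .
qed

section \<open>Comparison of slice integrals with their holomorphic coordinates\<close>

text \<open>With \<open>slice_int_le_disc_int_hc\<close> this exchanges a quaternion-valued function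
  on a slice for its coordinates. The constants are fixed before the imaginary unit, so they survive
  the supremum over i.\<close>

lemma disc_int_hc_le_slice_int:
  assumes p: "p \<ge> 0"
  obtains C where "C > 0"
    "\<And>i (h :: complex \<Rightarrow> quat) (b :: quat). i \<in> imag_units \<Longrightarrow> b \<in> Basis \<Longrightarrow> continuous_on (ball 0 1) h \<Longrightarrow>
      disc_int p (real k * p - 2) (\<lambda>z. hc i b (h z)) \<le> ennreal C * slice_int p k h"
proof
  let ?a = "real k * p - 2"
  \<comment> \<open>2^p comes from \<open>cmod_hc_le\<close> for a unit vector \<open>b\<close>, the
    next factor from \<open>weight_comparable\<close>, and pi undoes the normalisation of the area
    measure.\<close>
  define C where "C = 2 powr p * 2 powr \<bar>?a\<bar> * pi"
  show "C > 0" by (simp add: C_def)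
  fix i and h :: "complex \<Rightarrow> quat" and b :: quat assume i: "i \<in> imag_units" and b: "b \<in> Basis" and h: "continuous_on (ball 0 1) h"
  let ?F = "\<lambda>z. ennreal (1 / pi * ((1 - (cmod z)\<^sup>2) powr ?a * norm (h z) powr p))"
  have "disc_int p ?a (\<lambda>z. hc i b (h z)) \<le> (\<integral>\<^sup>+z. ennreal C * (?F z * indicator (ball 0 1) z) \<partial>lborel)"
    unfolding disc_int_def
  proof (rule nn_integral_mono)
    fix z
    show "ennreal (cmod (hc i b (h z)) powr p * (1 - cmod z) powr ?a) * indicator (ball 0 1) z
      \<le> ennreal C * (?F z * indicator (ball 0 1) z)"
    proof (cases "cmod z < 1")
      case True
      have "cmod (hc i b (h z)) powr p \<le> (2 * norm (h z)) powr p"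
        using cmod_hc_le[OF i, of b "h z"] b p by (intro powr_mono2) auto
      also have "\<dots> = 2 powr p * norm (h z) powr p" by (simp add: powr_mult)
      finally have "cmod (hc i b (h z)) powr p * (1 - cmod z) powr ?a
        \<le> (2 powr p * norm (h z) powr p) * (2 powr \<bar>?a\<bar> * (1 - (cmod z)\<^sup>2) powr ?a)"
        by (intro mult_mono weight_comparable True) auto
      also have "\<dots> = C * (1 / pi * ((1 - (cmod z)\<^sup>2) powr ?a * norm (h z) powr p))"
        by (simp add: C_def)
      finally show ?thesis
        using True by (simp add: ennreal_mult'[symmetric] C_def ennreal_leI)
    qed simp
  qed
  also have "\<dots> = ennreal C * slice_int p k h"
    unfolding slice_int_eq[OF h]
  proof (rule nn_integral_cmult)
    have "(\<lambda>z. ennreal (norm (h z) powr p) * indicator (ball 0 1) z) \<in> borel_measurable borel"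
      by (rule measurable_on_open[OF h, where \<phi> = "\<lambda>x. ennreal (norm x powr p)"]) auto
    moreover have "?F z * indicator (ball 0 1) z = ennreal (1 / pi * (1 - (cmod z)\<^sup>2) powr ?a) * (ennreal (norm (h z) powr p) * indicator (ball 0 1) z)" for z
      by (simp add: ennreal_mult'[symmetric] mult.assoc[symmetric])
    ultimately show "(\<lambda>z. ?F z * indicator (ball 0 1) z) \<in> borel_measurable lborel" by simp
  qed
  finally show "disc_int p ?a (\<lambda>z. hc i b (h z)) \<le> ennreal C * slice_int p k h" .
qed

lemma slice_int_le_disc_int_hc:
  assumes p: "p \<ge> 0"
  obtains C where "C > 0"
    "\<And>i (h :: complex \<Rightarrow> quat). i \<in> imag_units \<Longrightarrow> continuous_on (ball 0 1) h \<Longrightarrow>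
      slice_int p k h \<le> ennreal C * (\<Sum>b\<in>Basis. disc_int p (real k * p - 2) (\<lambda>z. hc i b (h z)))"
proof
  let ?a = "real k * p - 2"
  \<comment> \<open>The norm is at most the sum of the coordinates, and \<open>powr_sum_le\<close>
    charges the number of coordinates to the power p. The normalisation 1/pi is estimated by
    1.\<close>
  define C where "C = real (card (Basis :: quat set)) powr p * 2 powr \<bar>?a\<bar>"
  show "C > 0" by (simp add: C_def)
  fix i and h :: "complex \<Rightarrow> quat" assume i: "i \<in> imag_units" and h: "continuous_on (ball 0 1) h"
  let ?F = "\<lambda>b z. ennreal (cmod (hc i b (h z)) powr p * (1 - cmod z) powr ?a) * indicator (ball 0 1) z"
  have [measurable]: "?F b \<in> borel_measurable lborel" for b
  proof -
    have "continuous_on (ball 0 1) (\<lambda>z. hc i b (h z))"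
      by (rule continuous_on_compose2[OF linear_continuous_on[OF bounded_linear_hc] h]) auto
    then have "(\<lambda>z. ennreal (cmod (hc i b (h z)) powr p) * indicator (ball 0 1) z) \<in> borel_measurable borel"
      by (rule measurable_on_open[where \<phi> = "\<lambda>x. ennreal (norm x powr p)"]) auto
    moreover have "?F b z = ennreal ((1 - cmod z) powr ?a) * (ennreal (cmod (hc i b (h z)) powr p) * indicator (ball 0 1) z)" for z
      by (simp add: ennreal_mult' ac_simps)
    ultimately show ?thesis by simp
  qed
  have "slice_int p k h \<le> (\<integral>\<^sup>+z. ennreal C * (\<Sum>b\<in>Basis. ?F b z) \<partial>lborel)"
    unfolding slice_int_eq[OF h]
  proof (rule nn_integral_mono)
    fix z
    show "ennreal (1 / pi * ((1 - (cmod z)\<^sup>2) powr ?a * norm (h z) powr p)) * indicator (ball 0 1) z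
      \<le> ennreal C * (\<Sum>b\<in>Basis. ?F b z)"
    proof (cases "cmod z < 1")
      case True
      have "norm (h z) \<le> (\<Sum>b\<in>Basis. cmod (hc i b (h z)))"
        using norm_le_l1[of "h z"] by (rule order_trans) (intro sum_mono inner_le_hc)
      then have "norm (h z) powr p \<le> (\<Sum>b\<in>Basis. cmod (hc i b (h z))) powr p"
        using p by (intro powr_mono2) auto
      also have "\<dots> \<le> real (card (Basis :: quat set)) powr p * (\<Sum>b\<in>Basis. cmod (hc i b (h z)) powr p)"
        using p by (intro powr_sum_le) auto
      finally have "(1 - (cmod z)\<^sup>2) powr ?a * norm (h z) powr p
        \<le> (2 powr \<bar>?a\<bar> * (1 - cmod z) powr ?a) * (real (card (Basis :: quat set)) powr p * (\<Sum>b\<in>Basis. cmod (hc i b (h z)) powr p))"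
        by (intro mult_mono weight_comparable True) auto
      also have "\<dots> = C * (\<Sum>b\<in>Basis. cmod (hc i b (h z)) powr p * (1 - cmod z) powr ?a)"
        by (simp add: C_def sum_distrib_left ac_simps)
      finally have *: "(1 - (cmod z)\<^sup>2) powr ?a * norm (h z) powr p
        \<le> C * (\<Sum>b\<in>Basis. cmod (hc i b (h z)) powr p * (1 - cmod z) powr ?a)" .
      have "1 / pi * ((1 - (cmod z)\<^sup>2) powr ?a * norm (h z) powr p) \<le> 1 * ((1 - (cmod z)\<^sup>2) powr ?a * norm (h z) powr p)"
        using pi_gt3 by (intro mult_right_mono) auto
      with * have "1 / pi * ((1 - (cmod z)\<^sup>2) powr ?a * norm (h z) powr p)
        \<le> C * (\<Sum>b\<in>Basis. cmod (hc i b (h z)) powr p * (1 - cmod z) powr ?a)" by simp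
      then have "ennreal (1 / pi * ((1 - (cmod z)\<^sup>2) powr ?a * norm (h z) powr p))
        \<le> ennreal C * ennreal (\<Sum>b\<in>Basis. cmod (hc i b (h z)) powr p * (1 - cmod z) powr ?a)"
        by (subst ennreal_mult'[symmetric]) (auto simp: C_def intro!: ennreal_leI)
      then show ?thesis
        using True by (simp add: sum_ennreal)
    qed simp
  qed
  also have "\<dots> = ennreal C * (\<Sum>b\<in>Basis. disc_int p ?a (\<lambda>z. hc i b (h z)))"
  proof -
    have "(\<integral>\<^sup>+z. ennreal C * (\<Sum>b\<in>Basis. ?F b z) \<partial>lborel) = ennreal C * (\<integral>\<^sup>+z. (\<Sum>b\<in>Basis. ?F b z) \<partial>lborel)"
      by (rule nn_integral_cmult) (intro borel_measurable_sum, measurable)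
    also have "(\<integral>\<^sup>+z. (\<Sum>b\<in>Basis. ?F b z) \<partial>lborel) = (\<Sum>b\<in>Basis. \<integral>\<^sup>+z. ?F b z \<partial>lborel)"
      by (rule nn_integral_sum) measurable
    finally show ?thesis by (simp add: disc_int_def)
  qed
  finally show "slice_int p k h \<le> ennreal C * (\<Sum>b\<in>Basis. disc_int p ?a (\<lambda>z. hc i b (h z)))" .
qed

text \<open>The coordinates of iterated \<open>deriv_x0\<close> are iterated complex derivatives of
  the coordinates, so the disc estimate applies to each of them.\<close>

lemma slice_int_higher_le:
  assumes p: "p > 1"
  obtains C where "C > 0"
    "\<And>f i. slice_regular f \<Longrightarrow> i \<in> imag_units \<Longrightarrow>
       slice_int p (Suc n) (\<lambda>z. (deriv_x0 ^^ Suc n) f (slice i z)) \<le> ennreal C * slice_int p 1 (\<lambda>z. deriv_x0 f (slice i z))"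
proof -
  obtain C1 where C1: "C1 > 0" "\<And>i (h :: complex \<Rightarrow> quat). i \<in> imag_units \<Longrightarrow> continuous_on (ball 0 1) h \<Longrightarrow>
      slice_int p (Suc n) h \<le> ennreal C1 * (\<Sum>b\<in>Basis. disc_int p (real (Suc n) * p - 2) (\<lambda>z. hc i b (h z)))"
    by (rule slice_int_le_disc_int_hc[of p "Suc n"]) (use p in auto)
  obtain C2 where C2: "C2 > 0" "\<And>u. u holomorphic_on ball 0 1 \<Longrightarrow>
    disc_int p (real (Suc n) * p - 2) ((deriv ^^ Suc n) u) \<le> ennreal C2 * disc_int p (p - 2) (deriv u)"
    using disc_int_higher_deriv_le[OF p, of n] by blast
  obtain C3 where C3: "C3 > 0" "\<And>i (h :: complex \<Rightarrow> quat) (b :: quat). i \<in> imag_units \<Longrightarrow> b \<in> Basis \<Longrightarrow> continuous_on (ball 0 1) h \<Longrightarrow>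
      disc_int p (real 1 * p - 2) (\<lambda>z. hc i b (h z)) \<le> ennreal C3 * slice_int p 1 h"
    by (rule disc_int_hc_le_slice_int[of p 1]) (use p in auto)
  show ?thesis
  proof
    show "C1 * (real (card (Basis :: quat set)) * (C2 * C3)) > 0"
      using C1 C2 C3 by simp
    fix f i assume f: "slice_regular f" and i: "i \<in> imag_units"
    have sh: "slice_hol i f" by (rule slice_regular_slice_hol[OF f i])
    let ?I = "slice_int p 1 (\<lambda>z. deriv_x0 f (slice i z))"
    have "disc_int p (real (Suc n) * p - 2) (\<lambda>z. hc i b ((deriv_x0 ^^ Suc n) f (slice i z))) \<le> ennreal (C2 * C3) * ?I"
      if b: "b \<in> Basis" for b
    proof -
      let ?u = "\<lambda>z. hc i b (f (slice i z))"
      have "disc_int p (real (Suc n) * p - 2) (\<lambda>z. hc i b ((deriv_x0 ^^ Suc n) f (slice i z)))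
         = disc_int p (real (Suc n) * p - 2) ((deriv ^^ Suc n) ?u)"
        unfolding disc_int_def
        by (rule nn_integral_cong) (use hc_funpow_deriv_x0[OF sh, of _ b "Suc n"] in \<open>auto simp: indicator_def\<close>)
      also have "\<dots> \<le> ennreal C2 * disc_int p (p - 2) (deriv ?u)"
        by (rule C2(2)[OF slice_holD[OF sh]])
      also have "disc_int p (p - 2) (deriv ?u) = disc_int p (p - 2) (\<lambda>z. hc i b (deriv_x0 f (slice i z)))"
        unfolding disc_int_def
        by (rule nn_integral_cong) (use hc_deriv_x0[OF sh, of _ b] in \<open>auto simp: indicator_def\<close>)
      also have "ennreal C2 * \<dots> \<le> ennreal C2 * (ennreal C3 * ?I)"
        using C3(2)[OF i b slice_hol_continuous[OF slice_hol_deriv_x0[OF sh]]]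
        by (intro mult_left_mono) auto
      finally show ?thesis using C2 C3 by (simp add: ennreal_mult mult.assoc)
    qed
    then have "(\<Sum>b\<in>Basis. disc_int p (real (Suc n) * p - 2) (\<lambda>z. hc i b ((deriv_x0 ^^ Suc n) f (slice i z))))
      \<le> of_nat (card (Basis :: quat set)) * (ennreal (C2 * C3) * ?I)"
      by (rule sum_bounded_above)
    then have "slice_int p (Suc n) (\<lambda>z. (deriv_x0 ^^ Suc n) f (slice i z))
      \<le> ennreal C1 * (of_nat (card (Basis :: quat set)) * (ennreal (C2 * C3) * ?I))"
      by (intro order_trans[OF C1(2)[OF i slice_hol_continuous[OF slice_hol_funpow[OF sh]]]] mult_left_mono) auto
    also have "\<dots> = ennreal (C1 * (real (card (Basis :: quat set)) * (C2 * C3))) * ?I"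
      using C1 C2 C3 by (simp add: ennreal_mult ennreal_of_nat_eq_real_of_nat mult.assoc)
    finally show "slice_int p (Suc n) (\<lambda>z. (deriv_x0 ^^ Suc n) f (slice i z))
      \<le> ennreal (C1 * (real (card (Basis :: quat set)) * (C2 * C3))) * ?I" .
  qed
qed

text \<open>The extra terms are derivatives at 0, the same number for every imaginary unit, so a
  finite supremum on the right gives a finite one on the left. The factor 2 inside the power is that
  of \<open>cmod_hc_le\<close>.\<close>

lemma slice_int_le_higher:
  assumes p: "p > 1"
  obtains C where "C > 0"
    "\<And>f i. slice_regular f \<Longrightarrow> i \<in> imag_units \<Longrightarrow>
       slice_int p 1 (\<lambda>z. deriv_x0 f (slice i z)) \<le> ennreal C *
        (ennreal (\<Sum>k=1..n. (2 * norm ((deriv_x0 ^^ k) f 0)) powr p)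
          + slice_int p (Suc n) (\<lambda>z. (deriv_x0 ^^ Suc n) f (slice i z)))"
proof -
  obtain C1 where C1: "C1 > 0" "\<And>i (h :: complex \<Rightarrow> quat). i \<in> imag_units \<Longrightarrow> continuous_on (ball 0 1) h \<Longrightarrow>
      slice_int p 1 h \<le> ennreal C1 * (\<Sum>b\<in>Basis. disc_int p (real 1 * p - 2) (\<lambda>z. hc i b (h z)))"
    by (rule slice_int_le_disc_int_hc[of p 1]) (use p in auto)
  obtain C2 where C2: "C2 > 0" "\<And>u. u holomorphic_on ball 0 1 \<Longrightarrow>
    disc_int p (p - 2) (deriv u) \<le> ennreal C2 *
      (ennreal (\<Sum>k=1..n. cmod ((deriv ^^ k) u 0) powr p) + disc_int p (real (Suc n) * p - 2) ((deriv ^^ Suc n) u))"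
    using disc_int_le_higher_deriv[OF p, of n] by blast
  obtain C3 where C3: "C3 > 0" "\<And>i (h :: complex \<Rightarrow> quat) (b :: quat). i \<in> imag_units \<Longrightarrow> b \<in> Basis \<Longrightarrow> continuous_on (ball 0 1) h \<Longrightarrow>
      disc_int p (real (Suc n) * p - 2) (\<lambda>z. hc i b (h z)) \<le> ennreal C3 * slice_int p (Suc n) h"
    by (rule disc_int_hc_le_slice_int[of p "Suc n"]) (use p in auto)
  show ?thesis
  proof
    show "C1 * (real (card (Basis :: quat set)) * (C2 * (1 + C3))) > 0"
      using C1 C2 C3 by simp
    fix f i assume f: "slice_regular f" and i: "i \<in> imag_units"
    have sh: "slice_hol i f" by (rule slice_regular_slice_hol[OF f i])
    let ?I = "slice_int p (Suc n) (\<lambda>z. (deriv_x0 ^^ Suc n) f (slice i z))"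
    let ?S = "ennreal (\<Sum>k=1..n. (2 * norm ((deriv_x0 ^^ k) f 0)) powr p)"
    have "disc_int p (real 1 * p - 2) (\<lambda>z. hc i b (deriv_x0 f (slice i z))) \<le> ennreal (C2 * (1 + C3)) * (?S + ?I)"
      if b: "b \<in> Basis" for b
    proof -
      let ?u = "\<lambda>z. hc i b (f (slice i z))"
      have "disc_int p (real 1 * p - 2) (\<lambda>z. hc i b (deriv_x0 f (slice i z))) = disc_int p (p - 2) (deriv ?u)"
        unfolding disc_int_def
        by (rule nn_integral_cong) (use hc_deriv_x0[OF sh, of _ b] in \<open>auto simp: indicator_def\<close>)
      also have "\<dots> \<le> ennreal C2 *
         (ennreal (\<Sum>k=1..n. cmod ((deriv ^^ k) ?u 0) powr p) + disc_int p (real (Suc n) * p - 2) ((deriv ^^ Suc n) ?u))"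
        by (rule C2(2)[OF slice_holD[OF sh]])
      also have "disc_int p (real (Suc n) * p - 2) ((deriv ^^ Suc n) ?u)
         = disc_int p (real (Suc n) * p - 2) (\<lambda>z. hc i b ((deriv_x0 ^^ Suc n) f (slice i z)))"
        unfolding disc_int_def
        by (rule nn_integral_cong) (use hc_funpow_deriv_x0[OF sh, of _ b "Suc n"] in \<open>auto simp: indicator_def\<close>)
      also have "ennreal C2 * (ennreal (\<Sum>k=1..n. cmod ((deriv ^^ k) ?u 0) powr p) + \<dots>)
        \<le> ennreal C2 * (?S + ennreal C3 * ?I)"
      proof (intro mult_left_mono add_mono ennreal_leI sum_mono)
        fix k
        have "(deriv ^^ k) ?u 0 = hc i b ((deriv_x0 ^^ k) f 0)"
          using hc_funpow_deriv_x0[OF sh, of 0 b k] by simp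
        then show "cmod ((deriv ^^ k) ?u 0) powr p \<le> (2 * norm ((deriv_x0 ^^ k) f 0)) powr p"
          using cmod_hc_le[OF i, of b "(deriv_x0 ^^ k) f 0"] b p by (intro powr_mono2) auto
      qed (use C3(2)[OF i b slice_hol_continuous[OF slice_hol_funpow[OF sh, of "Suc n"]]] in auto)
      also have "\<dots> \<le> ennreal C2 * (ennreal (1 + C3) * (?S + ?I))"
      proof (rule mult_left_mono)
        have "?S + ennreal C3 * ?I \<le> 1 * (?S + ?I) + ennreal C3 * (?S + ?I)"
          by (intro add_mono mult_left_mono) auto
        also have "\<dots> = ennreal (1 + C3) * (?S + ?I)"
          using C3 by (simp add: ennreal_plus distrib_right)
        finally show "?S + ennreal C3 * ?I \<le> ennreal (1 + C3) * (?S + ?I)" .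
      qed simp
      finally show ?thesis using C2 C3 by (simp add: ennreal_mult mult.assoc)
    qed
    then have "(\<Sum>b\<in>Basis. disc_int p (real 1 * p - 2) (\<lambda>z. hc i b (deriv_x0 f (slice i z))))
      \<le> of_nat (card (Basis :: quat set)) * (ennreal (C2 * (1 + C3)) * (?S + ?I))"
      by (rule sum_bounded_above)
    then have "slice_int p 1 (\<lambda>z. deriv_x0 f (slice i z))
      \<le> ennreal C1 * (of_nat (card (Basis :: quat set)) * (ennreal (C2 * (1 + C3)) * (?S + ?I)))"
      by (intro order_trans[OF C1(2)[OF i slice_hol_continuous[OF slice_hol_deriv_x0[OF sh]]]] mult_left_mono) auto
    also have "\<dots> = ennreal (C1 * (real (card (Basis :: quat set)) * (C2 * (1 + C3)))) * (?S + ?I)"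
      using C1 C2 C3 by (simp only: ennreal_mult ennreal_of_nat_eq_real_of_nat mult.assoc less_imp_le of_nat_0_le_iff add_nonneg_nonneg zero_le_one mult_nonneg_nonneg)
    finally show "slice_int p 1 (\<lambda>z. deriv_x0 f (slice i z))
      \<le> ennreal (C1 * (real (card (Basis :: quat set)) * (C2 * (1 + C3)))) * (?S + ?I)" .
  qed
qed

definition besov_sup :: "real \<Rightarrow> nat \<Rightarrow> (quat \<Rightarrow> quat) \<Rightarrow> ennreal" where
  "besov_sup p k f = (SUP i\<in>imag_units. slice_int p k (\<lambda>z. (deriv_x0 ^^ k) f (slice i z)))"

lemma besov_sup_finite_iff:
  assumes p: "p > 1" and f: "slice_regular f"
  shows "besov_sup p (Suc n) f < \<infinity> \<longleftrightarrow> besov_sup p 1 f < \<infinity>"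
proof
  obtain C where C: "C > 0" "\<And>f i. slice_regular f \<Longrightarrow> i \<in> imag_units \<Longrightarrow>
       slice_int p (Suc n) (\<lambda>z. (deriv_x0 ^^ Suc n) f (slice i z)) \<le> ennreal C * slice_int p 1 (\<lambda>z. deriv_x0 f (slice i z))"
    using slice_int_higher_le[OF p, of n] by blast
  assume fin: "besov_sup p 1 f < \<infinity>"
  have "besov_sup p (Suc n) f \<le> ennreal C * besov_sup p 1 f"
    unfolding besov_sup_def
  proof (rule SUP_least)
    fix i assume i: "i \<in> imag_units"
    have "slice_int p 1 (\<lambda>z. deriv_x0 f (slice i z)) \<le> (SUP i\<in>imag_units. slice_int p 1 (\<lambda>z. (deriv_x0 ^^ 1) f (slice i z)))"
      by (rule SUP_upper2[OF i]) simp
    then show "slice_int p (Suc n) (\<lambda>z. (deriv_x0 ^^ Suc n) f (slice i z))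
      \<le> ennreal C * (SUP i\<in>imag_units. slice_int p 1 (\<lambda>z. (deriv_x0 ^^ 1) f (slice i z)))"
      by (intro order_trans[OF C(2)[OF f i]] mult_left_mono) auto
  qed
  then show "besov_sup p (Suc n) f < \<infinity>"
    using fin by (simp add: ennreal_mult_less_top le_less_trans)
next
  obtain C where C: "C > 0" "\<And>f i. slice_regular f \<Longrightarrow> i \<in> imag_units \<Longrightarrow>
       slice_int p 1 (\<lambda>z. deriv_x0 f (slice i z)) \<le> ennreal C *
        (ennreal (\<Sum>k=1..n. (2 * norm ((deriv_x0 ^^ k) f 0)) powr p)
          + slice_int p (Suc n) (\<lambda>z. (deriv_x0 ^^ Suc n) f (slice i z)))"
    using slice_int_le_higher[OF p, of n] by blast
  let ?S = "ennreal (\<Sum>k=1..n. (2 * norm ((deriv_x0 ^^ k) f 0)) powr p)"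
  assume fin: "besov_sup p (Suc n) f < \<infinity>"
  have "besov_sup p 1 f \<le> ennreal C * (?S + besov_sup p (Suc n) f)"
    unfolding besov_sup_def
  proof (rule SUP_least)
    fix i assume i: "i \<in> imag_units"
    have "slice_int p 1 (\<lambda>z. (deriv_x0 ^^ 1) f (slice i z)) \<le>
      ennreal C * (?S + slice_int p (Suc n) (\<lambda>z. (deriv_x0 ^^ Suc n) f (slice i z)))"
      using C(2)[OF f i] by simp
    also have "\<dots> \<le> ennreal C * (?S + (SUP i\<in>imag_units. slice_int p (Suc n) (\<lambda>z. (deriv_x0 ^^ Suc n) f (slice i z))))"
      by (intro mult_left_mono add_left_mono SUP_upper i) simp
    finally show "slice_int p 1 (\<lambda>z. (deriv_x0 ^^ 1) f (slice i z))
      \<le> ennreal C * (?S + (SUP i\<in>imag_units. slice_int p (Suc n) (\<lambda>z. (deriv_x0 ^^ Suc n) f (slice i z))))" .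
  qed
  then show "besov_sup p 1 f < \<infinity>"
    using fin by (simp add: ennreal_mult_less_top le_less_trans)
qed

subsection \<open>Power series and limits of slice regular functions\<close>

lemma imag_units_nonempty: "imag_units \<noteq> {}"
proof -
  have "(0, axis 1 1) \<in> imag_units" by (simp add: imag_units_def norm_prod_def)
  then show ?thesis by blast
qed

lemma slice_surj:
  obtains i z where "i \<in> imag_units" "q = slice i z" "cmod z = norm q"
proof (cases "snd q = 0")
  case True
  obtain i where "i \<in> imag_units" using imag_units_nonempty by blast
  moreover have "q = slice i (of_real (fst q))"
    using True by (simp add: quat_of_real_def prod_eq_iff)
  ultimately show ?thesis using that norm_slice by metis
next
  case False
  define i where "i = (0::real, (1 / norm (snd q)) *\<^sub>R snd q)"
  have "i \<in> imag_units" using False by (simp add: i_def imag_units_def norm_prod_def)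
  moreover have "q = slice i (Complex (fst q) (norm (snd q)))"
    using False by (simp add: slice_def i_def quat_of_real_def prod_eq_iff)
  ultimately show ?thesis using that norm_slice by metis
qed

primrec qpow :: "quat \<Rightarrow> nat \<Rightarrow> quat" where
  "qpow q 0 = quat_of_real 1"
| "qpow q (Suc m) = q *\<^sub>H qpow q m"

lemma norm_qpow: "norm (qpow q m) = norm q ^ m"
proof -
  have "norm (quat_of_real 1) = 1" by (simp add: quat_of_real_def norm_prod_def)
  then show ?thesis by (induction m) (simp_all add: norm_qmult)
qed

lemma hc_qpow: "i \<in> imag_units \<Longrightarrow> hc i v (qpow (slice i z) m *\<^sub>H a) = z ^ m * hc i v a"
  by (induction m) (simp_all add: qmult_assoc hc_slice qmult_of_real_left)

lemma qmult_diff_left: "(q - r) *\<^sub>H s = q *\<^sub>H s - r *\<^sub>H s"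
  by (rule linear_diff[OF bounded_linear.linear[OF bounded_linear_qmult_left]])

lemma qmult_diff_right: "q *\<^sub>H (r - s) = q *\<^sub>H r - q *\<^sub>H s"
  by (rule linear_diff[OF bounded_linear.linear[OF bounded_linear_qmult_right]])

text \<open>The telescoping q(q^m - q'^m) + (q - q')q'^m respects the order of the factors, so
  \<open>q\<close> and \<open>q'\<close> may lie in different slices.\<close>

lemma norm_qpow_diff_le:
  assumes "norm q \<le> s" "norm q' \<le> s"
  shows "norm (qpow q m - qpow q' m) \<le> real m * s ^ (m - 1) * norm (q - q')"
proof (induction m)
  case (Suc m)
  have s: "s \<ge> 0" using assms norm_ge_zero order_trans by blast
  have "qpow q (Suc m) - qpow q' (Suc m) = q *\<^sub>H (qpow q m - qpow q' m) + (q - q') *\<^sub>H qpow q' m"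
    by (simp add: qmult_diff_left qmult_diff_right)
  then have "norm (qpow q (Suc m) - qpow q' (Suc m))
      \<le> norm q * norm (qpow q m - qpow q' m) + norm (q - q') * norm q' ^ m"
    by (metis norm_qmult norm_qpow norm_triangle_ineq)
  also have "\<dots> \<le> s * (real m * s ^ (m - 1) * norm (q - q')) + norm (q - q') * s ^ m"
    using assms s by (intro add_mono mult_mono Suc mult_left_mono power_mono) auto
  \<comment> \<open>The case m = 0 is separate because \<open>m - 1\<close> is truncated; both sides
    are then 0.\<close>
  also have "s * (real m * s ^ (m - 1) * norm (q - q')) = real m * s ^ m * norm (q - q')"
    by (cases m) auto
  finally show ?case by (simp add: algebra_simps)
qed simp

definition taylor_coeff :: "(quat \<Rightarrow> quat) \<Rightarrow> nat \<Rightarrow> quat" where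
  "taylor_coeff f m = (1 / fact m) *\<^sub>R (deriv_x0 ^^ m) f 0"

lemma hc_taylor_coeff:
  assumes "slice_hol i f"
  shows "hc i v (taylor_coeff f m) = (deriv ^^ m) (\<lambda>z. hc i v (f (slice i z))) 0 / fact m"
proof -
  have "hc i v (taylor_coeff f m) = (1 / fact m) *\<^sub>R hc i v ((deriv_x0 ^^ m) f (slice i 0))"
    by (simp add: taylor_coeff_def bounded_linear.linear[OF bounded_linear_hc] linear_scale)
  also have "hc i v ((deriv_x0 ^^ m) f (slice i 0)) = (deriv ^^ m) (\<lambda>z. hc i v (f (slice i z))) 0"
    by (rule hc_funpow_deriv_x0[OF assms]) simp
  finally show ?thesis by (simp add: scaleR_conv_of_real)
qed

text \<open>Each slice has its own Taylor expansion, but the coefficients come from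
  \<open>deriv_x0\<close> at 0, which refers to no slice. The expansions therefore agree and form
  one quaternionic series.\<close>

lemma slice_regular_power_series:
  assumes f: "slice_regular f" and q: "norm q < 1"
  shows "(\<lambda>m. qpow q m *\<^sub>H taylor_coeff f m) sums f q"
proof -
  obtain i z where i: "i \<in> imag_units" and qz: "q = slice i z" and z: "cmod z = norm q"
    by (rule slice_surj)
  have sh: "slice_hol i f" by (rule slice_regular_slice_hol[OF f i])
  have "(\<lambda>m. \<Sum>b\<in>Basis. ((qpow q m *\<^sub>H taylor_coeff f m) \<bullet> b) *\<^sub>R b) sums (\<Sum>b\<in>Basis. (f q \<bullet> b) *\<^sub>R b)"
  proof (rule sums_sum)
    fix b :: quat
    have "(\<lambda>m. (deriv ^^ m) (\<lambda>z. hc i b (f (slice i z))) 0 / fact m * (z - 0) ^ m) sums hc i b (f (slice i z))"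
      by (rule holomorphic_power_series[OF slice_holD[OF sh]]) (use z q in simp)
    then have "(\<lambda>m. hc i b (qpow q m *\<^sub>H taylor_coeff f m)) sums hc i b (f q)"
      by (simp add: qz hc_qpow[OF i] hc_taylor_coeff[OF sh] mult.commute)
    then have "(\<lambda>m. (qpow q m *\<^sub>H taylor_coeff f m) \<bullet> b) sums (f q \<bullet> b)"
      by (auto dest!: sums_Re)
    then show "(\<lambda>m. ((qpow q m *\<^sub>H taylor_coeff f m) \<bullet> b) *\<^sub>R b) sums ((f q \<bullet> b) *\<^sub>R b)"
      by (rule bounded_linear.sums[OF bounded_linear_scaleR_left])
  qed
  then show ?thesis by (simp add: euclidean_representation)
qed

text \<open>Cauchy's inequality is applied to the coordinate along the coefficient \<open>a\<close>
  itself: its m-th Taylor coefficient has real part |a|^2, while the coordinate function is at most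
  2|a|M; one factor |a| cancels.\<close>

lemma norm_taylor_coeff_le:
  assumes f: "slice_regular f" and r: "0 < r" "r < 1" and M: "\<And>q. norm q \<le> r \<Longrightarrow> norm (f q) \<le> M"
  shows "norm (taylor_coeff f m) \<le> 2 * M / r ^ m"
proof (cases "taylor_coeff f m = 0")
  case True
  have "norm (f 0) \<le> M" using M[of 0] r by simp
  then have "M \<ge> 0" by (rule order_trans[OF norm_ge_zero])
  then show ?thesis using True r by simp
next
  case False
  obtain i where i: "i \<in> imag_units" using imag_units_nonempty by blast
  have sh: "slice_hol i f" by (rule slice_regular_slice_hol[OF f i])
  define a where "a = taylor_coeff f m"
  let ?u = "\<lambda>z. hc i a (f (slice i z))"
  have "cmod ((deriv ^^ m) ?u 0) \<le> fact m * (2 * norm a * M) / r ^ m"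
  proof (rule Cauchy_inequality)
    show "?u holomorphic_on ball 0 r"
      by (rule holomorphic_on_subset[OF slice_holD[OF sh]]) (use r in auto)
    show "continuous_on (cball 0 r) ?u"
      by (rule continuous_on_subset[OF holomorphic_on_imp_continuous_on[OF slice_holD[OF sh]]]) (use r in auto)
    fix z assume "cmod (0 - z) = r"
    then have "norm (f (slice i z)) \<le> M" by (intro M) (simp add: norm_slice[OF i])
    then show "cmod (?u z) \<le> 2 * norm a * M"
      by (intro order_trans[OF cmod_hc_le[OF i]] mult_left_mono) auto
  qed (use r in auto)
  then have "cmod (hc i a a) \<le> 2 * norm a * M / r ^ m"
    unfolding a_def hc_taylor_coeff[OF sh] by (simp add: norm_divide field_simps)
  moreover have "(norm a)\<^sup>2 \<le> cmod (hc i a a)"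
    using inner_le_hc[of a a i] by (simp add: power2_norm_eq_inner)
  ultimately have "norm a * norm a \<le> norm a * (2 * M / r ^ m)"
    by (simp add: power2_eq_square ac_simps)
  then have "norm a \<le> 2 * M / r ^ m"
    by (rule mult_left_le_imp_le) (use False in \<open>simp add: a_def\<close>)
  then show ?thesis by (simp add: a_def)
qed

section \<open>From a supremum bound to the full derivative, and locally uniform limits\<close>

text \<open>The Lipschitz bounds of the powers are summed against the bounds of the coefficients. As
  \<open>L\<close> depends only on \<open>s\<close> and \<open>r\<close> and the estimate is linear
  in \<open>M\<close>, it can be applied to differences of members of a sequence.\<close>

lemma slice_regular_lipschitz:
  assumes s: "0 \<le> s" "s < r" and r: "r < 1"
  obtains L where "L \<ge> 0"
    "\<And>f M q q'. slice_regular f \<Longrightarrow> (\<And>q. norm q \<le> r \<Longrightarrow> norm (f q) \<le> M) \<Longrightarrow>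
       norm q \<le> s \<Longrightarrow> norm q' \<le> s \<Longrightarrow> norm (f q - f q') \<le> L * M * norm (q - q')"
proof
  have r0: "r > 0" using s by simp
  let ?c = "\<lambda>m. real m * s ^ (m - 1) * (2 / r ^ m)"
  \<comment> \<open>The term of index 0 vanishes and that of index m+1 is (2/r)(m+1)(s/r)^m, so the
    series is a multiple of a differentiated geometric series.\<close>
  have "summable (\<lambda>m. real (Suc m) * (s / r) ^ m)"
    using geometric_deriv_sums[of "s / r"] s r0 by (auto simp: sums_iff)
  then have "summable (\<lambda>m. (2 / r) * (real (Suc m) * (s / r) ^ m))"
    by (rule summable_mult)
  moreover have "(\<lambda>m. (2 / r) * (real (Suc m) * (s / r) ^ m)) = (\<lambda>m. ?c (Suc m))"
    using r0 by (auto simp: power_divide)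
  ultimately have "summable (\<lambda>m. ?c (Suc m))" by (simp only:)
  then have c: "summable ?c" using summable_Suc_iff[of ?c] by blast
  show "(\<Sum>m. ?c m) \<ge> 0"
    by (rule suminf_nonneg[OF c]) (use s r0 in auto)
  fix f M and q q' :: quat
  assume f: "slice_regular f" and M: "\<And>q. norm q \<le> r \<Longrightarrow> norm (f q) \<le> M" and q: "norm q \<le> s" "norm q' \<le> s"
  let ?d = "\<lambda>m. qpow q m *\<^sub>H taylor_coeff f m - qpow q' m *\<^sub>H taylor_coeff f m"
  have sums: "?d sums (f q - f q')"
    using q s r by (intro sums_diff slice_regular_power_series f) auto
  have le: "norm (?d m) \<le> ?c m * (M * norm (q - q'))" for m
  proof -
    have "norm (?d m) = norm (qpow q m - qpow q' m) * norm (taylor_coeff f m)"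
      by (simp add: qmult_diff_left[symmetric] norm_qmult)
    also have "\<dots> \<le> (real m * s ^ (m - 1) * norm (q - q')) * (2 * M / r ^ m)"
      using s by (intro mult_mono norm_qpow_diff_le q norm_taylor_coeff_le[OF f r0 r M]) auto
    finally show ?thesis by (simp add: ac_simps)
  qed
  have c': "summable (\<lambda>m. ?c m * (M * norm (q - q')))" by (rule summable_mult2[OF c])
  have "norm (f q - f q') = norm (\<Sum>m. ?d m)" using sums by (simp add: sums_iff)
  also have "\<dots> \<le> (\<Sum>m. ?c m * (M * norm (q - q')))"
    by (rule norm_suminf_le[OF le c'])
  also have "\<dots> = (\<Sum>m. ?c m) * (M * norm (q - q'))"
    by (rule suminf_mult2[OF c, symmetric])
  also have "\<dots> = (\<Sum>m. ?c m) * M * norm (q - q')"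
    by (simp only: mult.assoc)
  finally show "norm (f q - f q') \<le> (\<Sum>m. ?c m) * M * norm (q - q')" .
qed

text \<open>The difference quotient in direction \<open>h\<close> is tested against the vector
  \<open>D h\<close>; in the limit one factor |D h| cancels.\<close>

lemma has_derivative_norm_le_lipschitz:
  fixes f :: "'a::real_normed_vector \<Rightarrow> 'b::real_inner"
  assumes D: "(f has_derivative D) (at x)" and S: "open S" "x \<in> S"
    and L: "\<And>y. y \<in> S \<Longrightarrow> norm (f y - f x) \<le> L * norm (y - x)"
  shows "norm (D h) \<le> L * norm h"
proof (cases "D h = 0")
  case True
  \<comment> \<open>The sign of \<open>L\<close> is not given; the Lipschitz bound at a point of
    \<open>S\<close> different from \<open>x\<close> shows that it is nonnegative.\<close>
  have "0 \<le> L * norm h"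
  proof (cases "h = 0")
    case False
    obtain e where e: "e > 0" "ball x e \<subseteq> S" using S openE by blast
    define y where "y = x + (e / 2 / norm h) *\<^sub>R h"
    have n: "norm (y - x) = e / 2" using False e by (simp add: y_def)
    then have "y \<in> S" using e by (auto simp: dist_norm norm_minus_commute)
    then have "0 \<le> L * (e / 2)" using L[of y] n norm_ge_zero order_trans by metis
    then have "L \<ge> 0" using e by (simp add: zero_le_mult_iff)
    then show ?thesis by simp
  qed simp
  then show ?thesis using True by simp
next
  case False
  let ?g = "\<lambda>t. (f (x + t *\<^sub>R h) - f x) \<bullet> D h"
  have lin: "((\<lambda>t::real. x + t *\<^sub>R h) has_derivative (\<lambda>t. t *\<^sub>R h)) (at 0)"
    by (auto intro!: derivative_eq_intros)
  have "((\<lambda>t. f (x + t *\<^sub>R h)) has_derivative (\<lambda>t. D (t *\<^sub>R h))) (at 0)"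
    by (rule has_derivative_compose[OF lin]) (use D in simp)
  then have "(?g has_derivative (\<lambda>t. D (t *\<^sub>R h) \<bullet> D h)) (at 0)"
    by (auto intro!: derivative_eq_intros)
  moreover have "D (t *\<^sub>R h) \<bullet> D h = (D h \<bullet> D h) * t" for t
    using linear_scale[OF has_derivative_linear[OF D]] by simp
  ultimately have "(?g has_real_derivative D h \<bullet> D h) (at 0)"
    by (simp add: has_field_derivative_def)
  then have lim: "((\<lambda>t. ?g t / t) \<longlongrightarrow> D h \<bullet> D h) (at 0)"
    unfolding DERIV_def by simp
  have "((\<lambda>t::real. x + t *\<^sub>R h) \<longlongrightarrow> x + 0 *\<^sub>R h) (at 0)"
    by (intro tendsto_intros)
  then have "eventually (\<lambda>t::real. x + t *\<^sub>R h \<in> S) (at 0)"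
    using S by (auto dest: topological_tendstoD)
  then have "eventually (\<lambda>t. ?g t / t \<le> L * norm h * norm (D h)) (at 0)"
  proof (rule eventually_elim2[OF _ eventually_at_ball'[OF zero_less_one]])
    fix t :: real assume t: "x + t *\<^sub>R h \<in> S" "t \<in> ball 0 1 \<and> t \<noteq> 0 \<and> t \<in> UNIV"
    have "?g t / t \<le> \<bar>?g t\<bar> / \<bar>t\<bar>" using abs_ge_self[of "?g t / t"] by (simp add: abs_divide)
    also have "\<dots> \<le> (L * (\<bar>t\<bar> * norm h)) * norm (D h) / \<bar>t\<bar>"
      using L[OF t(1)] Cauchy_Schwarz_ineq2[of "f (x + t *\<^sub>R h) - f x" "D h"]
      by (intro divide_right_mono order_trans[OF Cauchy_Schwarz_ineq2] mult_right_mono) auto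
    also have "\<dots> = L * norm h * norm (D h)" using t by simp
    finally show "?g t / t \<le> L * norm h * norm (D h)" .
  qed
  then have "D h \<bullet> D h \<le> L * norm h * norm (D h)"
    by (rule tendsto_upperbound[OF lim]) simp
  then show ?thesis
    using False by (simp add: power2_norm_eq_inner[symmetric] power2_eq_square)
qed

lemma slice_regular_add:
  assumes f: "slice_regular f" and g: "slice_regular g"
  shows "slice_regular (\<lambda>q. f q + g q)"
  unfolding slice_regular_iff
proof (intro conjI ballI allI impI)
  show "(\<lambda>q. f q + g q) differentiable at q" if "q \<in> ball 0 1" for q
    using f g that by (simp add: slice_regular_def differentiable_add)
  fix i z D assume i: "i \<in> imag_units" and z: "cmod z < 1"
    and D: "((\<lambda>q. f q + g q) has_derivative D) (at (slice i z))"
  have "slice i z \<in> ball 0 1" using slice_in_ball[OF i] z by blast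
  then obtain A B where A: "(f has_derivative A) (at (slice i z))" and B: "(g has_derivative B) (at (slice i z))"
    using f g unfolding slice_regular_def differentiable_def by meson
  have "D = (\<lambda>h. A h + B h)"
    by (rule has_derivative_unique[OF D has_derivative_add[OF A B]])
  moreover have "A (quat_of_real 1) + i *\<^sub>H A i = 0" "B (quat_of_real 1) + i *\<^sub>H B i = 0"
    using f g A B i z unfolding slice_regular_iff by blast+
  ultimately show "D (quat_of_real 1) + i *\<^sub>H D i = 0"
    by (simp add: qmult_add_right algebra_simps)
qed

lemma slice_regular_qmult:
  assumes f: "slice_regular f"
  shows "slice_regular (\<lambda>q. f q *\<^sub>H c)"
  unfolding slice_regular_iff
proof (intro conjI ballI allI impI)
  show "(\<lambda>q. f q *\<^sub>H c) differentiable at q" if "q \<in> ball 0 1" for q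
    using f that bounded_linear.has_derivative[OF bounded_linear_qmult_left]
    unfolding slice_regular_def differentiable_def by blast
  fix i z D assume i: "i \<in> imag_units" and z: "cmod z < 1"
    and D: "((\<lambda>q. f q *\<^sub>H c) has_derivative D) (at (slice i z))"
  have "slice i z \<in> ball 0 1" using slice_in_ball[OF i] z by blast
  then obtain A where A: "(f has_derivative A) (at (slice i z))"
    using f unfolding slice_regular_def differentiable_def by meson
  have "D = (\<lambda>h. A h *\<^sub>H c)"
    by (rule has_derivative_unique[OF D bounded_linear.has_derivative[OF bounded_linear_qmult_left A]])
  moreover have "A (quat_of_real 1) + i *\<^sub>H A i = 0"
    using f A i z unfolding slice_regular_iff by blast
  then have "(A (quat_of_real 1) + i *\<^sub>H A i) *\<^sub>H c = 0"
    by (simp add: qmult_def zero_prod_def)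
  ultimately show "D (quat_of_real 1) + i *\<^sub>H D i = 0"
    by (simp add: qmult_add_left qmult_assoc)
qed

lemma slice_regular_diff:
  assumes "slice_regular f" and "slice_regular g"
  shows "slice_regular (\<lambda>q. f q - g q)"
proof -
  have "(\<lambda>q. f q - g q) = (\<lambda>q. f q + g q *\<^sub>H quat_of_real (-1))"
    by (simp add: qmult_of_real_right)
  then show ?thesis
    using slice_regular_add[OF assms(1) slice_regular_qmult[OF assms(2)]] by simp
qed

lemma slice_regular_has_derivative:
  assumes "slice_regular f" "norm q < 1"
  shows "(f has_derivative frechet_derivative f (at q)) (at q)"
proof -
  have "q \<in> ball 0 1" using assms by simp
  then have "f differentiable at q" using assms(1) unfolding slice_regular_def by blast
  then show ?thesis by (simp add: frechet_derivative_works)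
qed

text \<open>Applied to F_k - F_l, the Lipschitz estimate converts uniform smallness on a larger ball
  into smallness of the difference of the full derivatives on a smaller one. This is the hypothesis
  of \<open>has_derivative_sequence\<close>; the Cauchy-Riemann condition then passes to the limit
  derivative.\<close>

lemma slice_regular_limit:
  assumes F: "\<And>k. slice_regular (F k)"
    and cau: "\<And>r e. 0 < r \<Longrightarrow> r < 1 \<Longrightarrow> 0 < e \<Longrightarrow>
      \<exists>K. \<forall>k\<ge>K. \<forall>l\<ge>K. \<forall>q. norm q \<le> r \<longrightarrow> norm (F k q - F l q) \<le> e"
  obtains f where "slice_regular f" "\<And>q. q \<notin> ball 0 1 \<Longrightarrow> f q = 0"
    "\<And>q. q \<in> ball 0 1 \<Longrightarrow> (\<lambda>k. F k q) \<longlonglongrightarrow> f q"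
    "\<And>q. q \<in> ball 0 1 \<Longrightarrow> (\<lambda>k. deriv_x0 (F k) q) \<longlonglongrightarrow> deriv_x0 f q"
proof
  define D where "D k q = frechet_derivative (F k) (at q)" for k q
  have D: "(F k has_derivative D k q) (at q)" if "norm q < 1" for k q
    unfolding D_def by (rule slice_regular_has_derivative[OF F that])
  have Dcau: "\<exists>K. \<forall>k\<ge>K. \<forall>l\<ge>K. \<forall>q h. norm q < s \<longrightarrow> norm (D k q h - D l q h) \<le> e * norm h"
    if s: "0 < s" "s < 1" and e: "e > 0" for s e
  proof -
    define r where "r = (1 + s) / 2"
    have r: "s < r" "0 < r" "r < 1" using s by (auto simp: r_def)
    obtain L where L: "L \<ge> 0" "\<And>f M q q'. slice_regular f \<Longrightarrow> (\<And>q. norm q \<le> r \<Longrightarrow> norm (f q) \<le> M) \<Longrightarrow>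
       norm q \<le> s \<Longrightarrow> norm q' \<le> s \<Longrightarrow> norm (f q - f q') \<le> L * M * norm (q - q')"
      using slice_regular_lipschitz[of s r] s r by (metis less_imp_le)
    \<comment> \<open>The summand 1 avoids a division by zero, as only \<open>L \<ge> 0\<close> is
      known.\<close>
    have "e / (L + 1) > 0" using e L(1) by (simp add: add_nonneg_pos)
    from cau[OF r(2,3) this]
    obtain K where K: "\<And>k l q. k \<ge> K \<Longrightarrow> l \<ge> K \<Longrightarrow> norm q \<le> r \<Longrightarrow> norm (F k q - F l q) \<le> e / (L + 1)"
      by blast
    show ?thesis
    proof (intro exI[of _ K] allI impI)
      fix k l and q h :: quat assume kl: "k \<ge> K" "l \<ge> K" and q: "norm q < s"
      have q1: "norm q < 1" using q s by simp
      have "norm (D k q h - D l q h) \<le> (L * (e / (L + 1))) * norm h"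
      proof (rule has_derivative_norm_le_lipschitz[where S = "ball 0 s" and x = q])
        show "((\<lambda>q. F k q - F l q) has_derivative (\<lambda>h. D k q h - D l q h)) (at q)"
          by (intro has_derivative_diff D q1)
        fix y :: quat assume y: "y \<in> ball 0 s"
        show "norm (F k y - F l y - (F k q - F l q)) \<le> L * (e / (L + 1)) * norm (y - q)"
          by (rule L(2)[OF slice_regular_diff[OF F F]]) (use K kl y q in auto)
      qed (use q in auto)
      also have "\<dots> \<le> e * norm h"
        using L(1) e by (intro mult_right_mono) (auto simp: field_simps)
      finally show "norm (D k q h - D l q h) \<le> e * norm h" .
    qed
  qed
  have Fconv: "convergent (\<lambda>k. F k q)" if q: "norm q < 1" for q
  proof (rule Cauchy_convergent, rule metric_CauchyI)
    fix e :: real assume e: "e > 0"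
    obtain r where r: "norm q < r" "r < 1" using dense q by blast
    have r0: "r > 0" using r(1) norm_ge_zero[of q] by linarith
    have "e / 2 > 0" using e by simp
    from cau[OF r0 r(2) this]
    obtain K where K: "\<And>k l q. k \<ge> K \<Longrightarrow> l \<ge> K \<Longrightarrow> norm q \<le> r \<Longrightarrow> norm (F k q - F l q) \<le> e / 2"
      by blast
    have "dist (F k q) (F l q) < e" if "k \<ge> K" "l \<ge> K" for k l
      using K[OF that, of q] r e by (simp add: dist_norm)
    then show "\<exists>K. \<forall>k\<ge>K. \<forall>l\<ge>K. dist (F k q) (F l q) < e" by blast
  qed
  have Dconv: "convergent (\<lambda>k. D k q h)" if q: "norm q < 1" for q h
  proof (rule Cauchy_convergent, rule metric_CauchyI)
    fix e :: real assume e: "e > 0"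
    define e' where "e' = e / (norm h + 1)"
    have pos: "norm h + 1 > 0" by (simp add: add_nonneg_pos)
    then have e': "e' > 0" "e' * norm h < e"
      using e by (simp_all only: e'_def divide_pos_pos times_divide_eq_left pos_divide_less_eq)
        (simp add: algebra_simps)
    obtain r where r: "norm q < r" "r < 1" using dense q by blast
    have r0: "r > 0" using r(1) norm_ge_zero[of q] by linarith
    from Dcau[OF r0 r(2) e'(1)]
    obtain K where K: "\<And>k l q h. k \<ge> K \<Longrightarrow> l \<ge> K \<Longrightarrow> norm q < r \<Longrightarrow> norm (D k q h - D l q h) \<le> e' * norm h"
      by blast
    have "dist (D k q h) (D l q h) < e" if "k \<ge> K" "l \<ge> K" for k l
      using K[OF that r(1), of h] e'(2) by (simp add: dist_norm)
    then show "\<exists>K. \<forall>k\<ge>K. \<forall>l\<ge>K. dist (D k q h) (D l q h) < e" by blast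
  qed
  \<comment> \<open>The value 0 outside the ball is the extension convention of
    \<open>besov_space\<close>.\<close>
  define f where "f q = (if norm q < 1 then lim (\<lambda>k. F k q) else 0)" for q
  define D' where "D' q h = lim (\<lambda>k. D k q h)" for q h
  have Flim: "(\<lambda>k. F k q) \<longlonglongrightarrow> f q" if "norm q < 1" for q
    using Fconv[OF that] that by (simp add: f_def convergent_LIMSEQ_iff)
  have Dlim: "(\<lambda>k. D k q h) \<longlonglongrightarrow> D' q h" if "norm q < 1" for q h
    using Dconv[OF that] by (simp add: D'_def convergent_LIMSEQ_iff)
  have fD: "(f has_derivative D' q) (at q)" if q: "norm q < 1" for q
  proof -
    obtain s where s: "norm q < s" "s < 1" using dense q by blast
    have s0: "s > 0" using s(1) norm_ge_zero[of q] by linarith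
    \<comment> \<open>\<open>has_derivative_sequence\<close> yields some differentiable limit on the
      smaller ball; uniqueness of limits identifies it with \<open>f\<close> afterwards.\<close>
    have "\<exists>g. \<forall>x\<in>ball 0 s. (\<lambda>k. F k x) \<longlonglongrightarrow> g x \<and> (g has_derivative D' x) (at x within ball 0 s)"
    proof (rule has_derivative_sequence)
      show "(F k has_derivative D k x) (at x within ball 0 s)" if "x \<in> ball 0 s" for k x
        by (rule has_derivative_at_withinI, rule D) (use that s in simp)
      show "(\<lambda>k. F k 0) \<longlonglongrightarrow> f 0" by (rule Flim) simp
      show "0 \<in> ball 0 s" using s0 by simp
      fix e :: real assume e: "e > 0"
      from Dcau[OF s0 s(2) e]
      obtain K where K: "\<And>k l q h. k \<ge> K \<Longrightarrow> l \<ge> K \<Longrightarrow> norm q < s \<Longrightarrow> norm (D k q h - D l q h) \<le> e * norm h"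
        by blast
      show "\<forall>\<^sub>F k in sequentially. \<forall>x\<in>ball 0 s. \<forall>h. norm (D k x h - D' x h) \<le> e * norm h"
      proof (rule eventually_sequentiallyI[of K], intro ballI allI)
        fix k and x h :: quat assume k: "k \<ge> K" and x: "x \<in> ball 0 s"
        have "(\<lambda>l. norm (D k x h - D l x h)) \<longlonglongrightarrow> norm (D k x h - D' x h)"
          using x s by (intro tendsto_intros Dlim) auto
        then show "norm (D k x h - D' x h) \<le> e * norm h"
        proof (rule LIMSEQ_le_const2, intro exI[of _ K] allI impI)
          show "norm (D k x h - D l x h) \<le> e * norm h" if "l \<ge> K" for l
            by (rule K[OF k that]) (use x in simp)
        qed
      qed
    qed simp
    then obtain g where g: "\<And>x. x \<in> ball 0 s \<Longrightarrow> (\<lambda>k. F k x) \<longlonglongrightarrow> g x"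
      "\<And>x. x \<in> ball 0 s \<Longrightarrow> (g has_derivative D' x) (at x within ball 0 s)" by blast
    have gf: "g x = f x" if "x \<in> ball 0 s" for x
      using LIMSEQ_unique[OF g(1)[OF that] Flim] that s by auto
    have qs: "q \<in> ball 0 s" using s by auto
    have "(g has_derivative D' q) (at q)"
      using g(2)[OF qs] at_within_open[OF qs open_ball] by simp
    then show ?thesis
      by (rule has_derivative_transform_within_open[OF _ open_ball qs]) (rule gf)
  qed
  show "slice_regular f"
    unfolding slice_regular_iff
  proof (intro conjI ballI allI impI)
    show "f differentiable at q" if "q \<in> ball 0 1" for q
      using fD[of q] that by (auto simp: differentiable_def)
    fix i z E assume i: "i \<in> imag_units" and z: "cmod z < 1" and E: "(f has_derivative E) (at (slice i z))"
    let ?q = "slice i z"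
    have q: "norm ?q < 1" using z by (simp add: norm_slice[OF i])
    have "D k ?q (quat_of_real 1) + i *\<^sub>H D k ?q i = 0" for k
      using F[of k] D[OF q, of k] i z unfolding slice_regular_iff by blast
    moreover have "(\<lambda>k. D k ?q (quat_of_real 1) + i *\<^sub>H D k ?q i) \<longlonglongrightarrow> D' ?q (quat_of_real 1) + i *\<^sub>H D' ?q i"
      by (intro tendsto_add Dlim q bounded_linear.tendsto[OF bounded_linear_qmult_right])
    ultimately have "D' ?q (quat_of_real 1) + i *\<^sub>H D' ?q i = 0"
      by (simp add: LIMSEQ_const_iff)
    then show "E (quat_of_real 1) + i *\<^sub>H E i = 0"
      using has_derivative_unique[OF E fD[OF q]] by simp
  qed
  show "f q = 0" if "q \<notin> ball 0 1" for q using that by (simp add: f_def)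
  show "(\<lambda>k. F k q) \<longlonglongrightarrow> f q" if "q \<in> ball 0 1" for q using that by (intro Flim) simp
  show "(\<lambda>k. deriv_x0 (F k) q) \<longlonglongrightarrow> deriv_x0 f q" if "q \<in> ball 0 1" for q
  proof -
    have q: "norm q < 1" using that by simp
    show ?thesis
      using Dlim[OF q, of "quat_of_real 1"] by (simp add: deriv_x0_eq[OF D[OF q]] deriv_x0_eq[OF fD[OF q]])
  qed
qed

subsection \<open>The norm\<close>

definition besov_semi :: "real \<Rightarrow> (quat \<Rightarrow> quat) \<Rightarrow> ennreal" where
  "besov_semi p f = (SUP i\<in>imag_units. ennreal_powr (slice_int p 1 (\<lambda>z. deriv_x0 f (slice i z))) (1 / p))"

lemma besov_enorm_eq: "besov_enorm p f = ennreal (norm (f 0)) + besov_semi p f"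
proof -
  have "(\<integral>\<^sup>+z\<in>ball 0 1. ennreal ((1 - (cmod z)\<^sup>2) powr p * norm (deriv_x0 f (slice i z)) powr p) \<partial>disc_lambda)
    = slice_int p 1 (\<lambda>z. deriv_x0 f (slice i z))" for i
    unfolding slice_int_def
  proof (rule nn_integral_cong)
    fix z :: complex
    have "(cmod z)\<^sup>2 \<le> 1" if "cmod z < 1"
      using that by (simp add: power_le_one)
    then show "ennreal ((1 - (cmod z)\<^sup>2) powr p * norm (deriv_x0 f (slice i z)) powr p) * indicator (ball 0 1) z
      = ennreal (norm ((1 - (cmod z)\<^sup>2) ^ 1 *\<^sub>R deriv_x0 f (slice i z)) powr p) * indicator (ball 0 1) z"
      by (cases "cmod z < 1") (simp_all add: powr_mult)
  qed
  then show ?thesis by (simp add: besov_enorm_def besov_semi_def)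
qed

lemma ennreal_powr_le_iff:
  assumes "p > 0" "A \<ge> 0"
  shows "ennreal_powr x (1 / p) \<le> ennreal A \<longleftrightarrow> x \<le> ennreal (A powr p)"
proof (cases x rule: ennreal_cases)
  case (real r)
  have "r powr (1 / p) \<le> A \<longleftrightarrow> (r powr (1 / p)) powr p \<le> A powr p"
    using assms powr_mono2[of p "r powr (1 / p)" A] powr_less_mono2[of p A "r powr (1 / p)"] by fastforce
  also have "(r powr (1 / p)) powr p = r"
    using assms real by (simp add: powr_powr)
  finally show ?thesis
    using assms real by (simp add: ennreal_powr_def ennreal_le_iff)
qed (simp add: ennreal_powr_def top_unique)

text \<open>Removes the supremum and the p-th root at once: later estimates are proved slice by
  slice for p-th powers, with a real bound \<open>A\<close>.\<close>

lemma besov_semi_le_iff: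
  assumes "p > 0" "A \<ge> 0"
  shows "besov_semi p f \<le> ennreal A \<longleftrightarrow>
    (\<forall>i\<in>imag_units. slice_int p 1 (\<lambda>z. deriv_x0 f (slice i z)) \<le> ennreal (A powr p))"
  unfolding besov_semi_def SUP_le_iff ennreal_powr_le_iff[OF assms] ..

lemma besov_semi_finite_iff:
  assumes "p > 0"
  shows "besov_semi p f < \<infinity> \<longleftrightarrow> besov_sup p 1 f < \<infinity>"
proof
  assume "besov_semi p f < \<infinity>"
  then obtain A where A: "A \<ge> 0" "besov_semi p f = ennreal A"
    by (cases "besov_semi p f" rule: ennreal_cases) auto
  then have "\<forall>i\<in>imag_units. slice_int p 1 (\<lambda>z. deriv_x0 f (slice i z)) \<le> ennreal (A powr p)"
    using besov_semi_le_iff[OF assms A(1), of f] by simp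
  then have "besov_sup p 1 f \<le> ennreal (A powr p)"
    unfolding besov_sup_def by (intro SUP_least) simp
  then show "besov_sup p 1 f < \<infinity>" by (simp add: le_less_trans)
next
  assume "besov_sup p 1 f < \<infinity>"
  then obtain B where B: "B \<ge> 0" "besov_sup p 1 f = ennreal B"
    by (cases "besov_sup p 1 f" rule: ennreal_cases) auto
  have "\<forall>i\<in>imag_units. slice_int p 1 (\<lambda>z. deriv_x0 f (slice i z)) \<le> ennreal ((B powr (1 / p)) powr p)"
    using assms B by (auto simp: powr_powr B(2)[symmetric] besov_sup_def intro: SUP_upper2)
  then have "besov_semi p f \<le> ennreal (B powr (1 / p))"
    by (subst besov_semi_le_iff) (use assms in auto)
  then show "besov_semi p f < \<infinity>" by (simp add: le_less_trans)
qed

text \<open>Since p n > 1 forces n >= 1, the order comparison applies, and membership becomes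
  finiteness of the seminorm that occurs in the norm.\<close>

lemma besov_space_eq:
  assumes p: "p > 1" and n: "p * real n > 1"
  shows "besov_space p n = {f. slice_regular f \<and> (\<forall>q. q \<notin> ball 0 1 \<longrightarrow> f q = 0) \<and> besov_semi p f < \<infinity>}"
proof -
  obtain m where m: "n = Suc m" using n by (cases n) auto
  show ?thesis
    unfolding besov_space_def slice_int_def[symmetric] besov_sup_def[symmetric] m
    using besov_sup_finite_iff[OF p] besov_semi_finite_iff[of p] p by auto
qed

section \<open>Minkowski's inequality and homogeneity of the seminorm\<close>

lemma slice_int_cong:
  "(\<And>z. cmod z < 1 \<Longrightarrow> h z = g z) \<Longrightarrow> slice_int p k h = slice_int p k g"
  unfolding slice_int_def by (intro nn_integral_cong) (simp add: indicator_def)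

lemma slice_int_measurable:
  assumes "continuous_on (ball 0 1) h"
  shows "(\<lambda>z. ennreal (norm ((1 - (cmod z)\<^sup>2) ^ k *\<^sub>R h z) powr p) * indicator (ball 0 1) z) \<in> borel_measurable disc_lambda"
proof -
  have "(\<lambda>z. ennreal (norm ((1 - (cmod z)\<^sup>2) ^ k *\<^sub>R h z) powr p) * indicator (ball 0 1) z) \<in> borel_measurable borel"
    by (rule measurable_on_open[where \<phi> = "\<lambda>x. ennreal (norm x powr p)"]) (auto intro!: continuous_intros assms)
  then show ?thesis by (simp add: disc_lambda_def disc_A_def)
qed

text \<open>(x+y)/(A+B) is the convex combination of x/A and y/B with weights A/(A+B) and B/(A+B),
  so the tangent of the p-th power at this mean gives the claim.\<close>

lemma powr_add_le_convex:
  fixes x y A B p :: real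
  assumes "x \<ge> 0" "y \<ge> 0" "A > 0" "B > 0" "p \<ge> 1"
  shows "(x + y) powr p \<le> (A + B) powr (p - 1) * (A powr (1 - p) * x powr p + B powr (1 - p) * y powr p)"
proof (cases "x + y = 0")
  case False
  define t where "t = (x + y) / (A + B)"
  have t: "t > 0" using False assms by (simp add: t_def)
  have 1: "A * (x / A) powr p = A powr (1 - p) * x powr p" "B * (y / B) powr p = B powr (1 - p) * y powr p"
    using assms by (simp_all add: powr_divide powr_diff)
  have "A * (t powr p + p * t powr (p - 1) * (x / A - t)) + B * (t powr p + p * t powr (p - 1) * (y / B - t))
     = (A + B) * t powr p + p * t powr (p - 1) * ((x + y) - (A + B) * t)"
    using assms by (simp add: algebra_simps)
  also have "(x + y) - (A + B) * t = 0" using assms by (simp add: t_def)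
  finally have "(A + B) * t powr p
     = A * (t powr p + p * t powr (p - 1) * (x / A - t)) + B * (t powr p + p * t powr (p - 1) * (y / B - t))"
    by simp
  also have "\<dots> \<le> A * (x / A) powr p + B * (y / B) powr p"
    using assms t by (intro add_mono mult_left_mono powr_above_tangent) auto
  finally have "(A + B) * t powr p \<le> A powr (1 - p) * x powr p + B powr (1 - p) * y powr p"
    unfolding 1 .
  then have "(A + B) powr (p - 1) * ((A + B) * t powr p)
    \<le> (A + B) powr (p - 1) * (A powr (1 - p) * x powr p + B powr (1 - p) * y powr p)"
    by (rule mult_left_mono) simp
  also have "(A + B) powr (p - 1) * ((A + B) * t powr p) = (x + y) powr p"
    using assms by (simp add: t_def powr_divide powr_diff)
  finally show ?thesis .
qed (use assms in auto)

text \<open>Integrating \<open>powr_add_le_convex\<close> with the bounds themselves as weights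
  gives Minkowski's inequality without roots of extended reals: the right-hand side collapses to
  (A+B)^(p-1)(A+B).\<close>

lemma slice_int_add_le:
  assumes p: "p \<ge> 1" and AB: "A > 0" "B > 0"
    and h: "continuous_on (ball 0 1) h" "slice_int p k h \<le> ennreal (A powr p)"
    and g: "continuous_on (ball 0 1) g" "slice_int p k g \<le> ennreal (B powr p)"
  shows "slice_int p k (\<lambda>z. h z + g z) \<le> ennreal ((A + B) powr p)"
proof -
  let ?c = "ennreal ((A + B) powr (p - 1))" and ?a = "ennreal (A powr (1 - p))" and ?b = "ennreal (B powr (1 - p))"
  define I :: "(complex \<Rightarrow> quat) \<Rightarrow> complex \<Rightarrow> ennreal" where
    "I h z = ennreal (norm ((1 - (cmod z)\<^sup>2) ^ k *\<^sub>R h z) powr p) * indicator (ball 0 1) z" for h z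
  have I: "slice_int p k h = (\<integral>\<^sup>+z. I h z \<partial>disc_lambda)" for h
    by (simp add: slice_int_def I_def)
  have [measurable]: "I h \<in> borel_measurable disc_lambda" "I g \<in> borel_measurable disc_lambda"
    unfolding I_def by (rule slice_int_measurable, rule h g)+
  have "slice_int p k (\<lambda>z. h z + g z) \<le> (\<integral>\<^sup>+z. ?c * (?a * I h z + ?b * I g z) \<partial>disc_lambda)"
    unfolding I
  proof (rule nn_integral_mono)
    fix z
    let ?s = "(1 - (cmod z)\<^sup>2) ^ k"
    have "norm (?s *\<^sub>R (h z + g z)) powr p \<le> (norm (?s *\<^sub>R h z) + norm (?s *\<^sub>R g z)) powr p"
      using p by (intro powr_mono2) (auto simp only: scaleR_right_distrib norm_ge_zero intro: norm_triangle_ineq)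
    also have "\<dots> \<le> (A + B) powr (p - 1) * (A powr (1 - p) * norm (?s *\<^sub>R h z) powr p + B powr (1 - p) * norm (?s *\<^sub>R g z) powr p)"
      by (rule powr_add_le_convex) (use AB p in auto)
    finally have *: "ennreal (norm (?s *\<^sub>R (h z + g z)) powr p)
      \<le> ?c * (?a * ennreal (norm (?s *\<^sub>R h z) powr p) + ?b * ennreal (norm (?s *\<^sub>R g z) powr p))"
      by (subst ennreal_mult_sum[symmetric]) (auto intro: ennreal_leI)
    show "I (\<lambda>z. h z + g z) z \<le> ?c * (?a * I h z + ?b * I g z)"
    proof (cases "z \<in> ball 0 1")
      case True
      show ?thesis using * unfolding I_def indicator_simps(1)[OF True] mult_1_right .
    next
      case False
      show ?thesis unfolding I_def indicator_simps(2)[OF False] by simp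
    qed
  qed
  also have "\<dots> = ?c * (\<integral>\<^sup>+z. ?a * I h z + ?b * I g z \<partial>disc_lambda)"
    by (rule nn_integral_cmult) measurable
  also have "(\<integral>\<^sup>+z. ?a * I h z + ?b * I g z \<partial>disc_lambda)
      = (\<integral>\<^sup>+z. ?a * I h z \<partial>disc_lambda) + (\<integral>\<^sup>+z. ?b * I g z \<partial>disc_lambda)"
    by (rule nn_integral_add) measurable
  also have "(\<integral>\<^sup>+z. ?a * I h z \<partial>disc_lambda) = ?a * slice_int p k h"
    unfolding I by (rule nn_integral_cmult) measurable
  also have "(\<integral>\<^sup>+z. ?b * I g z \<partial>disc_lambda) = ?b * slice_int p k g"
    unfolding I by (rule nn_integral_cmult) measurable
  also have "?c * (?a * slice_int p k h + ?b * slice_int p k g)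
      \<le> ?c * (ennreal (A powr (1 - p)) * ennreal (A powr p) + ennreal (B powr (1 - p)) * ennreal (B powr p))"
    by (intro mult_left_mono add_mono h g) auto
  also have "\<dots> = ennreal ((A + B) powr (p - 1) * (A powr (1 - p) * A powr p + B powr (1 - p) * B powr p))"
    by (rule ennreal_mult_sum[symmetric]) auto
  also have "(A + B) powr (p - 1) * (A powr (1 - p) * A powr p + B powr (1 - p) * B powr p) = (A + B) powr p"
  proof -
    have "A powr (1 - p) * A powr p = A" "B powr (1 - p) * B powr p = B"
      using AB by (simp_all add: powr_add[symmetric])
    moreover have "(A + B) powr (p - 1) * (A + B) = (A + B) powr p"
      using AB by (simp add: powr_diff)
    ultimately show ?thesis by simp
  qed
  finally show ?thesis .
qed

lemma deriv_x0_linear: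
  assumes f: "slice_regular f" and q: "norm q < 1"
  shows "slice_regular g \<Longrightarrow> deriv_x0 (\<lambda>q. f q + g q) q = deriv_x0 f q + deriv_x0 g q"
    and "slice_regular g \<Longrightarrow> deriv_x0 (\<lambda>q. f q - g q) q = deriv_x0 f q - deriv_x0 g q"
    and "deriv_x0 (\<lambda>q. f q *\<^sub>H c) q = deriv_x0 f q *\<^sub>H c"
proof -
  note D = slice_regular_has_derivative[OF _ q]
  show "deriv_x0 (\<lambda>q. f q + g q) q = deriv_x0 f q + deriv_x0 g q" if g: "slice_regular g"
    using deriv_x0_eq[OF has_derivative_add[OF D[OF f] D[OF g]]] deriv_x0_eq[OF D[OF f]] deriv_x0_eq[OF D[OF g]]
    by simp
  show "deriv_x0 (\<lambda>q. f q - g q) q = deriv_x0 f q - deriv_x0 g q" if g: "slice_regular g"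
    using deriv_x0_eq[OF has_derivative_diff[OF D[OF f] D[OF g]]] deriv_x0_eq[OF D[OF f]] deriv_x0_eq[OF D[OF g]]
    by simp
  show "deriv_x0 (\<lambda>q. f q *\<^sub>H c) q = deriv_x0 f q *\<^sub>H c"
    using deriv_x0_eq[OF bounded_linear.has_derivative[OF bounded_linear_qmult_left D[OF f]]] deriv_x0_eq[OF D[OF f]]
    by simp
qed

lemma continuous_on_deriv_x0_slice:
  assumes "slice_regular f" "i \<in> imag_units"
  shows "continuous_on (ball 0 1) (\<lambda>z. deriv_x0 f (slice i z))"
  by (intro slice_hol_continuous slice_hol_deriv_x0 slice_regular_slice_hol assms)

lemma besov_semi_add_le:
  assumes p: "p \<ge> 1" and f: "slice_regular f" and g: "slice_regular g"
  shows "besov_semi p (\<lambda>q. f q + g q) \<le> besov_semi p f + besov_semi p g"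
proof (rule ennreal_le_epsilon)
  fix e :: real assume fin: "besov_semi p f + besov_semi p g < top" and e: "e > 0"
  obtain a where a: "a \<ge> 0" "besov_semi p f = ennreal a"
    using fin by (cases "besov_semi p f" rule: ennreal_cases) auto
  obtain b where b: "b \<ge> 0" "besov_semi p g = ennreal b"
    using fin by (cases "besov_semi p g" rule: ennreal_cases) auto
  \<comment> \<open>\<open>slice_int_add_le\<close> needs positive bounds, while a seminorm may
    vanish; hence half of \<open>e\<close> is added to each.\<close>
  have pos: "a + e / 2 > 0" "b + e / 2 > 0" using a b e by (auto simp: add_nonneg_pos)
  have "besov_semi p f \<le> ennreal (a + e / 2)" "besov_semi p g \<le> ennreal (b + e / 2)"
    unfolding a b using e by (auto intro: ennreal_leI)
  then have le: "slice_int p 1 (\<lambda>z. deriv_x0 f (slice i z)) \<le> ennreal ((a + e / 2) powr p)"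
     "slice_int p 1 (\<lambda>z. deriv_x0 g (slice i z)) \<le> ennreal ((b + e / 2) powr p)" if "i \<in> imag_units" for i
    using that p pos by (simp_all add: besov_semi_le_iff)
  have "besov_semi p (\<lambda>q. f q + g q) \<le> ennreal ((a + e / 2) + (b + e / 2))"
  proof (subst besov_semi_le_iff, safe)
    fix i assume i: "i \<in> imag_units"
    have "slice_int p 1 (\<lambda>z. deriv_x0 (\<lambda>q. f q + g q) (slice i z))
      = slice_int p 1 (\<lambda>z. deriv_x0 f (slice i z) + deriv_x0 g (slice i z))"
      by (rule slice_int_cong) (simp add: deriv_x0_linear f g norm_slice[OF i])
    also have "\<dots> \<le> ennreal (((a + e / 2) + (b + e / 2)) powr p)"
      by (rule slice_int_add_le[OF p pos continuous_on_deriv_x0_slice[OF f i] le(1)[OF i]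
            continuous_on_deriv_x0_slice[OF g i] le(2)[OF i]])
    finally show "slice_int p 1 (\<lambda>z. deriv_x0 (\<lambda>q. f q + g q) (slice i z)) \<le> ennreal (((a + e / 2) + (b + e / 2)) powr p)" .
  qed (use p pos in auto)
  also have "(a + e / 2) + (b + e / 2) = a + b + e" by simp
  also have "ennreal (a + b + e) = besov_semi p f + besov_semi p g + ennreal e"
    using a b e by (simp add: ennreal_plus)
  finally show "besov_semi p (\<lambda>q. f q + g q) \<le> besov_semi p f + besov_semi p g + ennreal e" .
qed

lemma besov_semi_zero: "p > 0 \<Longrightarrow> besov_semi p (\<lambda>_. 0) = 0"
proof -
  assume p: "p > 0"
  have "deriv_x0 (\<lambda>_. 0) = (\<lambda>_. 0)" by (auto simp: deriv_x0_def)
  then have "besov_semi p (\<lambda>_. 0) \<le> ennreal 0"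
    using p by (subst besov_semi_le_iff) (auto simp: slice_int_def)
  then show ?thesis by simp
qed

lemma ennreal_powr_cmult:
  assumes "c > 0" "p > 0"
  shows "ennreal_powr (ennreal (c powr p) * x) (1 / p) = ennreal c * ennreal_powr x (1 / p)"
proof (cases x rule: ennreal_cases)
  case (real r)
  then have "(c powr p * r) powr (1 / p) = c * r powr (1 / p)"
    using assms by (simp add: powr_mult powr_powr)
  then show ?thesis
    using real assms by (simp add: ennreal_powr_def ennreal_mult'[symmetric])
qed (use assms in \<open>simp add: ennreal_powr_def ennreal_mult_top\<close>)

lemma besov_semi_qmult:
  assumes p: "p > 0" and f: "slice_regular f"
  shows "besov_semi p (\<lambda>q. f q *\<^sub>H c) = ennreal (norm c) * besov_semi p f"
proof (cases "c = 0")
  case True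
  then show ?thesis using besov_semi_zero[OF p] by simp
next
  case False
  have "slice_int p 1 (\<lambda>z. deriv_x0 (\<lambda>q. f q *\<^sub>H c) (slice i z))
     = ennreal (norm c powr p) * slice_int p 1 (\<lambda>z. deriv_x0 f (slice i z))" if i: "i \<in> imag_units" for i
  proof -
    let ?h = "\<lambda>z. deriv_x0 f (slice i z)"
    have "slice_int p 1 (\<lambda>z. deriv_x0 (\<lambda>q. f q *\<^sub>H c) (slice i z)) = slice_int p 1 (\<lambda>z. ?h z *\<^sub>H c)"
      by (rule slice_int_cong) (simp add: deriv_x0_linear(3) f norm_slice[OF i])
    also have "\<dots> = (\<integral>\<^sup>+z. ennreal (norm c powr p) * (ennreal (norm ((1 - (cmod z)\<^sup>2) ^ 1 *\<^sub>R ?h z) powr p) * indicator (ball 0 1) z) \<partial>disc_lambda)"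
      unfolding slice_int_def
      by (rule nn_integral_cong) (simp add: norm_qmult powr_mult ennreal_mult' ac_simps)
    also have "\<dots> = ennreal (norm c powr p) * slice_int p 1 ?h"
      unfolding slice_int_def
      by (rule nn_integral_cmult, rule slice_int_measurable, rule continuous_on_deriv_x0_slice[OF f i])
    finally show ?thesis .
  qed
  then have "besov_semi p (\<lambda>q. f q *\<^sub>H c)
    = (SUP i\<in>imag_units. ennreal (norm c) * ennreal_powr (slice_int p 1 (\<lambda>z. deriv_x0 f (slice i z))) (1 / p))"
    unfolding besov_semi_def using False p by (intro SUP_cong refl) (simp add: ennreal_powr_cmult)
  then show ?thesis
    unfolding besov_semi_def by (simp add: SUP_mult_left_ennreal)
qed

section \<open>Evaluation estimates and Fatou's lemma\<close>

text \<open>The seminorm bounds the derivative of each coordinate uniformly on the disc of radius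
  \<open>r\<close>, and integration from 0 bounds the coordinate. This makes the norm definite and
  makes norm-Cauchy sequences locally uniformly Cauchy.\<close>

lemma besov_local_bound:
  assumes p: "p > 1" and r: "r < 1"
  obtains C where "C \<ge> 0"
    "\<And>f N q. slice_regular f \<Longrightarrow> N \<ge> 0 \<Longrightarrow> besov_semi p f \<le> ennreal N \<Longrightarrow> norm q \<le> r \<Longrightarrow>
       norm (f q) \<le> norm (f 0) + C * N"
proof -
  obtain C1 where C1: "C1 > 0" "\<And>v z. v holomorphic_on ball 0 1 \<Longrightarrow> cmod z \<le> r \<Longrightarrow>
       ennreal (cmod (v z) powr p) \<le> ennreal C1 * disc_int p (real 1 * p - 2) v"
    using disc_int_local_bound[OF r, of p "real 1 * p - 2"] p by auto
  obtain C2 where C2: "C2 > 0" "\<And>i h b. i \<in> imag_units \<Longrightarrow> b \<in> Basis \<Longrightarrow> continuous_on (ball 0 1) h \<Longrightarrow>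
      disc_int p (real 1 * p - 2) (\<lambda>z. hc i b (h z)) \<le> ennreal C2 * slice_int p 1 h"
    by (rule disc_int_hc_le_slice_int[of p 1]) (use p in auto)
  \<comment> \<open>The p-th root passes from the bound on |u'|^p to one on |u'|, which makes the
    estimate linear in \<open>N\<close>.\<close>
  define c where "c = (C1 * C2) powr (1 / p)"
  have c: "c \<ge> 0" by (simp add: c_def)
  have cp: "c powr p = C1 * C2" using C1 C2 p by (simp add: c_def powr_powr)
  show ?thesis
  proof
    show "real (card (Basis :: quat set)) * c \<ge> 0" using c by simp
    fix f N and q :: quat
    assume f: "slice_regular f" and N: "N \<ge> 0" "besov_semi p f \<le> ennreal N" and q: "norm q \<le> r"
    obtain i z where i: "i \<in> imag_units" and qz: "q = slice i z" and z: "cmod z = norm q"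
      by (rule slice_surj)
    have sh: "slice_hol i f" by (rule slice_regular_slice_hol[OF f i])
    have int_le: "slice_int p 1 (\<lambda>z. deriv_x0 f (slice i z)) \<le> ennreal (N powr p)"
      using N i p by (simp add: besov_semi_le_iff)
    have *: "\<bar>(f q - f 0) \<bullet> b\<bar> \<le> c * N" if b: "b \<in> Basis" for b
    proof -
      let ?u = "\<lambda>z. hc i b (f (slice i z))"
      have hol: "?u holomorphic_on ball 0 1" by (rule slice_holD[OF sh])
      have du: "cmod (deriv ?u w) \<le> c * N" if w: "w \<in> cball 0 r" for w :: complex
      proof -
        have "deriv ?u w = hc i b (deriv_x0 f (slice i w))"
          using hc_deriv_x0[OF sh, of w b] w r by simp
        then have "ennreal (cmod (deriv ?u w) powr p) \<le> ennreal C1 * disc_int p (real 1 * p - 2) (\<lambda>z. hc i b (deriv_x0 f (slice i z)))"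
          using C1(2)[OF slice_holD[OF slice_hol_deriv_x0[OF sh]], of w b] w by simp
        also have "\<dots> \<le> ennreal C1 * (ennreal C2 * ennreal (N powr p))"
          by (intro mult_left_mono order_trans[OF C2(2)[OF i b continuous_on_deriv_x0_slice[OF f i]]] int_le) auto
        also have "\<dots> = ennreal ((c * N) powr p)"
          using C1 C2 N c by (simp add: powr_mult cp ennreal_mult'[symmetric] mult.assoc)
        finally have "cmod (deriv ?u w) powr p \<le> (c * N) powr p"
          by (simp add: ennreal_le_iff)
        then show ?thesis
          using p c N powr_less_mono2[of p "c * N" "cmod (deriv ?u w)"] by fastforce
      qed
      have "cmod (?u z - ?u 0) \<le> c * N * cmod (z - 0)"
      proof (rule field_differentiable_bound)
        fix w :: complex assume w: "w \<in> cball 0 r"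
        have "(?u has_field_derivative deriv ?u w) (at w)"
          by (rule holomorphic_derivI[OF hol open_ball]) (use w r in simp)
        then show "(?u has_field_derivative deriv ?u w) (at w within cball 0 r)"
          by (rule has_field_derivative_at_within)
      qed (use du z q order_trans[OF norm_ge_zero q] in auto)
      also have "\<dots> \<le> c * N * 1"
        using c N z q r by (intro mult_left_mono) auto
      finally have "cmod (?u z - ?u 0) \<le> c * N" by simp
      moreover have "\<bar>(f q - f 0) \<bullet> b\<bar> \<le> cmod (?u z - ?u 0)"
        using abs_Re_le_cmod[of "?u z - ?u 0"] by (simp add: qz inner_diff_left)
      ultimately show ?thesis by simp
    qed
    have "norm (f q - f 0) \<le> (\<Sum>b\<in>Basis. \<bar>(f q - f 0) \<bullet> b\<bar>)" by (rule norm_le_l1)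
    also have "\<dots> \<le> real (card (Basis :: quat set)) * (c * N)"
      by (rule sum_bounded_above) (rule *)
    finally show "norm (f q) \<le> norm (f 0) + real (card (Basis :: quat set)) * c * N"
      using norm_triangle_sub[of "f q" "f 0"] by (simp add: mult.assoc)
  qed
qed

text \<open>The bound is asked only from some index on, since a Cauchy condition says nothing about
  the earlier terms.\<close>

lemma slice_int_Fatou:
  assumes p: "p > 0" and h: "\<And>l. continuous_on (ball 0 1) (h l)"
    and lim: "\<And>z. cmod z < 1 \<Longrightarrow> (\<lambda>l. h l z) \<longlonglongrightarrow> g z"
    and le: "\<And>l. l \<ge> L \<Longrightarrow> slice_int p k (h l) \<le> B"
  shows "slice_int p k g \<le> B"
proof -
  let ?I = "\<lambda>h z. ennreal (norm ((1 - (cmod z)\<^sup>2) ^ k *\<^sub>R h z) powr p) * indicator (ball 0 1) z"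
  have "slice_int p k g = (\<integral>\<^sup>+z. liminf (\<lambda>l. ?I (h l) z) \<partial>disc_lambda)"
    unfolding slice_int_def
  proof (rule nn_integral_cong)
    fix z :: complex
    have "(\<lambda>l. ?I (h l) z) \<longlonglongrightarrow> ?I g z"
    proof (cases "cmod z < 1")
      case True
      have "(\<lambda>l. norm ((1 - (cmod z)\<^sup>2) ^ k *\<^sub>R h l z) powr p) \<longlonglongrightarrow> norm ((1 - (cmod z)\<^sup>2) ^ k *\<^sub>R g z) powr p"
        by (rule tendsto_powr') (use p in \<open>auto intro!: tendsto_intros lim True\<close>)
      then show ?thesis using True by (auto intro: tendsto_ennrealI)
    qed simp
    then show "?I g z = liminf (\<lambda>l. ?I (h l) z)"
      by (intro lim_imp_Liminf[symmetric]) auto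
  qed
  also have "\<dots> \<le> liminf (\<lambda>l. slice_int p k (h l))"
    unfolding slice_int_def by (rule nn_integral_liminf) (rule slice_int_measurable[OF h])
  also have "\<dots> \<le> B"
    by (rule Liminf_le) (use le in \<open>auto simp: eventually_sequentially\<close>)
  finally show ?thesis .
qed

lemma besov_norm_eq: "besov_semi p f < \<infinity> \<Longrightarrow> ennreal (besov_norm p f) = ennreal (norm (f 0)) + besov_semi p f"
  unfolding besov_norm_def besov_enorm_eq by (simp add: ennreal_enn2real_if)

lemma besov_norm_le:
  assumes "besov_semi p f \<le> ennreal a" "a \<ge> 0"
  shows "besov_norm p f \<le> norm (f 0) + a"
proof -
  have "besov_enorm p f \<le> ennreal (norm (f 0) + a)"
    unfolding besov_enorm_eq using assms by (simp add: ennreal_plus add_left_mono)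
  then show ?thesis unfolding besov_norm_def by (rule enn2real_leI[rotated]) (use assms in auto)
qed

lemma right_quat_subspace_besov:
  assumes p: "p > 1" and n: "p * real n > 1"
  shows "right_quat_subspace (besov_space p n)"
  unfolding right_quat_subspace_def besov_space_eq[OF p n]
proof (intro conjI ballI allI)
  have "slice_regular (\<lambda>_. 0)"
    unfolding slice_regular_iff
    by (auto dest: has_derivative_unique[OF _ has_derivative_const])
  then show "(\<lambda>_. 0) \<in> {f. slice_regular f \<and> (\<forall>q. q \<notin> ball 0 1 \<longrightarrow> f q = 0) \<and> besov_semi p f < \<infinity>}"
    using besov_semi_zero[of p] p by simp
next
  fix f g
  assume "f \<in> {f. slice_regular f \<and> (\<forall>q. q \<notin> ball 0 1 \<longrightarrow> f q = 0) \<and> besov_semi p f < \<infinity>}"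
    and "g \<in> {f. slice_regular f \<and> (\<forall>q. q \<notin> ball 0 1 \<longrightarrow> f q = 0) \<and> besov_semi p f < \<infinity>}"
  then have f: "slice_regular f" "\<And>q. q \<notin> ball 0 1 \<Longrightarrow> f q = 0" "besov_semi p f < \<infinity>"
    and g: "slice_regular g" "\<And>q. q \<notin> ball 0 1 \<Longrightarrow> g q = 0" "besov_semi p g < \<infinity>" by blast+
  have "besov_semi p (\<lambda>x. f x + g x) \<le> besov_semi p f + besov_semi p g"
    using p by (intro besov_semi_add_le f g) simp
  also have "\<dots> < \<infinity>" using f g by simp
  finally show "(\<lambda>x. f x + g x) \<in> {f. slice_regular f \<and> (\<forall>q. q \<notin> ball 0 1 \<longrightarrow> f q = 0) \<and> besov_semi p f < \<infinity>}"
    using slice_regular_add[OF f(1) g(1)] f(2) g(2) by auto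
next
  fix f c
  assume "f \<in> {f. slice_regular f \<and> (\<forall>q. q \<notin> ball 0 1 \<longrightarrow> f q = 0) \<and> besov_semi p f < \<infinity>}"
  then have f: "slice_regular f" "\<And>q. q \<notin> ball 0 1 \<Longrightarrow> f q = 0" "besov_semi p f < \<infinity>" by blast+
  have "besov_semi p (\<lambda>x. f x *\<^sub>H c) < \<infinity>"
    using f p by (simp add: besov_semi_qmult ennreal_mult_less_top)
  then show "(\<lambda>x. f x *\<^sub>H c) \<in> {f. slice_regular f \<and> (\<forall>q. q \<notin> ball 0 1 \<longrightarrow> f q = 0) \<and> besov_semi p f < \<infinity>}"
    using slice_regular_qmult[OF f(1)] f(2) by (auto simp: qmult_def zero_prod_def)
qed

subsection \<open>Completeness\<close>

lemma right_quat_norm_on_besov: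
  assumes p: "p > 1" and n: "p * real n > 1"
  shows "right_quat_norm_on (besov_space p n) (besov_norm p)"
  unfolding right_quat_norm_on_def
proof (intro conjI ballI allI)
  note V = besov_space_eq[OF p n]
  fix f assume "f \<in> besov_space p n"
  then have f: "slice_regular f" "\<And>q. q \<notin> ball 0 1 \<Longrightarrow> f q = 0" "besov_semi p f < \<infinity>"
    unfolding V by blast+
  note Nf = besov_norm_eq[OF f(3)]
  show "0 \<le> besov_norm p f" by (simp add: besov_norm_def)
  show "besov_norm p f = 0 \<longleftrightarrow> f = (\<lambda>_. 0)"
  proof
    assume "besov_norm p f = 0"
    then have z: "norm (f 0) = 0" "besov_semi p f = 0"
      using Nf by (simp_all add: zero_eq_add_iff_both_eq_0)
    show "f = (\<lambda>_. 0)"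
    proof
      fix q
      show "f q = 0"
      proof (cases "q \<in> ball 0 1")
        case True
        then have "norm q < 1" by simp
        then obtain C where "C \<ge> 0" "\<And>f N q'. slice_regular f \<Longrightarrow> N \<ge> 0 \<Longrightarrow> besov_semi p f \<le> ennreal N \<Longrightarrow>
            norm q' \<le> norm q \<Longrightarrow> norm (f q') \<le> norm (f 0) + C * N"
          using besov_local_bound[OF p, of "norm q"] by blast
        \<comment> \<open>As the seminorm vanishes, N = 0 is admissible and |f(q)| <= |f(0)| =
          0.\<close>
        from this(2)[OF f(1), of 0 q] show ?thesis using z by simp
      qed (rule f(2))
    qed
  next
    assume "f = (\<lambda>_. 0)"
    then show "besov_norm p f = 0"
      using besov_semi_zero[of p] p by (simp add: besov_norm_def besov_enorm_eq)
  qed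
  fix c
  have "ennreal (besov_norm p (\<lambda>x. f x *\<^sub>H c)) = ennreal (norm (f 0 *\<^sub>H c)) + besov_semi p (\<lambda>x. f x *\<^sub>H c)"
    by (rule besov_norm_eq) (use f p in \<open>simp add: besov_semi_qmult ennreal_mult_less_top\<close>)
  also have "\<dots> = ennreal (norm c) * ennreal (besov_norm p f)"
    using f p by (simp add: besov_semi_qmult norm_qmult Nf distrib_left ennreal_mult' mult.commute)
  also have "\<dots> = ennreal (besov_norm p f * norm c)"
    by (simp add: ennreal_mult'[symmetric] mult.commute)
  finally show "besov_norm p (\<lambda>x. f x *\<^sub>H c) = besov_norm p f * norm c"
    by (simp add: besov_norm_def)
next
  note V = besov_space_eq[OF p n]
  fix f g assume "f \<in> besov_space p n" "g \<in> besov_space p n"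
  then have f: "slice_regular f" "besov_semi p f < \<infinity>" and g: "slice_regular g" "besov_semi p g < \<infinity>"
    unfolding V by blast+
  have le: "besov_semi p (\<lambda>x. f x + g x) \<le> besov_semi p f + besov_semi p g"
    using p by (intro besov_semi_add_le f g) simp
  also have "\<dots> < \<infinity>" using f g by simp
  finally have "ennreal (besov_norm p (\<lambda>x. f x + g x)) = ennreal (norm (f 0 + g 0)) + besov_semi p (\<lambda>x. f x + g x)"
    by (rule besov_norm_eq)
  also have "\<dots> \<le> ennreal (norm (f 0) + norm (g 0)) + (besov_semi p f + besov_semi p g)"
    by (intro add_mono le ennreal_leI norm_triangle_ineq)
  also have "\<dots> = (ennreal (norm (f 0)) + besov_semi p f) + (ennreal (norm (g 0)) + besov_semi p g)"
    by (simp add: ennreal_plus ac_simps)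
  also have "\<dots> = ennreal (besov_norm p f + besov_norm p g)"
    unfolding besov_norm_eq[OF f(2), symmetric] besov_norm_eq[OF g(2), symmetric]
    by (simp add: besov_norm_def)
  finally show "besov_norm p (\<lambda>x. f x + g x) \<le> besov_norm p f + besov_norm p g"
    by (subst (asm) ennreal_le_iff) (simp_all add: besov_norm_def)
qed

lemma norm_complete_on_besov:
  assumes p: "p > 1" and n: "p * real n > 1"
  shows "norm_complete_on (besov_space p n) (besov_norm p)"
  unfolding norm_complete_on_def
proof (intro allI impI, elim conjE)
  note V = besov_space_eq[OF p n]
  fix F :: "nat \<Rightarrow> quat \<Rightarrow> quat"
  assume "\<forall>k. F k \<in> besov_space p n"
  then have F: "slice_regular (F k)" "q \<notin> ball 0 1 \<Longrightarrow> F k q = 0" "besov_semi p (F k) < \<infinity>" for k q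
    unfolding V by blast+
  assume cau: "\<forall>e>0. \<exists>K. \<forall>k\<ge>K. \<forall>m\<ge>K. besov_norm p (\<lambda>x. F k x - F m x) < e"
  \<comment> \<open>\<open>enn2real\<close> sends infinity to 0, so the Cauchy hypothesis bounds the
    seminorm of a difference only once that seminorm is known to be finite.\<close>
  have diff_fin: "besov_semi p (\<lambda>x. F k x - F l x) < \<infinity>" for k l
  proof -
    have "besov_semi p (\<lambda>x. F k x + F l x *\<^sub>H quat_of_real (-1))
       \<le> besov_semi p (F k) + besov_semi p (\<lambda>x. F l x *\<^sub>H quat_of_real (-1))"
      using p by (intro besov_semi_add_le slice_regular_qmult F) simp
    also have "\<dots> < \<infinity>"
      using F p by (simp add: besov_semi_qmult ennreal_mult_less_top)
    finally show ?thesis by (simp add: qmult_of_real_right)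
  qed
  have small: "\<exists>K. \<forall>k\<ge>K. \<forall>l\<ge>K. norm (F k 0 - F l 0) \<le> e \<and> besov_semi p (\<lambda>x. F k x - F l x) \<le> ennreal e"
    if e: "e > 0" for e
  proof -
    obtain K where K: "\<And>k l. k \<ge> K \<Longrightarrow> l \<ge> K \<Longrightarrow> besov_norm p (\<lambda>x. F k x - F l x) < e"
      using cau e by blast
    have "norm (F k 0 - F l 0) \<le> e \<and> besov_semi p (\<lambda>x. F k x - F l x) \<le> ennreal e" if "k \<ge> K" "l \<ge> K" for k l
    proof -
      have "ennreal (norm (F k 0 - F l 0)) + besov_semi p (\<lambda>x. F k x - F l x) \<le> ennreal e"
        unfolding besov_norm_eq[OF diff_fin, symmetric] using K[OF that] by (intro ennreal_leI) simp
      then have "ennreal (norm (F k 0 - F l 0)) \<le> ennreal e" "besov_semi p (\<lambda>x. F k x - F l x) \<le> ennreal e"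
        by (meson add_increasing2 add_increasing le_iff_add order_trans zero_le order_refl)+
      then show ?thesis using e by (simp add: ennreal_le_iff)
    qed
    then show ?thesis by blast
  qed
  obtain f where f: "slice_regular f" "\<And>q. q \<notin> ball 0 1 \<Longrightarrow> f q = 0"
    "\<And>q. q \<in> ball 0 1 \<Longrightarrow> (\<lambda>k. F k q) \<longlonglongrightarrow> f q"
    "\<And>q. q \<in> ball 0 1 \<Longrightarrow> (\<lambda>k. deriv_x0 (F k) q) \<longlonglongrightarrow> deriv_x0 f q"
  proof (rule slice_regular_limit[of F])
    show "slice_regular (F k)" for k by (rule F)
    fix r e :: real assume r: "r < 1" and e: "e > 0"
    obtain C where C: "C \<ge> 0" "\<And>f N q. slice_regular f \<Longrightarrow> N \<ge> 0 \<Longrightarrow> besov_semi p f \<le> ennreal N \<Longrightarrow>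
        norm q \<le> r \<Longrightarrow> norm (f q) \<le> norm (f 0) + C * N"
      using besov_local_bound[OF p r] by blast
    \<comment> \<open>Chosen so that the difference at 0, at most \<open>d\<close>, and the growth
      term \<open>C * d\<close> add up to at most \<open>e\<close>.\<close>
    define d where "d = e / (1 + C)"
    have "1 + C > 0" using C(1) by simp
    then have "d > 0" "d * (1 + C) = e" using e by (simp_all add: d_def)
    then have d: "d > 0" "d + C * d = e" by (simp_all add: algebra_simps)
    obtain K where K: "\<And>k l. k \<ge> K \<Longrightarrow> l \<ge> K \<Longrightarrow> norm (F k 0 - F l 0) \<le> d"
      "\<And>k l. k \<ge> K \<Longrightarrow> l \<ge> K \<Longrightarrow> besov_semi p (\<lambda>x. F k x - F l x) \<le> ennreal d"
      using small[OF d(1)] by blast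
    have "norm (F k q - F l q) \<le> e" if kl: "k \<ge> K" "l \<ge> K" and q: "norm q \<le> r" for k l q
    proof -
      have "norm (F k q - F l q) \<le> norm (F k 0 - F l 0) + C * d"
        by (rule C(2)[OF slice_regular_diff[OF F(1) F(1)] less_imp_le[OF d(1)] K(2)[OF kl] q])
      then show ?thesis using K(1)[OF kl] d(2) by linarith
    qed
    then show "\<exists>K. \<forall>k\<ge>K. \<forall>l\<ge>K. \<forall>q. norm q \<le> r \<longrightarrow> norm (F k q - F l q) \<le> e" by blast
  qed blast
  \<comment> \<open>In the Cauchy estimate \<open>k\<close> stays fixed while the second index tends
    to infinity; the seminorm part is then an application of Fatou's lemma on each slice.\<close>
  have lim_small: "\<exists>K. \<forall>k\<ge>K. norm (F k 0 - f 0) \<le> e \<and> besov_semi p (\<lambda>x. F k x - f x) \<le> ennreal e"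
    if e: "e > 0" for e
  proof -
    obtain K where K: "\<And>k l. k \<ge> K \<Longrightarrow> l \<ge> K \<Longrightarrow> norm (F k 0 - F l 0) \<le> e"
      "\<And>k l. k \<ge> K \<Longrightarrow> l \<ge> K \<Longrightarrow> besov_semi p (\<lambda>x. F k x - F l x) \<le> ennreal e"
      using small[OF e] by blast
    have "norm (F k 0 - f 0) \<le> e" if k: "k \<ge> K" for k
    proof -
      have "(\<lambda>l. norm (F k 0 - F l 0)) \<longlonglongrightarrow> norm (F k 0 - f 0)"
        by (intro tendsto_intros f(3)) simp
      then show ?thesis by (rule LIMSEQ_le_const2) (use K(1)[OF k] in blast)
    qed
    moreover have "besov_semi p (\<lambda>x. F k x - f x) \<le> ennreal e" if k: "k \<ge> K" for k
    proof (subst besov_semi_le_iff, safe)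
      fix i assume i: "i \<in> imag_units"
      have ball: "slice i z \<in> ball 0 1" "norm (slice i z) < 1" if "cmod z < 1" for z
        using that by (simp_all add: norm_slice[OF i])
      have le: "slice_int p 1 (\<lambda>z. deriv_x0 (F k) (slice i z) - deriv_x0 (F l) (slice i z)) \<le> ennreal (e powr p)"
        if l: "l \<ge> K" for l
      proof -
        have "slice_int p 1 (\<lambda>z. deriv_x0 (F k) (slice i z) - deriv_x0 (F l) (slice i z))
          = slice_int p 1 (\<lambda>z. deriv_x0 (\<lambda>x. F k x - F l x) (slice i z))"
          by (rule slice_int_cong) (simp add: deriv_x0_linear(2)[OF F(1) ball(2) F(1)])
        then show ?thesis
          using K(2)[OF k l] besov_semi_le_iff[of p e "\<lambda>x. F k x - F l x"] p e i by simp
      qed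
      have "slice_int p 1 (\<lambda>z. deriv_x0 (\<lambda>x. F k x - f x) (slice i z))
        = slice_int p 1 (\<lambda>z. deriv_x0 (F k) (slice i z) - deriv_x0 f (slice i z))"
        by (rule slice_int_cong) (simp add: deriv_x0_linear(2)[OF F(1) ball(2) f(1)])
      also have "\<dots> \<le> ennreal (e powr p)"
      proof (rule slice_int_Fatou[where h = "\<lambda>l z. deriv_x0 (F k) (slice i z) - deriv_x0 (F l) (slice i z)" and L = K])
        show "continuous_on (ball 0 1) (\<lambda>z. deriv_x0 (F k) (slice i z) - deriv_x0 (F l) (slice i z))" for l
          by (intro continuous_on_diff continuous_on_deriv_x0_slice F i)
        show "(\<lambda>l. deriv_x0 (F k) (slice i z) - deriv_x0 (F l) (slice i z)) \<longlonglongrightarrow> deriv_x0 (F k) (slice i z) - deriv_x0 f (slice i z)"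
          if "cmod z < 1" for z
          by (intro tendsto_diff tendsto_const f(4) ball that)
      qed (use p le in auto)
      finally show "slice_int p 1 (\<lambda>z. deriv_x0 (\<lambda>x. F k x - f x) (slice i z)) \<le> ennreal (e powr p)" .
    qed (use p e in auto)
    ultimately show ?thesis by blast
  qed
  \<comment> \<open>Write \<open>f\<close> as F_K minus the difference F_K - f, both of finite
    seminorm; the minus sign is right multiplication by -1.\<close>
  have "besov_semi p f < \<infinity>"
  proof -
    obtain K where K: "besov_semi p (\<lambda>x. F K x - f x) \<le> ennreal 1"
      using lim_small[of 1] by auto
    let ?g = "\<lambda>x. (F K x - f x) *\<^sub>H quat_of_real (-1)"
    have "besov_semi p (\<lambda>x. F K x + ?g x) \<le> besov_semi p (F K) + besov_semi p ?g"
      using p by (intro besov_semi_add_le slice_regular_qmult slice_regular_diff F f) simp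
    also have "\<dots> < \<infinity>"
      using F K p by (simp add: besov_semi_qmult slice_regular_diff f ennreal_mult_less_top le_less_trans[OF K])
    finally show ?thesis by (simp add: qmult_of_real_right)
  qed
  then have "f \<in> besov_space p n"
    unfolding V using f(1,2) by blast
  moreover have "(\<lambda>k. besov_norm p (\<lambda>x. F k x - f x)) \<longlonglongrightarrow> 0"
  proof (rule LIMSEQ_I)
    fix e :: real assume e: "e > 0"
    \<comment> \<open>Two non-strict bounds by e/3 keep the total strictly below
      \<open>e\<close>.\<close>
    obtain K where K: "\<And>k. k \<ge> K \<Longrightarrow> norm (F k 0 - f 0) \<le> e / 3"
      "\<And>k. k \<ge> K \<Longrightarrow> besov_semi p (\<lambda>x. F k x - f x) \<le> ennreal (e / 3)"
      using lim_small[of "e / 3"] e by auto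
    have "norm (besov_norm p (\<lambda>x. F k x - f x) - 0) < e" if k: "k \<ge> K" for k
    proof -
      have "besov_norm p (\<lambda>x. F k x - f x) \<le> norm (F k 0 - f 0) + e / 3"
        by (rule besov_norm_le[OF K(2)[OF k]]) (use e in simp)
      moreover have "besov_norm p (\<lambda>x. F k x - f x) \<ge> 0" by (simp add: besov_norm_def)
      ultimately show ?thesis using K(1)[OF k] e by simp
    qed
    then show "\<exists>K. \<forall>k\<ge>K. norm (besov_norm p (\<lambda>x. F k x - f x) - 0) < e" by blast
  qed
  ultimately show "\<exists>f\<in>besov_space p n. (\<lambda>k. besov_norm p (\<lambda>x. F k x - f x)) \<longlonglongrightarrow> 0"
    by blast
qed

text \<open>The first conjunct certifies that on the space the value of \<open>besov_norm\<close> is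
  never the default 0 that \<open>enn2real\<close> assigns to infinity.\<close>

theorem corollary4p12:
  fixes p :: real and n :: nat
  assumes "p > 1" and "p * real n > 1"
  shows "(\<forall>f\<in>besov_space p n. besov_enorm p f < \<infinity>) \<and>
         right_quat_banach_space (besov_space p n) (besov_norm p)"
proof
  show "\<forall>f\<in>besov_space p n. besov_enorm p f < \<infinity>"
    unfolding besov_space_eq[OF assms] by (auto simp: besov_enorm_eq)
  show "right_quat_banach_space (besov_space p n) (besov_norm p)"
    unfolding right_quat_banach_space_def
    using right_quat_subspace_besov[OF assms] right_quat_norm_on_besov[OF assms]
      norm_complete_on_besov[OF assms] by blast
qed

end
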